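(* Let $\Omega\subset\mathbb{R}$ be a bounded open interval, let $2<p<\infty$, $q=\frac{p}{p-1}$, let $r\ge 2$ be an integer and let $1\le s\le r$. There is a constant $C$, independent of $f$, of $h$ and of the partition, such that the following holds. Let $f\in L^2(\Omega)$, let $(u,v)\in H_0^1(\Omega)\times H_0^1(\Omega)$ be the weak solution, i.e. $$(\nabla v,\nabla\psi)=-(f,\psi), \qquad (\nabla u,\nabla\eta)=-(|v|^{q-2}v,\eta) \qquad \forall\,\psi,\eta\in H_0^1(\Omega),$$ and suppose $u,v\in H^s(\Omega)$. For a partition $\mathcal{T}_h$ of $\Omega$ let $(u_h,v_h)\in V_h\times V_h$ be the discrete solution, i.e. $$(\nabla v_h,\nabla\psi_h) = -(f,\psi_h), \qquad (\nabla u_h,\nabla\eta_h) = -(|v_h|^{q-2}v_h,\eta_h) \qquad \forall\,\psi_h,\eta_h\in V_h .$$ Then $$\|\nabla(v-v_h)\|_{L^2(\Omega)}\le Ch^{s-1}\|v\|_{H^s(\Omega)},$$ $$\|v-v_h\|_{L^2(\Omega)}\le Ch^{s}\|v\|_{H^s(\Omega)},$$ $$\|\nabla(u-u_h)\|_{L^2(\Omega)}\le Ch^{s-1}\|u\|_{H^s(\Omega)}+Ch^{\frac{s}{p-1}}\|v\|_{H^s(\Omega)}^{\frac{1}{p-1}},$$ $$\|u-u_h\|_{L^2(\Omega)}\le Ch^{s}\|u\|_{H^s(\Omega)}+C\left(h^{\frac{s+p-1}{p-1}}+h^{\frac{s}{p-1}}\right)\|v\|_{H^s(\Omega)}^{\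frac{1}{p-1}}.$$
   Context: $(\cdot,\cdot)$ denotes the $L^2(\Omega)$ inner product, and $\nabla$ is the (weak) derivative in dimension one. $\mathcal{T}_h$ is a partition of $\Omega$ into finitely many nondegenerate intervals $T_1,\dots,T_n$ with pairwise disjoint interiors, and $h$ is the mesh size (the maximal length of the $T_k$). For the integer $r\ge 2$, $$V_h=\{w\in C(\overline\Omega): w=0 \text{ on } \partial\Omega,\ w|_{T_k} \text{ is a polynomial of degree at most } r-1 \text{ for every } T_k\in\mathcal{T}_h\}\subset H_0^1(\Omega).$$ The expressions $|v|^{q-2}v$ and $|v_h|^{q-2}v_h$ are understood to be $0$ where $v=0$, respectively $v_h=0$. The constant $C$ may depend on $\Omega$, $p$, $r$ and $s$. *)

theory Defs
  imports "HOL-Analysis.Analysis" "HOL-Computational_Algebra.Polynomial"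
begin

text \<open>Elements of Lebesgue and Sobolev spaces are represented by functions on the whole real line.
  Only their values on the domain matter there, and they may be altered on null sets.\<close>

definition L2_on :: "real set \<Rightarrow> (real \<Rightarrow> real) set" where
  "L2_on \<Omega> = {f \<in> borel_measurable (lebesgue_on \<Omega>). integrable (lebesgue_on \<Omega>) (\<lambda>x. (f x)\<^sup>2)}"

definition L2_inner_on :: "real set \<Rightarrow> (real \<Rightarrow> real) \<Rightarrow> (real \<Rightarrow> real) \<Rightarrow> real" where
  "L2_inner_on \<Omega> f g = (LINT x|lebesgue_on \<Omega>. f x * g x)"

definition L2_norm_on :: "real set \<Rightarrow> (real \<Rightarrow> real) \<Rightarrow> real" where
  "L2_norm_on \<Omega> f = sqrt (L2_inner_on \<Omega> f f)"

text \<open>Smooth functions with compact support inside the domain, extended by zero.\<close>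

definition test_functions :: "real set \<Rightarrow> (real \<Rightarrow> real) set" where
  "test_functions \<Omega> = {\<phi>. (\<forall>k x. ((deriv ^^ k) \<phi>) field_differentiable (at x)) \<and>
     compact (closure {x. \<phi> x \<noteq> 0}) \<and> closure {x. \<phi> x \<noteq> 0} \<subseteq> \<Omega>}"

definition locally_integrable_on :: "real set \<Rightarrow> (real \<Rightarrow> real) \<Rightarrow> bool" where
  "locally_integrable_on \<Omega> f \<longleftrightarrow> (\<forall>K. compact K \<and> K \<subseteq> \<Omega> \<longrightarrow> f absolutely_integrable_on K)"

definition has_weak_deriv :: "real set \<Rightarrow> nat \<Rightarrow> (real \<Rightarrow> real) \<Rightarrow> (real \<Rightarrow> real) \<Rightarrow> bool" where
  "has_weak_deriv \<Omega> k u g \<longleftrightarrow> locally_integrable_on \<Omega> u \<and> locally_integrable_on \<Omega> g \<and>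
     (\<forall>\<phi>\<in>test_functions \<Omega>.
        L2_inner_on \<Omega> u ((deriv ^^ k) \<phi>) = (-1) ^ k * L2_inner_on \<Omega> g \<phi>)"

text \<open>The weak derivative of order \<open>k\<close> is unique up to null sets; some representative is chosen.
  The choice affects no integral below. If there is no weak derivative, the value is arbitrary.\<close>

definition weak_deriv :: "real set \<Rightarrow> nat \<Rightarrow> (real \<Rightarrow> real) \<Rightarrow> real \<Rightarrow> real" where
  "weak_deriv \<Omega> k u = (SOME g. has_weak_deriv \<Omega> k u g)"

abbreviation weak_grad :: "real set \<Rightarrow> (real \<Rightarrow> real) \<Rightarrow> real \<Rightarrow> real" where
  "weak_grad \<Omega> u \<equiv> weak_deriv \<Omega> 1 u"

text \<open>The integrand of the squared Gagliardo (Sobolev-Slobodeckij) seminorm of order \<open>\<theta>\<close>,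
  where \<open>0 < \<theta> < 1\<close>. On the diagonal its value is \<open>0\<close>, which is a null set.\<close>

definition gagliardo_integrand :: "real \<Rightarrow> (real \<Rightarrow> real) \<Rightarrow> real \<times> real \<Rightarrow> real" where
  "gagliardo_integrand \<theta> g = (\<lambda>(x, y). (g x - g y)\<^sup>2 / \<bar>x - y\<bar> powr (1 + 2 * \<theta>))"

text \<open>The Sobolev space of real order \<open>s \<ge> 0\<close>: the usual space of functions with
  square-integrable weak derivatives if \<open>s\<close> is an integer, and the Sobolev-Slobodeckij space
  otherwise, with the fractional seminorm applied to the derivative of order \<open>\<lfloor>s\<rfloor>\<close>.\<close>

definition sobolev :: "real set \<Rightarrow> real \<Rightarrow> (real \<Rightarrow> real) set" where
  "sobolev \<Omega> s = {u \<in> L2_on \<Omega>. (\<forall>k\<le>nat \<lfloor>s\<rfloor>. \<exists>g\<in>L2_on \<Omega>. has_weak_deriv \<Omega> k u g) \<and>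
     (s \<notin> \<int> \<longrightarrow> integrable (lebesgue_on \<Omega> \<Otimes>\<^sub>M lebesgue_on \<Omega>)
                 (gagliardo_integrand (frac s) (weak_deriv \<Omega> (nat \<lfloor>s\<rfloor>) u)))}"

definition sobolev_norm :: "real set \<Rightarrow> real \<Rightarrow> (real \<Rightarrow> real) \<Rightarrow> real" where
  "sobolev_norm \<Omega> s u = sqrt ((\<Sum>k\<le>nat \<lfloor>s\<rfloor>. (L2_norm_on \<Omega> (weak_deriv \<Omega> k u))\<^sup>2) +
     (if s \<in> \<int> then 0
      else LINT z|(lebesgue_on \<Omega> \<Otimes>\<^sub>M lebesgue_on \<Omega>).
             gagliardo_integrand (frac s) (weak_deriv \<Omega> (nat \<lfloor>s\<rfloor>) u) z))"

text \<open>The closure of the test functions in the Sobolev space of order 1.\<close>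

definition sobolev_1_0 :: "real set \<Rightarrow> (real \<Rightarrow> real) set" where
  "sobolev_1_0 \<Omega> = {u \<in> sobolev \<Omega> 1. \<exists>\<phi> :: nat \<Rightarrow> real \<Rightarrow> real.
     (\<forall>n. \<phi> n \<in> test_functions \<Omega>) \<and>
     (\<lambda>n. sobolev_norm \<Omega> 1 (\<lambda>x. u x - \<phi> n x)) \<longlonglongrightarrow> 0}"

text \<open>Partitions consist of closed intervals; \<open>division_of\<close> already requires finiteness and
  disjoint interiors, but allows one-point intervals.\<close>

definition interval_partition :: "real set \<Rightarrow> real set set \<Rightarrow> bool" where
  "interval_partition \<Omega> \<T> \<longleftrightarrow> \<T> division_of (closure \<Omega>) \<and> (\<forall>T\<in>\<T>. interior T \<noteq> {})"

definition mesh_size :: "real set set \<Rightarrow> real" where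
  "mesh_size \<T> = Max (measure lborel ` \<T>)"

definition fe_space :: "real set \<Rightarrow> nat \<Rightarrow> real set set \<Rightarrow> (real \<Rightarrow> real) set" where
  "fe_space \<Omega> r \<T> = {w. continuous_on (closure \<Omega>) w \<and> (\<forall>x\<in>frontier \<Omega>. w x = 0) \<and>
     (\<forall>T\<in>\<T>. \<exists>P :: real poly. degree P \<le> r - 1 \<and> (\<forall>x\<in>T. w x = poly P x))}"

text \<open>The nonlinearity takes the value \<open>0\<close> at \<open>0\<close>, also for \<open>q < 2\<close>.\<close>

definition power_nl :: "real \<Rightarrow> real \<Rightarrow> real" where
  "power_nl q t = \<bar>t\<bar> powr (q - 2) * t"

definition weak_solution ::
  "real set \<Rightarrow> real \<Rightarrow> (real \<Rightarrow> real) \<Rightarrow> (real \<Rightarrow> real) \<Rightarrow> (real \<Rightarrow> real) \<Rightarrow> bool" where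
  "weak_solution \<Omega> q f u v \<longleftrightarrow> u \<in> sobolev_1_0 \<Omega> \<and> v \<in> sobolev_1_0 \<Omega> \<and>
     (\<forall>\<psi>\<in>sobolev_1_0 \<Omega>.
        L2_inner_on \<Omega> (weak_grad \<Omega> v) (weak_grad \<Omega> \<psi>) = - L2_inner_on \<Omega> f \<psi>) \<and>
     (\<forall>\<eta>\<in>sobolev_1_0 \<Omega>.
        L2_inner_on \<Omega> (weak_grad \<Omega> u) (weak_grad \<Omega> \<eta>) =
        - L2_inner_on \<Omega> (\<lambda>x. power_nl q (v x)) \<eta>)"

definition discrete_solution ::
  "real set \<Rightarrow> real \<Rightarrow> nat \<Rightarrow> real set set \<Rightarrow> (real \<Rightarrow> real) \<Rightarrow> (real \<Rightarrow> real) \<Rightarrow> (real \<Rightarrow> real) \<Rightarrow> bool"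
where
  "discrete_solution \<Omega> q r \<T> f u\<^sub>h v\<^sub>h \<longleftrightarrow> u\<^sub>h \<in> fe_space \<Omega> r \<T> \<and> v\<^sub>h \<in> fe_space \<Omega> r \<T> \<and>
     (\<forall>\<psi>\<in>fe_space \<Omega> r \<T>.
        L2_inner_on \<Omega> (weak_grad \<Omega> v\<^sub>h) (weak_grad \<Omega> \<psi>) = - L2_inner_on \<Omega> f \<psi>) \<and>
     (\<forall>\<eta>\<in>fe_space \<Omega> r \<T>.
        L2_inner_on \<Omega> (weak_grad \<Omega> u\<^sub>h) (weak_grad \<Omega> \<eta>) =
        - L2_inner_on \<Omega> (\<lambda>x. power_nl q (v\<^sub>h x)) \<eta>)"

end

theory Submission
  imports Defs
begin

text \<open>In dimension one both weak equations are ordinary integration. A function in the Sobolev space of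
  order 1 is almost everywhere the primitive of its weak derivative, and membership in the closure of
  the test functions forces this primitive to vanish at both end points. Such a pair of a primitive
  and a square-integrable derivative satisfies \<open>L2_primitive\<close>; the finite element functions belong to
  such pairs too, and integration by parts and the Cauchy-Schwarz inequality for such pairs do the
  analytic work. To get there from the definition by test functions, smooth bumps are built from
  \<open>exp (- 1 / x)\<close>, and the fundamental lemma of the calculus of variations and the lemma of du Bois-Reymond are proved. The
  latter also turns the weak equation into one that may be tested with every primitive that vanishes
  at the end points (\<open>weak_equation_extends\<close>), in particular with discrete functions.

  The two components solve the same linear problem with different data: the data of the exact and of
  the discrete equation are both \<open>f\<close> in the first component, and they are the powers of \<open>v\<close> and of the
  discrete approximation of \<open>v\<close> in the second. So one estimate for the linear problem with perturbed
  data suffices (\<open>galerkin_error\<close>, \<open>sobolev_galerkin_error\<close>). Besides the difference of the data it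
  involves the distance of the derivative of the solution from the derivatives of discrete functions.
  This estimate also yields the additional power of the mesh size in the norm of \<open>L\<^sup>2\<close>: in dimension
  one the Green function of a node is a discrete function, so the error at the nodes comes from the
  data alone.

  The distance from the discrete space is estimated by interpolation at the nodes (\<open>fe_interpolation\<close>).
  On an element, the highest derivative is replaced by \<open>0\<close>, or by its mean if \<open>s\<close> is not an integer,
  and integrated repeatedly; each integration gains one power of the length, and the mean gains the
  fractional power (\<open>fractional_Poincare\<close>). No constants arise here, so the estimates can be summed
  over an arbitrary partition.

  Finally the nonlinearity has the Hoelder exponent \<open>q - 1 = 1 / (p - 1)\<close>, and integration over a bounded
  interval carries this over to norms (\<open>power_nl_L2_Hoelder\<close>). The error of \<open>v\<close> in \<open>L\<^sup>2\<close>, raised to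
  this exponent, therefore bounds the perturbation of the data of the second equation.\<close>

section \<open>Smooth functions with compact support\<close>

text \<open>Up to a polynomial factor in \<open>1 / x\<close> this is the standard smooth function that is flat at \<open>0\<close>.
  With the factor the family is closed under differentiation, so smoothness needs no formula for
  the derivatives of higher order.\<close>

definition flat_exp :: "real poly \<Rightarrow> real \<Rightarrow> real" where
  "flat_exp P x = (if x > 0 then poly P (1 / x) * exp (- (1 / x)) else 0)"

lemma poly_exp_tendsto_0: "((\<lambda>y::real. poly P y * exp (- y)) \<longlongrightarrow> 0) at_top"
proof -
  have "((\<lambda>y::real. \<Sum>i\<le>degree P. coeff P i * (y ^ i / exp y)) \<longlongrightarrow> (\<Sum>i\<le>degree P. coeff P i * 0)) at_top"
    by (intro tendsto_sum tendsto_mult tendsto_const tendsto_power_div_exp_0)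
  then show ?thesis
    by (simp add: poly_altdef sum_distrib_right exp_minus divide_inverse mult.assoc)
qed

lemma flat_exp_tendsto_0: "(flat_exp P \<longlongrightarrow> 0) (at 0)"
proof -
  have "((\<lambda>x. poly P (inverse x) * exp (- inverse x)) \<longlongrightarrow> 0) (at_right (0::real))"
    by (rule filterlim_compose[OF poly_exp_tendsto_0 filterlim_inverse_at_top_right])
  moreover have "\<forall>\<^sub>F x in at_right (0::real). poly P (inverse x) * exp (- inverse x) = flat_exp P x"
    by (auto simp: eventually_at_filter flat_exp_def divide_inverse)
  ultimately have "(flat_exp P \<longlongrightarrow> 0) (at_right 0)"
    by (rule Lim_transform_eventually)
  moreover have "\<forall>\<^sub>F x in at_left (0::real). 0 = flat_exp P x"
    by (auto simp: eventually_at_filter flat_exp_def)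
  then have "(flat_exp P \<longlongrightarrow> 0) (at_left 0)"
    by (rule Lim_transform_eventually[OF tendsto_const])
  ultimately show ?thesis by (simp add: filterlim_split_at)
qed

text \<open>At \<open>0\<close> the difference quotient is again a member of the family, namely the one whose
  polynomial has an additional factor \<open>1 / x\<close>, and so it tends to \<open>0\<close>.\<close>

lemma flat_exp_has_derivative:
  "(flat_exp P has_real_derivative flat_exp (monom 1 2 * (P - pderiv P)) x) (at x)"
proof -
  consider "x > 0" | "x < 0" | "x = 0" by linarith
  then show ?thesis
  proof cases
    case 1
    have "((\<lambda>x. poly P (1 / x) * exp (- (1 / x))) has_real_derivative
        flat_exp (monom 1 2 * (P - pderiv P)) x) (at x)"
      using 1 unfolding flat_exp_def
      by (auto intro!: derivative_eq_intros DERIV_chain2[OF poly_DERIV]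
          simp: poly_monom field_simps power2_eq_square)
    then show ?thesis
      by (rule has_field_derivative_transform_within_open[where S="{0<..}"])
         (use 1 in \<open>auto simp: flat_exp_def\<close>)
  next
    case 2
    have "((\<lambda>x. 0) has_real_derivative flat_exp (monom 1 2 * (P - pderiv P)) x) (at x)"
      using 2 by (simp add: flat_exp_def)
    then show ?thesis
      by (rule has_field_derivative_transform_within_open[where S="{..<0}"])
         (use 2 in \<open>auto simp: flat_exp_def\<close>)
  next
    case 3
    have "\<forall>\<^sub>F h in at 0. flat_exp (pCons 0 P) h = (flat_exp P (0 + h) - flat_exp P 0) / h"
      by (auto simp: flat_exp_def eventually_at_filter)
    with flat_exp_tendsto_0[of "pCons 0 P"]
    have "((\<lambda>h. (flat_exp P (0 + h) - flat_exp P 0) / h) \<longlongrightarrow> 0) (at 0)"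
      by (rule Lim_transform_eventually)
    then show ?thesis using 3 by (simp add: DERIV_def flat_exp_def)
  qed
qed

definition smooth :: "(real \<Rightarrow> real) \<Rightarrow> bool" where
  "smooth f \<longleftrightarrow> (\<forall>k x. (deriv ^^ k) f field_differentiable (at x))"

lemma smooth_deriv:
  assumes "smooth f"
  shows "smooth (deriv f)" "(f has_real_derivative deriv f x) (at x)" "continuous_on A f" 
proof -
  show "smooth (deriv f)"
    unfolding smooth_def
  proof (intro allI)
    fix k x
    show "(deriv ^^ k) (deriv f) field_differentiable at x"
      using assms[unfolded smooth_def, rule_format, of "Suc k" x] by (simp add: funpow_swap1)
  qed
  have d: "f field_differentiable at x" for x
    using assms[unfolded smooth_def, rule_format, of 0 x] by simp
  then show "(f has_real_derivative deriv f x) (at x)"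
    by (simp add: field_differentiable_derivI)
  show "continuous_on A f"
    using d by (simp add: continuous_at_imp_continuous_on field_differentiable_imp_continuous_at)
qed

text \<open>A coinduction principle for smoothness.\<close>

lemma smooth_class:
  assumes S: "\<And>f. f \<in> S \<Longrightarrow> \<exists>g\<in>S. \<forall>x. (f has_real_derivative g x) (at x)" and "f \<in> S"
  shows "smooth f"
proof -
  have *: "(deriv ^^ k) f \<in> S" for k
  proof (induction k)
    case (Suc k)
    then obtain g where g: "g \<in> S" "\<forall>x. ((deriv ^^ k) f has_real_derivative g x) (at x)"
      using S by blast
    then have "deriv ((deriv ^^ k) f) = g"
      by (auto simp: DERIV_imp_deriv)
    then show ?case using g by simp
  qed (use assms in simp)
  then show ?thesis
    unfolding smooth_def by (meson S field_differentiable_def)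
qed

lemma smooth_primitive:
  assumes "smooth \<psi>" "\<And>x. (\<phi> has_real_derivative \<psi> x) (at x)"
  shows "smooth \<phi>"
  unfolding smooth_def
proof (intro allI)
  fix k x
  have d: "deriv \<phi> = \<psi>" using assms(2) by (auto simp: DERIV_imp_deriv)
  show "(deriv ^^ k) \<phi> field_differentiable at x"
  proof (cases k)
    case 0 then show ?thesis using assms(2) by (auto simp: field_differentiable_def)
  next
    case (Suc j)
    then have "(deriv ^^ k) \<phi> = (deriv ^^ j) \<psi>" by (simp add: funpow_Suc_right d del: funpow.simps)
    then show ?thesis using assms(1) by (simp add: smooth_def)
  qed
qed

lemma smooth_diff_cmult:
  assumes "smooth f" "smooth g"
  shows "smooth (\<lambda>x. f x - c * g x)"
proof (rule smooth_class)
  show "(\<lambda>x. f x - c * g x) \<in> {\<lambda>x. f x - c * g x |f g. smooth f \<and> smooth g}"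
    using assms by blast
next
  fix e assume "e \<in> {\<lambda>x. f x - c * g x |f g. smooth f \<and> smooth g}"
  then obtain f g where fg: "e = (\<lambda>x. f x - c * g x)" "smooth f" "smooth g" by blast
  have "(e has_real_derivative deriv f x - c * deriv g x) (at x)" for x
    unfolding fg(1) by (intro DERIV_diff DERIV_cmult smooth_deriv(2) fg)
  then show "\<exists>g\<in>{\<lambda>x. f x - c * g x |f g. smooth f \<and> smooth g}. \<forall>x. (e has_real_derivative g x) (at x)"
    using smooth_deriv(1)[OF fg(2)] smooth_deriv(1)[OF fg(3)]
    by (intro bexI[of _ "\<lambda>x. deriv f x - c * deriv g x"]) auto
qed

text \<open>The products alone are not closed under differentiation, because the product rule gives a sum;
  their span is.\<close>

inductive_set bump_span :: "(real \<Rightarrow> real) set" where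
  prod: "(\<lambda>x. flat_exp P (\<alpha> * (x - c)) * flat_exp Q (\<alpha> * (d - x))) \<in> bump_span"
| comb: "f \<in> bump_span \<Longrightarrow> g \<in> bump_span \<Longrightarrow> (\<lambda>x. \<beta> * f x + \<gamma> * g x) \<in> bump_span"

lemma bump_span_deriv: "f \<in> bump_span \<Longrightarrow> \<exists>g\<in>bump_span. \<forall>x. (f has_real_derivative g x) (at x)"
proof (induction rule: bump_span.induct)
  case (prod P \<alpha> c Q d)
  let ?D = "\<lambda>P. monom 1 2 * (P - pderiv P)"
  let ?g = "\<lambda>x. \<alpha> * (flat_exp (?D P) (\<alpha> * (x - c)) * flat_exp Q (\<alpha> * (d - x))) +
      (- \<alpha>) * (flat_exp P (\<alpha> * (x - c)) * flat_exp (?D Q) (\<alpha> * (d - x)))"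
  have "?g \<in> bump_span" by (intro bump_span.intros)
  moreover have "((\<lambda>x. flat_exp P (\<alpha> * (x - c)) * flat_exp Q (\<alpha> * (d - x))) has_real_derivative ?g x) (at x)" for x
    by (auto intro!: derivative_eq_intros DERIV_chain2[OF flat_exp_has_derivative])
  ultimately show ?case by (intro bexI[of _ ?g]) auto
next
  case (comb f g \<beta> \<gamma>)
  then obtain f' g' where *: "f' \<in> bump_span" "g' \<in> bump_span"
    "\<And>x. (f has_real_derivative f' x) (at x)" "\<And>x. (g has_real_derivative g' x) (at x)" by blast
  have "((\<lambda>x. \<beta> * f x + \<gamma> * g x) has_real_derivative \<beta> * f' x + \<gamma> * g' x) (at x)" for x
    by (intro DERIV_add DERIV_cmult *)
  with *(1,2) show ?case
    by (intro bexI[of _ "\<lambda>x. \<beta> * f' x + \<gamma> * g' x"]) (auto intro: bump_span.comb)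
qed

text \<open>As \<open>n\<close> grows, these functions increase to the indicator function of the open interval and
  stay below \<open>1\<close>. They can therefore replace mollifiers: dominated convergence suffices.\<close>

definition bump :: "real \<Rightarrow> real \<Rightarrow> nat \<Rightarrow> real \<Rightarrow> real" where
  "bump c d n x = flat_exp 1 (real (Suc n) * (x - c)) * flat_exp 1 (real (Suc n) * (d - x))"

lemma smooth_bump: "smooth (bump c d n)"
  unfolding bump_def by (rule smooth_class[OF bump_span_deriv bump_span.prod])

lemma bump_bounds: "0 \<le> bump c d n x" "bump c d n x \<le> 1"
  by (auto simp: bump_def flat_exp_def mult_le_one)

lemma bump_outside: "x \<notin> {c<..<d} \<Longrightarrow> bump c d n x = 0"
  by (auto simp: bump_def flat_exp_def zero_less_mult_iff)

lemma bump_inside: "x \<in> {c<..<d} \<Longrightarrow> 0 < bump c d n x"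
  by (auto simp: bump_def flat_exp_def zero_less_mult_iff)

lemma bump_tendsto_1:
  assumes "x \<in> {c<..<d}" shows "(\<lambda>n. bump c d n x) \<longlonglongrightarrow> 1"
proof -
  have *: "(\<lambda>n. exp (- (1 / (real (Suc n) * y)))) \<longlonglongrightarrow> 1" if "y > 0" for y
  proof -
    have "(\<lambda>n. exp (- (inverse (real (Suc n)) * inverse y))) \<longlonglongrightarrow> exp (- (0 * inverse y))"
      by (intro tendsto_intros LIMSEQ_inverse_real_of_nat)
    then show ?thesis by (simp add: field_simps)
  qed
  have "(\<lambda>n. exp (- (1 / (real (Suc n) * (x - c)))) * exp (- (1 / (real (Suc n) * (d - x))))) \<longlonglongrightarrow> 1 * 1"
    using assms by (intro tendsto_mult *) auto
  moreover have "bump c d n x = exp (- (1 / (real (Suc n) * (x - c)))) * exp (- (1 / (real (Suc n) * (d - x))))" for n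
    using assms by (auto simp: bump_def flat_exp_def zero_less_mult_iff)
  ultimately show ?thesis by simp
qed

lemma test_functionsI:
  assumes "smooth \<phi>" "\<And>x. x \<notin> {c..d} \<Longrightarrow> \<phi> x = 0" "{c..d} \<subseteq> \<Omega>"
  shows "\<phi> \<in> test_functions \<Omega>"
proof -
  have *: "closure {x. \<phi> x \<noteq> 0} \<subseteq> {c..d}"
  proof (rule closure_minimal)
    show "{x. \<phi> x \<noteq> 0} \<subseteq> {c..d}" using assms(2) by blast
  qed simp
  then have "bounded (closure {x. \<phi> x \<noteq> 0})"
    using bounded_closed_interval bounded_subset by blast
  then have "compact (closure {x. \<phi> x \<noteq> 0})"
    by (simp add: compact_eq_bounded_closed)
  with * show ?thesis using assms by (auto simp: test_functions_def smooth_def)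
qed

lemma test_functions_smooth: "\<phi> \<in> test_functions \<Omega> \<Longrightarrow> smooth \<phi>"
  by (simp add: test_functions_def smooth_def)

text \<open>The bounds of the support are made strict, so that a degenerate or empty support causes no
  case distinction later.\<close>

lemma test_functions_support:
  assumes "\<phi> \<in> test_functions {a<..<b}" "a < b"
  obtains c d where "a < c" "c < d" "d < b" "\<And>x. x \<notin> {c..d} \<Longrightarrow> \<phi> x = 0"
proof -
  let ?K = "closure {x. \<phi> x \<noteq> 0}"
  have K: "compact ?K" "?K \<subseteq> {a<..<b}" using assms by (auto simp: test_functions_def)
  have in_K: "x \<in> ?K" if "\<phi> x \<noteq> 0" for x using that closure_subset[of "{x. \<phi> x \<noteq> 0}"] by auto
  show thesis
  proof (cases "?K = {}")
    case True
    then have "\<phi> x = 0" for x using in_K by blast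
    then show thesis
      by (intro that[of "(2 * a + b) / 3" "(a + 2 * b) / 3"]) (use assms(2) in auto)
  next
    case False
    obtain l where l: "l \<in> ?K" "\<forall>x\<in>?K. l \<le> x" using compact_attains_inf[OF K(1) False] by blast
    obtain u where u: "u \<in> ?K" "\<forall>x\<in>?K. x \<le> u" using compact_attains_sup[OF K(1) False] by blast
    have "a < l" "u < b" using K l u by auto
    have "l \<le> u" using l u by auto
    show thesis
    proof (rule that[of l "(u + b) / 2"])
      fix x assume "x \<notin> {l..(u + b) / 2}"
      then have "x \<notin> ?K" using l(2) u(2) \<open>u < b\<close> by force
      then show "\<phi> x = 0" using in_K by blast
    qed (use \<open>a < l\<close> \<open>u < b\<close> \<open>l \<le> u\<close> in auto)
  qed
qed

lemma test_functions_deriv: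
  assumes "\<phi> \<in> test_functions {a<..<b}" "a < b"
  shows "deriv \<phi> \<in> test_functions {a<..<b}"
proof -
  obtain c d where cd: "a < c" "c < d" "d < b" "\<And>x. x \<notin> {c..d} \<Longrightarrow> \<phi> x = 0"
    using test_functions_support assms by blast
  show ?thesis
  proof (rule test_functionsI)
    show "smooth (deriv \<phi>)" using assms smooth_deriv test_functions_smooth by blast
    show "{c..d} \<subseteq> {a<..<b}" using cd by auto
    fix x assume x: "x \<notin> {c..d}"
    have "(\<phi> has_real_derivative 0) (at x)"
      by (rule has_field_derivative_transform_within_open[where f="\<lambda>_. 0" and S="- {c..d}"])
         (use x cd in \<open>auto simp: open_Compl\<close>)
    then show "deriv \<phi> x = 0" by (rule DERIV_imp_deriv)
  qed
qed

section \<open>Square-integrable functions\<close>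

lemma L2_on_mult_integrable:
  assumes "f \<in> L2_on S" "g \<in> L2_on S"
  shows "integrable (lebesgue_on S) (\<lambda>x. f x * g x)"
proof (rule Bochner_Integration.integrable_bound)
  show "integrable (lebesgue_on S) (\<lambda>x. (f x)\<^sup>2 + (g x)\<^sup>2)"
    using assms by (auto simp: L2_on_def)
  show "(\<lambda>x. f x * g x) \<in> borel_measurable (lebesgue_on S)"
    using assms by (auto simp: L2_on_def)
  have "\<bar>s * t\<bar> \<le> s\<^sup>2 + t\<^sup>2" for s t :: real
  proof -
    have "2 * (\<bar>s\<bar> * \<bar>t\<bar>) \<le> s\<^sup>2 + t\<^sup>2"
      using sum_squares_bound[of "\<bar>s\<bar>" "\<bar>t\<bar>"] by simp
    moreover have "0 \<le> \<bar>s\<bar> * \<bar>t\<bar>" by simp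
    ultimately show ?thesis unfolding abs_mult by linarith
  qed
  then show "AE x in lebesgue_on S. norm (f x * g x) \<le> norm ((f x)\<^sup>2 + (g x)\<^sup>2)"
    by simp
qed

lemma L2_on_lincomb:
  assumes "f \<in> L2_on S" "g \<in> L2_on S"
  shows "(\<lambda>x. \<alpha> * f x + \<beta> * g x) \<in> L2_on S"
proof -
  have "integrable (lebesgue_on S) (\<lambda>x. \<alpha>\<^sup>2 * (f x)\<^sup>2 + \<beta>\<^sup>2 * (g x)\<^sup>2 + 2 * \<alpha> * \<beta> * (f x * g x))"
    using assms L2_on_mult_integrable[OF assms] by (auto simp: L2_on_def)
  then have "integrable (lebesgue_on S) (\<lambda>x. (\<alpha> * f x + \<beta> * g x)\<^sup>2)"
    by (simp add: power2_sum power_mult_distrib algebra_simps)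
  then show ?thesis using assms by (auto simp: L2_on_def)
qed

lemma L2_on_diff: "f \<in> L2_on S \<Longrightarrow> g \<in> L2_on S \<Longrightarrow> (\<lambda>x. f x - g x) \<in> L2_on S"
  using L2_on_lincomb[of f S g 1 "-1"] by simp

lemma L2_on_const: "S \<in> lmeasurable \<Longrightarrow> (\<lambda>x. c) \<in> L2_on S"
  by (simp add: L2_on_def finite_measure.integrable_const finite_measure_lebesgue_on)

lemma L2_on_integrable: "S \<in> lmeasurable \<Longrightarrow> f \<in> L2_on S \<Longrightarrow> integrable (lebesgue_on S) f"
  using L2_on_mult_integrable[of f S "\<lambda>x. 1"] L2_on_const[of S 1] by simp

lemma L2_on_subset:
  assumes "f \<in> L2_on S" "T \<subseteq> S" "S \<in> sets lebesgue" "T \<in> sets lebesgue"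
  shows "f \<in> L2_on T"
proof -
  have "set_integrable lebesgue S (\<lambda>x. (f x)\<^sup>2)"
    using assms by (simp add: L2_on_def integrable_restrict_space set_integrable_def)
  then have "set_integrable lebesgue T (\<lambda>x. (f x)\<^sup>2)"
    by (rule set_integrable_subset) fact+
  then have "integrable (lebesgue_on T) (\<lambda>x. (f x)\<^sup>2)"
    using assms(4) by (simp add: integrable_restrict_space set_integrable_def)
  moreover have "f \<in> borel_measurable (lebesgue_on T)"
    by (rule measurable_restrict_mono[OF _ assms(2)]) (use assms(1) in \<open>simp add: L2_on_def\<close>)
  ultimately show ?thesis by (simp add: L2_on_def)
qed

lemma L2_on_cong_AE:
  assumes "f \<in> L2_on S" "AE x in lebesgue_on S. g x = f x" "g \<in> borel_measurable (lebesgue_on S)"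
  shows "g \<in> L2_on S"
proof -
  have "integrable (lebesgue_on S) (\<lambda>x. (g x)\<^sup>2) \<longleftrightarrow> integrable (lebesgue_on S) (\<lambda>x. (f x)\<^sup>2)"
    by (rule integrable_cong_AE) (use assms in \<open>auto simp: L2_on_def\<close>)
  then show ?thesis using assms by (simp add: L2_on_def)
qed

lemma L2_inner_cong_AE:
  assumes "f \<in> L2_on S" "g \<in> L2_on S" "f' \<in> L2_on S" "g' \<in> L2_on S"
    "AE x in lebesgue_on S. f x = f' x" "AE x in lebesgue_on S. g x = g' x"
  shows "L2_inner_on S f g = L2_inner_on S f' g'"
  unfolding L2_inner_on_def
proof (rule integral_cong_AE)
  show "AE x in lebesgue_on S. f x * g x = f' x * g' x"
    using assms(5,6) by eventually_elim simp
qed (use assms in \<open>auto simp: L2_on_def\<close>)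

lemma L2_norm_nonneg: "0 \<le> L2_norm_on S f"
  by (simp add: L2_norm_on_def L2_inner_on_def Bochner_Integration.integral_nonneg)

lemma L2_norm_square: "(L2_norm_on S f)\<^sup>2 = L2_inner_on S f f"
  by (simp add: L2_norm_on_def L2_inner_on_def Bochner_Integration.integral_nonneg)

lemma L2_norm_cong_AE:
  assumes "f \<in> L2_on S" "g \<in> L2_on S" "AE x in lebesgue_on S. f x = g x"
  shows "L2_norm_on S f = L2_norm_on S g"
  unfolding L2_norm_on_def using L2_inner_cong_AE[of f S f g g] assms by simp

lemma L2_inner_lincomb:
  assumes "f \<in> L2_on S" "g \<in> L2_on S" "k \<in> L2_on S"
  shows "L2_inner_on S (\<lambda>x. \<alpha> * f x + \<beta> * g x) k = \<alpha> * L2_inner_on S f k + \<beta> * L2_inner_on S g k"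
    and "L2_inner_on S k (\<lambda>x. \<alpha> * f x + \<beta> * g x) = \<alpha> * L2_inner_on S k f + \<beta> * L2_inner_on S k g"
  using L2_on_mult_integrable[OF assms(1,3)] L2_on_mult_integrable[OF assms(2,3)]
  by (simp_all add: L2_inner_on_def distrib_right distrib_left mult.assoc mult.left_commute mult.commute[of "k _"])

lemma L2_inner_diff:
  assumes "f \<in> L2_on S" "g \<in> L2_on S" "k \<in> L2_on S"
  shows "L2_inner_on S (\<lambda>x. f x - g x) k = L2_inner_on S f k - L2_inner_on S g k"
    and "L2_inner_on S k (\<lambda>x. f x - g x) = L2_inner_on S k f - L2_inner_on S k g"
  using L2_inner_lincomb[OF assms, of 1 "-1"] by simp_all

lemma L2_inner_commute: "L2_inner_on S f g = L2_inner_on S g f"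
  by (simp add: L2_inner_on_def mult.commute)

text \<open>The quadratic polynomial \<open>\<parallel>f - t g\<parallel>\<^sup>2\<close> in \<open>t\<close> has no negative value.\<close>

lemma L2_Cauchy_Schwarz:
  assumes f: "f \<in> L2_on S" and g: "g \<in> L2_on S"
  shows "\<bar>L2_inner_on S f g\<bar> \<le> L2_norm_on S f * L2_norm_on S g"
proof -
  let ?A = "L2_inner_on S f f" and ?B = "L2_inner_on S f g" and ?C = "L2_inner_on S g g"
  have q: "0 \<le> ?A - 2 * t * ?B + t\<^sup>2 * ?C" for t
  proof -
    let ?k = "\<lambda>x. 1 * f x + (- t) * g x"
    have "0 \<le> L2_inner_on S ?k ?k"
      by (simp add: L2_inner_on_def Bochner_Integration.integral_nonneg)
    also have "\<dots> = 1 * (1 * ?A + (- t) * ?B) + (- t) * (1 * L2_inner_on S g f + (- t) * ?C)"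
      using L2_inner_lincomb(1)[OF f g L2_on_lincomb[OF f g, of 1 "-t"], of 1 "-t"]
        L2_inner_lincomb(2)[OF f g f, of 1 "-t"] L2_inner_lincomb(2)[OF f g g, of 1 "-t"]
      by (simp only:)
    finally show ?thesis
      by (simp add: L2_inner_commute[of S g f] power2_eq_square algebra_simps)
  qed
  have C: "0 \<le> ?C" by (metis L2_norm_square zero_le_power2)
  have "?B\<^sup>2 \<le> ?A * ?C"
  proof (cases "?C = 0")
    case True
    have "?B = 0"
    proof (rule ccontr)
      assume "?B \<noteq> 0"
      then show False using q[of "(?A + 1) / (2 * ?B)"] True by simp
    qed
    with True show ?thesis by simp
  next
    case False
    then have "0 \<le> (?A - 2 * (?B / ?C) * ?B + (?B / ?C)\<^sup>2 * ?C) * ?C"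
      using q[of "?B / ?C"] C by simp
    also have "\<dots> = ?A * ?C - ?B\<^sup>2"
      using False by (simp add: field_simps power2_eq_square)
    finally show ?thesis by simp
  qed
  then have "?B\<^sup>2 \<le> (L2_norm_on S f * L2_norm_on S g)\<^sup>2"
    by (simp add: power_mult_distrib L2_norm_square)
  then have "\<bar>?B\<bar> \<le> \<bar>L2_norm_on S f * L2_norm_on S g\<bar>"
    by (simp only: abs_le_square_iff)
  then show ?thesis by (simp add: L2_norm_nonneg)
qed

lemma L2_norm_triangle:
  assumes f: "f \<in> L2_on S" and g: "g \<in> L2_on S"
  shows "L2_norm_on S (\<lambda>x. f x + g x) \<le> L2_norm_on S f + L2_norm_on S g"
proof -
  let ?k = "\<lambda>x. 1 * f x + 1 * g x"
  have "(L2_norm_on S ?k)\<^sup>2 = L2_inner_on S f f + 2 * L2_inner_on S f g + L2_inner_on S g g"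
    unfolding L2_norm_square
    using L2_inner_lincomb(1)[OF f g L2_on_lincomb[OF f g, of 1 1], of 1 1]
      L2_inner_lincomb(2)[OF f g f, of 1 1] L2_inner_lincomb(2)[OF f g g, of 1 1]
      L2_inner_commute[of S g f] by simp
  also have "\<dots> \<le> (L2_norm_on S f + L2_norm_on S g)\<^sup>2"
    using L2_Cauchy_Schwarz[OF f g] by (simp add: power2_sum L2_norm_square)
  finally show ?thesis
    using power2_le_imp_le[of "L2_norm_on S ?k"] L2_norm_nonneg[of S f] L2_norm_nonneg[of S g] by simp
qed

lemma L2_norm_diff_commute: "L2_norm_on S (\<lambda>x. f x - g x) = L2_norm_on S (\<lambda>x. g x - f x)"
  by (simp add: L2_norm_on_def L2_inner_on_def algebra_simps)

lemma absolutely_integrable_on_open_interval_real: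
  fixes f :: "real \<Rightarrow> real"
  shows "f absolutely_integrable_on {c<..<d} \<longleftrightarrow> f absolutely_integrable_on {c..d}"
  unfolding absolutely_integrable_on_def integrable_on_open_interval_real ..

lemma L2_on_Icc:
  assumes "f \<in> L2_on {c<..<d}"
  shows "f absolutely_integrable_on {c..d}"
proof -
  have "integrable (lebesgue_on {c<..<d}) f"
    using assms by (intro L2_on_integrable) simp_all
  then have "f absolutely_integrable_on {c<..<d}"
    by (simp add: integrable_restrict_space set_integrable_def)
  then show ?thesis by (simp add: absolutely_integrable_on_open_interval_real)
qed

text \<open>The bridge between the Lebesgue integrals of the definitions and the gauge integral over closed
  intervals, for which splitting and the fundamental theorem of calculus are available.\<close>

lemma L2_inner_Icc:
  assumes "f \<in> L2_on {c<..<d}" "g \<in> L2_on {c<..<d}"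
  shows "(\<lambda>x. f x * g x) absolutely_integrable_on {c..d}"
    and "L2_inner_on {c<..<d} f g = integral {c..d} (\<lambda>x. f x * g x)"
proof -
  have i: "integrable (lebesgue_on {c<..<d}) (\<lambda>x. f x * g x)"
    by (rule L2_on_mult_integrable[OF assms])
  then have "(\<lambda>x. f x * g x) absolutely_integrable_on {c<..<d}"
    by (simp add: integrable_restrict_space set_integrable_def)
  then show "(\<lambda>x. f x * g x) absolutely_integrable_on {c..d}"
    by (simp add: absolutely_integrable_on_open_interval_real)
  show "L2_inner_on {c<..<d} f g = integral {c..d} (\<lambda>x. f x * g x)"
    unfolding L2_inner_on_def using lebesgue_integral_eq_integral[OF i] 
    by (simp add: integral_open_interval_real)
qed

lemma L2_on_IccI:
  assumes "g absolutely_integrable_on {c..d}" "(\<lambda>x. (g x)\<^sup>2) integrable_on {c..d}"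
  shows "g \<in> L2_on {c<..<d}"
proof -
  have "(\<lambda>x. (g x)\<^sup>2) absolutely_integrable_on {c<..<d}"
    using assms(2) by (simp add: absolutely_integrable_on_open_interval_real
        nonnegative_absolutely_integrable_1)
  moreover have "g absolutely_integrable_on {c<..<d}"
    using assms by (simp add: absolutely_integrable_on_open_interval_real)
  ultimately show ?thesis
    using absolutely_integrable_measurable[of "{c<..<d}" g]
    by (simp add: L2_on_def integrable_restrict_space set_integrable_def)
qed

lemma L2_on_continuous:
  assumes "continuous_on {c..d} g"
  shows "g \<in> L2_on {c<..<d}"
  by (intro L2_on_IccI absolutely_integrable_continuous_real integrable_continuous_real
      continuous_intros assms)

section \<open>The fundamental lemma of the calculus of variations\<close>

text \<open>A factor with compact support turns a function that is only locally integrable into an integrable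
  one, and the integral becomes one over a compact interval.\<close>

lemma L2_inner_compact_support:
  assumes "locally_integrable_on \<Omega> g" "continuous_on UNIV \<phi>"
    and "{c..d} \<subseteq> \<Omega>" "\<And>x. x \<notin> {c..d} \<Longrightarrow> \<phi> x = 0" "\<Omega> \<in> sets lebesgue"
  shows "(\<lambda>x. g x * \<phi> x) absolutely_integrable_on {c..d}"
    and "integrable (lebesgue_on \<Omega>) (\<lambda>x. g x * \<phi> x)"
    and "L2_inner_on \<Omega> g \<phi> = integral {c..d} (\<lambda>x. g x * \<phi> x)"
proof -
  have g: "g absolutely_integrable_on {c..d}"
    using assms by (auto simp: locally_integrable_on_def)
  have c: "continuous_on {c..d} \<phi>" using assms(2) continuous_on_subset by blast
  have "bounded (\<phi> ` {c..d})"
    using c compact_Icc compact_continuous_image compact_imp_bounded by blast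
  then have "(\<lambda>x. \<phi> x * g x) absolutely_integrable_on {c..d}"
    using g c by (intro absolutely_integrable_bounded_measurable_product_real)
      (auto intro: continuous_imp_measurable_on_sets_lebesgue)
  then show i: "(\<lambda>x. g x * \<phi> x) absolutely_integrable_on {c..d}"
    by (simp add: mult.commute)
  have eq: "indicat_real \<Omega> x *\<^sub>R (g x * \<phi> x) = indicat_real {c..d} x *\<^sub>R (g x * \<phi> x)" for x
    using assms(3,4) by (cases "x \<in> {c..d}") (auto simp: indicator_def)
  show "integrable (lebesgue_on \<Omega>) (\<lambda>x. g x * \<phi> x)"
    using i assms(5) by (simp add: integrable_restrict_space eq set_integrable_def del: real_scaleR_def)
  have "L2_inner_on \<Omega> g \<phi> = set_lebesgue_integral lebesgue {c..d} (\<lambda>x. g x * \<phi> x)"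
    using assms(5) by (simp add: L2_inner_on_def integral_restrict_space eq
        set_lebesgue_integral_def del: real_scaleR_def)
  then show "L2_inner_on \<Omega> g \<phi> = integral {c..d} (\<lambda>x. g x * \<phi> x)"
    using set_lebesgue_integral_eq_integral(2)[OF i] by simp
qed

text \<open>Lebesgue differentiation: almost every value of \<open>g\<close> is a limit of means over short intervals.\<close>

lemma zero_if_interval_integrals_zero:
  fixes g :: "real \<Rightarrow> real"
  assumes g: "g absolutely_integrable_on {c..d}"
    and z: "\<And>x y. c \<le> x \<Longrightarrow> x \<le> y \<Longrightarrow> y \<le> d \<Longrightarrow> integral {x..y} g = 0"
  shows "\<exists>N. negligible N \<and> (\<forall>x\<in>{c<..<d} - N. g x = 0)"
proof -
  \<comment> \<open>The differentiation theorem is about functions that are integrable over all intervals.\<close>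
  define f where "f x = (if x \<in> {c..d} then g x else 0)" for x
  have gi: "g integrable_on {c..d}" using g absolutely_integrable_on_def by blast
  have "f integrable_on UNIV"
    unfolding f_def using gi by (simp only: integrable_restrict_UNIV)
  then have "f integrable_on cbox x y" for x y
    using integrable_on_subcbox by blast
  then obtain N where N: "negligible N"
    "\<And>x e. \<lbrakk>x \<notin> N; 0 < e\<rbrakk> \<Longrightarrow> \<exists>d>0. \<forall>h. 0 < h \<and> h < d \<longrightarrow>
        norm (integral (cbox x (x + h *\<^sub>R One)) f /\<^sub>R h ^ DIM(real) - f x) < e"
    using integrable_ccontinuous_explicit[of f] by blast
  have "g x = 0" if x: "x \<in> {c<..<d} - N" for x
  proof (rule ccontr)
    assume "g x \<noteq> 0"
    then obtain \<delta> where \<delta>: "\<delta> > 0"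
      "\<And>h. 0 < h \<and> h < \<delta> \<Longrightarrow> norm (integral (cbox x (x + h *\<^sub>R One)) f /\<^sub>R h ^ DIM(real) - f x) < \<bar>g x\<bar>"
      using N(2)[of x "\<bar>g x\<bar>"] x by auto
    define h where "h = min (\<delta> / 2) (d - x)"
    have h: "0 < h" "h < \<delta>" "x + h \<le> d" using \<delta>(1) x by (auto simp: h_def)
    have "integral {x..x + h} f = integral {x..x + h} g"
      by (rule integral_cong) (use x h in \<open>auto simp: f_def\<close>)
    also have "\<dots> = 0" using z[of x "x + h"] x h by auto
    finally show False using \<delta>(2)[of h] h x by (simp add: f_def)
  qed
  with N(1) show ?thesis by blast
qed

text \<open>Countably many intervals with rational end points exhaust the open interval.\<close>

lemma AE_open_interval_exhaustion:
  fixes a b :: real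
  assumes "\<And>c d. a < c \<Longrightarrow> c < d \<Longrightarrow> d < b \<Longrightarrow> \<exists>N. negligible N \<and> (\<forall>x\<in>{c<..<d} - N. P x)"
  shows "AE x in lebesgue_on {a<..<b}. P x"
proof -
  define I where "I = {(c, d) \<in> \<rat> \<times> \<rat>. a < c \<and> c < d \<and> d < b}"
  have "countable I"
    by (rule countable_subset[of _ "\<rat> \<times> \<rat>"]) (auto simp: I_def countable_rat)
  obtain N where N: "\<And>c d. (c, d) \<in> I \<Longrightarrow> negligible (N (c, d)) \<and> (\<forall>x\<in>{c<..<d} - N (c, d). P x)"
  proof -
    have "\<forall>z\<in>I. \<exists>N. negligible N \<and> (\<forall>x\<in>{fst z<..<snd z} - N. P x)"
      using assms by (auto simp: I_def)
    then obtain N where "\<forall>z\<in>I. negligible (N z) \<and> (\<forall>x\<in>{fst z<..<snd z} - N z. P x)"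
      by (rule bchoice[THEN exE])
    then show thesis by (intro that[of N]) auto
  qed
  have "negligible (\<Union>z\<in>I. N z)"
    using \<open>countable I\<close> N by (intro negligible_countable_Union) auto
  moreover have "P x" if x: "x \<in> {a<..<b}" "x \<notin> (\<Union>z\<in>I. N z)" for x
  proof -
    obtain c where "c \<in> \<rat>" "a < c" "c < x" using x Rats_dense_in_real[of a x] by auto
    moreover obtain d where "d \<in> \<rat>" "x < d" "d < b" using x Rats_dense_in_real[of x b] by auto
    ultimately have "(c, d) \<in> I" "x \<in> {c<..<d}" by (auto simp: I_def)
    then show ?thesis using N x(2) by blast
  qed
  ultimately have "AE x in lebesgue. x \<in> {a<..<b} \<longrightarrow> P x"
    unfolding eventually_ae_filter_negligible by (intro exI[of _ "\<Union>z\<in>I. N z"]) auto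
  then show ?thesis by (subst AE_restrict_space_iff) auto
qed

text \<open>Bumps supported in \<open>{x..y}\<close> tend to the indicator function of the interval, so the integral of
  \<open>g\<close> over each compact subinterval is \<open>0\<close>.\<close>

lemma fundamental_lemma_variations:
  assumes g: "locally_integrable_on {a<..<b} g"
    and z: "\<And>\<phi>. \<phi> \<in> test_functions {a<..<b} \<Longrightarrow> L2_inner_on {a<..<b} g \<phi> = 0"
  shows "AE x in lebesgue_on {a<..<b}. g x = 0"
proof (rule AE_open_interval_exhaustion, rule zero_if_interval_integrals_zero)
  fix c d :: real assume cd: "a < c" "c < d" "d < b"
  show gc: "g absolutely_integrable_on {c..d}"
    using cd by (intro g[unfolded locally_integrable_on_def, rule_format]) auto
  fix x y assume xy: "c \<le> x" "x \<le> y" "y \<le> d"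
  have gi: "g absolutely_integrable_on {x..y}"
    using absolutely_integrable_on_subinterval[OF gc] xy by auto
  have sub: "{x..y} \<subseteq> {a<..<b}" using xy cd by auto
  have out: "bump x y n t = 0" if "t \<notin> {x..y}" for n t
    using that by (intro bump_outside) auto
  note b = L2_inner_compact_support[OF g smooth_deriv(3)[OF smooth_bump] sub out, simplified]
  have "bump x y n \<in> test_functions {a<..<b}" for n
    by (rule test_functionsI[OF smooth_bump out sub])
  then have "integral {x<..<y} (\<lambda>t. g t * bump x y n t) = 0" for n
    using z b(3) by (simp add: integral_open_interval_real)
  moreover have "(\<lambda>n. integral {x<..<y} (\<lambda>t. g t * bump x y n t)) \<longlonglongrightarrow> integral {x<..<y} g"
  proof (rule dominated_convergence(2)[where h="\<lambda>t. \<bar>g t\<bar>"])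
    show "(\<lambda>t. g t * bump x y n t) integrable_on {x<..<y}" for n
      using b(1)[of n] absolutely_integrable_on_def integrable_on_open_interval_real by blast
    show "(\<lambda>t. \<bar>g t\<bar>) integrable_on {x<..<y}"
      using gi integrable_on_open_interval_real[of "\<lambda>t. \<bar>g t\<bar>"]
      by (auto simp: absolutely_integrable_on_def)
    show "norm (g t * bump x y n t) \<le> \<bar>g t\<bar>" for n t
      using bump_bounds[of x y n t] by (simp add: abs_mult mult_left_le)
    show "(\<lambda>n. g t * bump x y n t) \<longlonglongrightarrow> g t" if "t \<in> {x<..<y}" for t
      using tendsto_mult_left[OF bump_tendsto_1[OF that], of "g t"] by simp
  qed
  ultimately show "integral {x..y} g = 0"
    by (simp add: LIMSEQ_const_iff integral_open_interval_real)
qed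

section \<open>Primitives of square-integrable functions\<close>

lemma integrable_prod_mult:
  fixes f g :: "real \<Rightarrow> real"
  assumes "sigma_finite_measure M" "integrable M f" "integrable M g"
  shows "integrable (M \<Otimes>\<^sub>M M) (\<lambda>(x, y). f x * g y)"
    and "(LINT z|(M \<Otimes>\<^sub>M M). (\<lambda>(x, y). f x * g y) z) = (LINT x|M. f x) * (LINT x|M. g x)"
proof -
  interpret sigma_finite_measure M by fact
  interpret P: pair_sigma_finite M M ..
  have [measurable]: "f \<in> borel_measurable M" "g \<in> borel_measurable M" using assms by auto
  show i: "integrable (M \<Otimes>\<^sub>M M) (\<lambda>(x, y). f x * g y)"
    by (rule P.Fubini_integrable) (use assms in \<open>auto simp: abs_mult\<close>)
  show "(LINT z|(M \<Otimes>\<^sub>M M). (\<lambda>(x, y). f x * g y) z) = (LINT x|M. f x) * (LINT x|M. g x)"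
    using P.integral_fst'[OF i] by simp
qed

text \<open>Integration by parts for primitives of functions that are merely integrable. The product
  \<open>f x * g y\<close> is integrated over the square; the two triangles \<open>x \<le> y\<close> and \<open>y < x\<close> give the two
  integrals on the left by Fubini's theorem.\<close>

lemma integral_by_parts_primitives:
  fixes f g :: "real \<Rightarrow> real"
  assumes f: "f absolutely_integrable_on {a..b}" and g: "g absolutely_integrable_on {a..b}"
  shows "integral {a..b} (\<lambda>x. integral {a..x} f * g x) + integral {a..b} (\<lambda>x. f x * integral {a..x} g)
    = integral {a..b} f * integral {a..b} g"
proof -
  let ?M = "lebesgue_on {a..b}"
  interpret finite_measure ?M by (rule finite_measure_lebesgue_on) simp
  interpret P: pair_sigma_finite ?M ?M ..
  have fi: "integrable ?M f" and gi: "integrable ?M g"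
    using f g by (simp_all add: integrable_restrict_space set_integrable_def)
  have [measurable]: "f \<in> borel_measurable ?M" "g \<in> borel_measurable ?M" using fi gi by auto
  have [measurable]: "fst \<in> borel_measurable (?M \<Otimes>\<^sub>M ?M)" "snd \<in> borel_measurable (?M \<Otimes>\<^sub>M ?M)"
    by (auto intro!: measurable_compose[OF measurable_fst] measurable_compose[OF measurable_snd]
        measurable_restrict_space1 simp: id_def[symmetric])
  have I: "integrable (?M \<Otimes>\<^sub>M ?M) (\<lambda>(x, y). f x * g y)"
    "(LINT z|(?M \<Otimes>\<^sub>M ?M). (\<lambda>(x, y). f x * g y) z) = (LINT x|?M. f x) * (LINT x|?M. g x)"
    by (rule integrable_prod_mult[OF sigma_finite_measure_axioms fi gi])+
  define k where "k = (\<lambda>(x, y). if x \<le> y then f x * g y else 0)"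
  define l where "l = (\<lambda>(x, y). if y < x then f x * g y else 0)"
  have k: "integrable (?M \<Otimes>\<^sub>M ?M) k"
    by (rule Bochner_Integration.integrable_bound[OF I(1)]) (auto simp: k_def split_beta)
  have l: "integrable (?M \<Otimes>\<^sub>M ?M) l"
    by (rule Bochner_Integration.integrable_bound[OF I(1)]) (auto simp: l_def split_beta)
  have part: "(LINT x|?M. (if x \<in> S then h x else 0)) = integral {a..y} h"
    if h: "h absolutely_integrable_on {a..b}" and y: "y \<in> {a..b}"
      and S: "{a..<y} \<subseteq> S" "S \<subseteq> {..y}" for h :: "real \<Rightarrow> real" and S y
  proof -
    have hy: "h absolutely_integrable_on {a..y}"
      by (rule absolutely_integrable_on_subinterval[OF h]) (use y in auto)
    have "(LINT x|?M. (if x \<in> S then h x else 0)) = (LINT x|?M. indicat_real {a..y} x * h x)"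
    proof (rule integral_cong_AE)
      have "AE x in lebesgue. x \<noteq> y"
        unfolding eventually_ae_filter_negligible by (intro exI[of _ "{y}"]) auto
      then have "AE x in ?M. x \<noteq> y" by (subst AE_restrict_space_iff) auto
      then show ae: "AE x in ?M. (if x \<in> S then h x else 0) = indicat_real {a..y} x * h x"
        using AE_space
      proof eventually_elim
        case (elim x)
        then have "x \<in> S \<longleftrightarrow> x \<in> {a..y}" using S by force
        then show ?case by (simp add: indicator_def)
      qed
      have h': "h \<in> borel_measurable ?M"
        using iffD1[OF absolutely_integrable_measurable h] by simp
      have "S \<inter> {a..b} = {a..<y} \<or> S \<inter> {a..b} = {a..y}"
      proof (cases "y \<in> S")
        case True
        then have "x \<in> S \<inter> {a..b} \<longleftrightarrow> x \<in> {a..y}" for x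
          using S y by (cases "x = y") force+
        then show ?thesis by blast
      next
        case False
        then have "x \<in> S \<inter> {a..b} \<longleftrightarrow> x \<in> {a..<y}" for x
          using S y by (cases "x = y") force+
        then show ?thesis by blast
      qed
      then have "S \<inter> {a..b} \<in> sets lebesgue" by auto
      then have [measurable]: "S \<inter> {a..b} \<in> sets ?M" by (auto simp: sets_restrict_space)
      have "(\<lambda>x. if x \<in> S \<inter> {a..b} then h x else 0) \<in> borel_measurable ?M"
        using h' by measurable
      then show "(\<lambda>x. if x \<in> S then h x else 0) \<in> borel_measurable ?M"
        by (rule measurable_cong[THEN iffD1, rotated]) simp
      have "{a..y} \<in> sets ?M" using y by (auto simp: sets_restrict_space)
      then show "(\<lambda>x. indicat_real {a..y} x * h x) \<in> borel_measurable ?M" using h' by measurable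
    qed
    also have "\<dots> = set_lebesgue_integral lebesgue {a..y} h"
      unfolding set_lebesgue_integral_def using y
      by (auto simp: integral_restrict_space indicator_def intro!: Bochner_Integration.integral_cong)
    finally show ?thesis using set_lebesgue_integral_eq_integral(2)[OF hy] by simp
  qed
  have c: "continuous_on {a..b} (\<lambda>x. integral {a..x} h)" if "h absolutely_integrable_on {a..b}" for h :: "real \<Rightarrow> real"
    using that by (intro indefinite_integral_continuous_1) (simp add: absolutely_integrable_on_def)
  have pi: "(\<lambda>x. integral {a..x} h * h' x) absolutely_integrable_on {a..b}"
    if "h absolutely_integrable_on {a..b}" "h' absolutely_integrable_on {a..b}" for h h' :: "real \<Rightarrow> real"
    using c[OF that(1)] that(2)
    by (intro absolutely_integrable_bounded_measurable_product_real)
      (auto intro: continuous_imp_measurable_on_sets_lebesgue compact_imp_bounded compact_continuous_image)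
  have eqL: "(LINT x|?M. h x) = integral {a..b} h" if "h absolutely_integrable_on {a..b}" for h :: "real \<Rightarrow> real"
    using lebesgue_integral_eq_integral[of "{a..b}" h] that by (simp add: integrable_restrict_space set_integrable_def)
  have "integral\<^sup>L (?M \<Otimes>\<^sub>M ?M) k = (LINT y|?M. LINT x|?M. k (x, y))"
    using P.integral_snd[of "curry k"] k by simp
  also have "\<dots> = (LINT y|?M. integral {a..y} f * g y)"
  proof (rule Bochner_Integration.integral_cong[OF refl])
    fix y assume y: "y \<in> space ?M"
    have "(LINT x|?M. k (x, y)) = (LINT x|?M. (if x \<in> {..y} then f x else 0) * g y)"
      by (intro Bochner_Integration.integral_cong) (auto simp: k_def)
    also have "\<dots> = (LINT x|?M. (if x \<in> {..y} then f x else 0)) * g y"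
      by simp
    also have "\<dots> = integral {a..y} f * g y" by (subst part[OF f]) (use y in auto)
    finally show "(LINT x|?M. k (x, y)) = integral {a..y} f * g y" .
  qed
  also have "\<dots> = integral {a..b} (\<lambda>x. integral {a..x} f * g x)"
    by (rule eqL[OF pi[OF f g]])
  finally have 1: "integral\<^sup>L (?M \<Otimes>\<^sub>M ?M) k = integral {a..b} (\<lambda>x. integral {a..x} f * g x)" .
  have "integral\<^sup>L (?M \<Otimes>\<^sub>M ?M) l = (LINT x|?M. LINT y|?M. l (x, y))"
    using P.integral_fst'[OF l] by simp
  also have "\<dots> = (LINT x|?M. integral {a..x} g * f x)"
  proof (rule Bochner_Integration.integral_cong[OF refl])
    fix x assume x: "x \<in> space ?M"
    have "(LINT y|?M. l (x, y)) = (LINT y|?M. (if y \<in> {..<x} then g y else 0) * f x)"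
      by (intro Bochner_Integration.integral_cong) (auto simp: l_def)
    also have "\<dots> = (LINT y|?M. (if y \<in> {..<x} then g y else 0)) * f x"
      by simp
    also have "\<dots> = integral {a..x} g * f x" by (subst part[OF g, of x]) (use x in auto)
    finally show "(LINT y|?M. l (x, y)) = integral {a..x} g * f x" .
  qed
  also have "\<dots> = integral {a..b} (\<lambda>x. f x * integral {a..x} g)"
    using eqL[OF pi[OF g f]] by (simp add: mult.commute)
  finally have 2: "integral\<^sup>L (?M \<Otimes>\<^sub>M ?M) l = integral {a..b} (\<lambda>x. f x * integral {a..x} g)" .
  have "integral\<^sup>L (?M \<Otimes>\<^sub>M ?M) k + integral\<^sup>L (?M \<Otimes>\<^sub>M ?M) l = (LINT z|(?M \<Otimes>\<^sub>M ?M). k z + l z)"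
    using k l by simp
  also have "\<dots> = (LINT z|(?M \<Otimes>\<^sub>M ?M). (\<lambda>(x, y). f x * g y) z)"
    by (intro Bochner_Integration.integral_cong) (auto simp: k_def l_def)
  also have "\<dots> = integral {a..b} f * integral {a..b} g"
    unfolding I(2) using eqL[OF f] eqL[OF g] by simp
  finally show ?thesis unfolding 1 2 .
qed

text \<open>In dimension one, the Sobolev space of order 1 consists of these functions, up to null sets.
  The pair of the continuous representative and its derivative is kept together, since the derivative is determined only up to null sets.\<close>

definition L2_primitive :: "real \<Rightarrow> real \<Rightarrow> (real \<Rightarrow> real) \<Rightarrow> (real \<Rightarrow> real) \<Rightarrow> bool" where
  "L2_primitive a b U g \<longleftrightarrow> g \<in> L2_on {a<..<b} \<and> (\<forall>x\<in>{a..b}. U x = U a + integral {a..x} g)"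

lemma L2_primitive_integrable:
  assumes "L2_primitive a b U g" shows "g absolutely_integrable_on {a..b}" "g integrable_on {a..b}"
  using assms L2_on_Icc by (auto simp: L2_primitive_def absolutely_integrable_on_def)

lemma L2_primitiveD: "L2_primitive a b U g \<Longrightarrow> a \<le> x \<Longrightarrow> x \<le> b \<Longrightarrow> U x = U a + integral {a..x} g"
  unfolding L2_primitive_def by (meson atLeastAtMost_iff)

lemma L2_primitive_L2_deriv: "L2_primitive a b U g \<Longrightarrow> g \<in> L2_on {a<..<b}"
  unfolding L2_primitive_def by blast

lemma L2_primitive_integrable_sub:
  assumes "L2_primitive a b U g" "a \<le> c" "d \<le> b" shows "g integrable_on {c..d}"
  by (rule integrable_on_subinterval[OF L2_primitive_integrable(2)[OF assms(1)]]) (use assms(2,3) in auto)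

lemma L2_primitive_increment:
  assumes U: "L2_primitive a b U g" and "a \<le> c" "c \<le> d" "d \<le> b"
  shows "U d - U c = integral {c..d} g"
proof -
  have "integral {a..c} g + integral {c..d} g = integral {a..d} g"
    by (intro Henstock_Kurzweil_Integration.integral_combine L2_primitive_integrable_sub[OF U])
      (use assms(2-4) in simp_all)
  moreover have "U d = U a + integral {a..d} g" "U c = U a + integral {a..c} g"
    by (rule L2_primitiveD[OF U]; use assms(2-4) in simp)+
  ultimately show ?thesis by simp
qed

lemma L2_primitive_sub:
  assumes U: "L2_primitive a b U g" and "a \<le> c" "d \<le> b"
  shows "L2_primitive c d U g"
  unfolding L2_primitive_def
proof
  show "g \<in> L2_on {c<..<d}"
    by (rule L2_on_subset[of _ "{a<..<b}"]) (use L2_primitive_L2_deriv[OF U] assms(2,3) in auto)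
  show "\<forall>x\<in>{c..d}. U x = U c + integral {c..x} g"
  proof
    fix x assume "x \<in> {c..d}"
    then show "U x = U c + integral {c..x} g"
      using L2_primitive_increment[OF U, of c x] assms by auto
  qed
qed

lemma L2_primitive_continuous:
  assumes U: "L2_primitive a b U g" shows "continuous_on {a..b} U"
proof -
  have "continuous_on {a..b} (\<lambda>x. U a + integral {a..x} g)"
    by (intro continuous_intros indefinite_integral_continuous_1 L2_primitive_integrable(2)[OF U])
  then show ?thesis
    by (rule continuous_on_eq) (use L2_primitiveD[OF U, symmetric] in simp)
qed

lemma L2_primitive_L2: "L2_primitive a b U g \<Longrightarrow> U \<in> L2_on {a<..<b}" "L2_primitive a b U g \<Longrightarrow> g \<in> L2_on {a<..<b}"
  by (simp_all add: L2_on_continuous L2_primitive_continuous L2_primitive_L2_deriv)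

lemma L2_primitive_diff:
  assumes "L2_primitive a b U g" "L2_primitive a b V h"
  shows "L2_primitive a b (\<lambda>x. U x - V x) (\<lambda>x. g x - h x)"
  unfolding L2_primitive_def
proof (intro conjI ballI)
  show "(\<lambda>x. g x - h x) \<in> L2_on {a<..<b}" using assms L2_on_diff L2_primitive_L2_deriv by blast
  fix x assume x: "x \<in> {a..b}"
  have "integral {a..x} (\<lambda>x. g x - h x) = integral {a..x} g - integral {a..x} h"
    by (intro Henstock_Kurzweil_Integration.integral_diff L2_primitive_integrable_sub[OF assms(1)]
        L2_primitive_integrable_sub[OF assms(2)]) (use x in auto)
  moreover have "U x = U a + integral {a..x} g" "V x = V a + integral {a..x} h"
    using L2_primitiveD[OF assms(1), of x] L2_primitiveD[OF assms(2), of x] x by simp_all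
  ultimately show "U x - V x = U a - V a + integral {a..x} (\<lambda>x. g x - h x)" by simp
qed

lemma L2_primitive_cong_AE:
  assumes U: "L2_primitive a b U g" and h: "h \<in> L2_on {a<..<b}" and ae: "AE x in lebesgue_on {a<..<b}. g x = h x"
  shows "L2_primitive a b U h"
  unfolding L2_primitive_def
proof (intro conjI ballI h)
  fix x assume x: "x \<in> {a..b}"
  have "AE y in lebesgue. y \<in> {a<..<b} \<longrightarrow> g y = h y" using ae by (subst (asm) AE_restrict_space_iff) auto
  then obtain N where N: "negligible N" "{y. \<not> (y \<in> {a<..<b} \<longrightarrow> g y = h y)} \<subseteq> N"
    unfolding eventually_ae_filter_negligible by blast
  have "negligible (N \<union> {a, b})" using N(1) by simp
  then have "integral {a..x} g = integral {a..x} h"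
    by (rule integral_spike) (use N(2) x in force)
  then show "U x = U a + integral {a..x} h" using L2_primitiveD[OF U, of x] x by simp
qed

lemma L2_primitive_by_parts:
  assumes U: "L2_primitive a b U g" and V: "L2_primitive a b V h" and "a \<le> b"
  shows "L2_inner_on {a<..<b} U h + L2_inner_on {a<..<b} g V = U b * V b - U a * V a"
proof -
  let ?F = "\<lambda>x. integral {a..x} g" and ?G = "\<lambda>x. integral {a..x} h"
  have F: "?F x = U x - U a" and G: "?G x = V x - V a" if "x \<in> {a..b}" for x
    using L2_primitiveD[OF U, of x] L2_primitiveD[OF V, of x] that by simp_all
  note gi = L2_primitive_integrable[OF U] and hi = L2_primitive_integrable[OF V]
  have Uh: "(\<lambda>x. U x * h x) integrable_on {a..b}" and gV: "(\<lambda>x. g x * V x) integrable_on {a..b}"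
    using L2_inner_Icc(1) L2_primitive_L2 U V by (auto simp: absolutely_integrable_on_def)
  have "integral {a..b} (\<lambda>x. ?F x * h x) = integral {a..b} (\<lambda>x. U x * h x - U a * h x)"
    by (intro integral_cong) (simp only: F left_diff_distrib)
  also have "\<dots> = integral {a..b} (\<lambda>x. U x * h x) - U a * integral {a..b} h"
    using Uh hi(2) by (subst Henstock_Kurzweil_Integration.integral_diff) (auto intro: integrable_on_mult_right)
  finally have 1: "integral {a..b} (\<lambda>x. ?F x * h x) = integral {a..b} (\<lambda>x. U x * h x) - U a * ?G b" .
  have "integral {a..b} (\<lambda>x. g x * ?G x) = integral {a..b} (\<lambda>x. g x * V x - V a * g x)"
    by (intro integral_cong) (simp only: G right_diff_distrib mult.commute[of "V a"])
  also have "\<dots> = integral {a..b} (\<lambda>x. g x * V x) - V a * integral {a..b} g"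
    using gV gi(2) by (subst Henstock_Kurzweil_Integration.integral_diff) (auto intro: integrable_on_mult_right)
  finally have 2: "integral {a..b} (\<lambda>x. g x * ?G x) = integral {a..b} (\<lambda>x. g x * V x) - V a * ?F b" .
  have "L2_inner_on {a<..<b} U h + L2_inner_on {a<..<b} g V =
      integral {a..b} (\<lambda>x. U x * h x) + integral {a..b} (\<lambda>x. g x * V x)"
    using L2_inner_Icc(2) L2_primitive_L2 U V by metis
  also have "\<dots> = ?F b * ?G b + U a * ?G b + V a * ?F b"
    using 1 2 integral_by_parts_primitives[OF gi(1) hi(1)] by simp
  also have "\<dots> = U b * V b - U a * V a"
    unfolding F[of b, simplified, OF \<open>a \<le> b\<close>] G[of b, simplified, OF \<open>a \<le> b\<close>]
    by (simp add: algebra_simps)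
  finally show ?thesis .
qed

lemma L2_norm_Icc:
  assumes "g \<in> L2_on {c<..<d}"
  shows "(\<lambda>x. (g x)\<^sup>2) integrable_on {c..d}" "(L2_norm_on {c<..<d} g)\<^sup>2 = integral {c..d} (\<lambda>x. (g x)\<^sup>2)"
  using L2_inner_Icc[OF assms assms]
  by (auto simp: L2_norm_square absolutely_integrable_on_def simp flip: power2_eq_square)

lemma L2_norm_mono_interval:
  assumes "g \<in> L2_on {a<..<b}" "a \<le> c" "d \<le> b"
  shows "L2_norm_on {c<..<d} g \<le> L2_norm_on {a<..<b} g"
proof -
  have g: "g \<in> L2_on {c<..<d}"
    by (rule L2_on_subset[OF assms(1)]) (use assms in auto)
  have "integral {c..d} (\<lambda>x. (g x)\<^sup>2) \<le> integral {a..b} (\<lambda>x. (g x)\<^sup>2)"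
    by (rule integral_subset_le) (use assms L2_norm_Icc[OF g] L2_norm_Icc[OF assms(1)] in auto)
  then have "(L2_norm_on {c<..<d} g)\<^sup>2 \<le> (L2_norm_on {a<..<b} g)\<^sup>2"
    by (simp add: L2_norm_Icc[OF g] L2_norm_Icc[OF assms(1)])
  then show ?thesis using power2_le_imp_le L2_norm_nonneg by blast
qed

text \<open>The Cauchy-Schwarz inequality, applied to \<open>g\<close> and the constant \<open>1\<close> on the interval between the two points.\<close>

lemma L2_primitive_Hoelder:
  assumes U: "L2_primitive a b U g" and "x \<in> {a..b}" "y \<in> {a..b}"
  shows "(U x - U y)\<^sup>2 \<le> (b - a) * (L2_norm_on {a<..<b} g)\<^sup>2"
proof -
  have *: "(U y - U x)\<^sup>2 \<le> (b - a) * (L2_norm_on {a<..<b} g)\<^sup>2"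
    if xy: "a \<le> x" "x \<le> y" "y \<le> b" for x y
  proof -
    have g: "g \<in> L2_on {x<..<y}" using L2_primitive_sub[OF U xy(1) xy(3)] by (rule L2_primitive_L2_deriv)
    have one: "(\<lambda>x. 1) \<in> L2_on {x<..<y}" by (intro L2_on_const) simp
    have n1: "(L2_norm_on {x<..<y} (\<lambda>x. 1))\<^sup>2 = y - x"
      using L2_norm_Icc(2)[OF one] xy by simp
    have "U y - U x = L2_inner_on {x<..<y} g (\<lambda>x. 1)"
      using L2_primitive_increment[OF U xy] L2_inner_Icc(2)[OF g one] by simp
    then have "\<bar>U y - U x\<bar> \<le> L2_norm_on {x<..<y} g * L2_norm_on {x<..<y} (\<lambda>x. 1)"
      using L2_Cauchy_Schwarz[OF g one] by simp
    then have "\<bar>U y - U x\<bar>\<^sup>2 \<le> (L2_norm_on {x<..<y} g * L2_norm_on {x<..<y} (\<lambda>x. 1))\<^sup>2"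
      by (intro power_mono) auto
    also have "\<dots> = (L2_norm_on {x<..<y} g)\<^sup>2 * (y - x)" by (simp add: power_mult_distrib n1)
    also have "\<dots> \<le> (L2_norm_on {a<..<b} g)\<^sup>2 * (b - a)"
      using U xy L2_norm_mono_interval[of g a b x y]
      by (intro mult_mono power_mono) (auto simp: L2_primitive_L2_deriv[OF U] L2_norm_nonneg)
    finally show ?thesis by (simp add: mult.commute)
  qed
  show ?thesis
    using *[of x y] *[of y x] assms(2,3) by (cases "x \<le> y") (auto simp: power2_commute[of "U x"])
qed

lemma L2_primitive_smooth:
  assumes "smooth \<phi>" "a \<le> b" shows "L2_primitive a b \<phi> (deriv \<phi>)"
  unfolding L2_primitive_def
proof (intro conjI ballI)
  show "deriv \<phi> \<in> L2_on {a<..<b}"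
    by (intro L2_on_continuous smooth_deriv(3) smooth_deriv(1) assms)
  fix x assume "x \<in> {a..b}"
  then have "(deriv \<phi> has_integral \<phi> x - \<phi> a) {a..x}"
    by (intro fundamental_theorem_of_calculus)
      (auto simp flip: has_real_derivative_iff_has_vector_derivative
        intro: has_field_derivative_at_within smooth_deriv(2)[OF assms(1)])
  then show "\<phi> x = \<phi> a + integral {a..x} (deriv \<phi>)" by (simp add: integral_unique)
qed

section \<open>Weak derivatives in one dimension\<close>

lemma L2_locally_integrable:
  assumes "g \<in> L2_on {a<..<b}" shows "locally_integrable_on {a<..<b} g"
  unfolding locally_integrable_on_def
proof (intro allI impI)
  fix K assume K: "compact K \<and> K \<subseteq> {a<..<b}"
  have "g absolutely_integrable_on {a<..<b}"
    using L2_on_Icc[OF assms] by (simp add: absolutely_integrable_on_open_interval_real)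
  then show "g absolutely_integrable_on K"
    by (rule set_integrable_subset) (use K in \<open>auto intro: lmeasurable_compact fmeasurableD\<close>)
qed

lemma test_functions_L2: "\<phi> \<in> test_functions \<Omega> \<Longrightarrow> \<phi> \<in> L2_on {a<..<b}"
  by (intro L2_on_continuous smooth_deriv(3) test_functions_smooth)

lemma test_functions_iter_deriv:
  "\<phi> \<in> test_functions {a<..<b} \<Longrightarrow> a < b \<Longrightarrow> (deriv ^^ k) \<phi> \<in> test_functions {a<..<b}"
  by (induction k) (simp_all add: test_functions_deriv)

lemma test_functions_integrable:
  assumes "locally_integrable_on {a<..<b} g" "\<phi> \<in> test_functions {a<..<b}" "a < b"
  shows "integrable (lebesgue_on {a<..<b}) (\<lambda>x. g x * \<phi> x)"
proof -
  obtain c d where cd: "a < c" "c < d" "d < b" "\<And>x. x \<notin> {c..d} \<Longrightarrow> \<phi> x = 0"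
    using test_functions_support[OF assms(2,3)] by blast
  have sub: "{c..d} \<subseteq> {a<..<b}" using cd by auto
  have c: "continuous_on UNIV \<phi>"
    using assms(2) by (intro smooth_deriv(3) test_functions_smooth)
  show ?thesis
    by (rule L2_inner_compact_support(2)[OF assms(1) c sub cd(4)]) simp_all
qed

lemma locally_integrable_diff:
  assumes "locally_integrable_on \<Omega> f" "locally_integrable_on \<Omega> g"
  shows "locally_integrable_on \<Omega> (\<lambda>x. f x - g x)"
  using assms unfolding locally_integrable_on_def by (auto intro: set_integral_diff(1))

lemma test_inner_diff:
  assumes "locally_integrable_on {a<..<b} f" "locally_integrable_on {a<..<b} g"
    "\<phi> \<in> test_functions {a<..<b}" "a < b"
  shows "L2_inner_on {a<..<b} (\<lambda>x. f x - g x) \<phi> = L2_inner_on {a<..<b} f \<phi> - L2_inner_on {a<..<b} g \<phi>"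
  using test_functions_integrable[OF assms(1,3,4)] test_functions_integrable[OF assms(2,3,4)]
  by (simp add: L2_inner_on_def left_diff_distrib)

lemma has_weak_deriv_diff:
  assumes "has_weak_deriv {a<..<b} k u g" "has_weak_deriv {a<..<b} k v h" "a < b"
  shows "has_weak_deriv {a<..<b} k (\<lambda>x. u x - v x) (\<lambda>x. g x - h x)"
  unfolding has_weak_deriv_def
proof (intro conjI ballI)
  note u = assms(1)[unfolded has_weak_deriv_def] and v = assms(2)[unfolded has_weak_deriv_def]
  show "locally_integrable_on {a<..<b} (\<lambda>x. u x - v x)" "locally_integrable_on {a<..<b} (\<lambda>x. g x - h x)"
    using u v locally_integrable_diff by blast+
  fix \<phi> assume \<phi>: "\<phi> \<in> test_functions {a<..<b}"
  have "L2_inner_on {a<..<b} (\<lambda>x. u x - v x) ((deriv ^^ k) \<phi>)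
      = L2_inner_on {a<..<b} u ((deriv ^^ k) \<phi>) - L2_inner_on {a<..<b} v ((deriv ^^ k) \<phi>)"
    using u v \<phi> assms(3) by (intro test_inner_diff test_functions_iter_deriv) auto
  also have "\<dots> = (-1) ^ k * L2_inner_on {a<..<b} g \<phi> - (-1) ^ k * L2_inner_on {a<..<b} h \<phi>"
    using u v \<phi> by simp
  also have "\<dots> = (-1) ^ k * L2_inner_on {a<..<b} (\<lambda>x. g x - h x) \<phi>"
    using u v \<phi> assms(3) by (subst test_inner_diff) (auto simp: right_diff_distrib)
  finally show "L2_inner_on {a<..<b} (\<lambda>x. u x - v x) ((deriv ^^ k) \<phi>)
      = (-1) ^ k * L2_inner_on {a<..<b} (\<lambda>x. g x - h x) \<phi>" .
qed

text \<open>The difference of two weak derivatives of the same function is orthogonal to all test functions.\<close>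

lemma has_weak_deriv_unique:
  assumes "has_weak_deriv {a<..<b} k u g" "has_weak_deriv {a<..<b} k u h" "a < b"
  shows "AE x in lebesgue_on {a<..<b}. g x = h x"
proof -
  note u = assms(1)[unfolded has_weak_deriv_def] and v = assms(2)[unfolded has_weak_deriv_def]
  have "AE x in lebesgue_on {a<..<b}. g x - h x = 0"
  proof (rule fundamental_lemma_variations)
    show "locally_integrable_on {a<..<b} (\<lambda>x. g x - h x)"
      using u v locally_integrable_diff by blast
    fix \<phi> assume \<phi>: "\<phi> \<in> test_functions {a<..<b}"
    have "(-1) ^ k * L2_inner_on {a<..<b} g \<phi> = (-1) ^ k * L2_inner_on {a<..<b} h \<phi>"
      using u v \<phi> by metis
    then show "L2_inner_on {a<..<b} (\<lambda>x. g x - h x) \<phi> = 0"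
      using u v \<phi> assms(3) by (subst test_inner_diff) auto
  qed
  then show ?thesis by simp
qed

lemma borel_measurable_lebesgue_on_AE:
  fixes f g :: "real \<Rightarrow> real"
  assumes "f \<in> borel_measurable (lebesgue_on S)" "AE x in lebesgue_on S. f x = g x" "S \<in> sets lebesgue"
  shows "g \<in> borel_measurable (lebesgue_on S)"
proof -
  have "(\<lambda>x. indicat_real S x *\<^sub>R f x) \<in> borel_measurable lebesgue"
    using assms by (subst borel_measurable_restrict_space_iff[symmetric]) auto
  moreover have "AE x in lebesgue. x \<in> S \<longrightarrow> f x = g x"
    using assms(2,3) by (subst (asm) AE_restrict_space_iff) auto
  then have "AE x in lebesgue. indicat_real S x *\<^sub>R f x = indicat_real S x *\<^sub>R g x"
    by eventually_elim (auto simp: indicator_def)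
  ultimately have "(\<lambda>x. indicat_real S x *\<^sub>R g x) \<in> borel_measurable lebesgue"
    by (rule borel_measurable_AE)
  then show ?thesis
    using assms(3) by (subst borel_measurable_restrict_space_iff) auto
qed

lemma L2_on_AE:
  assumes "f \<in> L2_on S" "AE x in lebesgue_on S. f x = g x" "S \<in> sets lebesgue"
  shows "g \<in> L2_on S"
proof (rule L2_on_cong_AE[OF assms(1)])
  show "AE x in lebesgue_on S. g x = f x" using assms(2) by eventually_elim simp
  show "g \<in> borel_measurable (lebesgue_on S)"
    using borel_measurable_lebesgue_on_AE[OF _ assms(2,3)] assms(1) by (simp add: L2_on_def)
qed

text \<open>If some weak derivative is square-integrable, then so is the one selected by the choice operator,
  and its norm is the same. This makes the choice harmless in all that follows.\<close>

lemma weak_deriv_props: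
  assumes g: "has_weak_deriv {a<..<b} k u g" "g \<in> L2_on {a<..<b}" and "a < b"
  shows "has_weak_deriv {a<..<b} k u (weak_deriv {a<..<b} k u)"
    and "AE x in lebesgue_on {a<..<b}. g x = weak_deriv {a<..<b} k u x"
    and "weak_deriv {a<..<b} k u \<in> L2_on {a<..<b}"
    and "L2_norm_on {a<..<b} (weak_deriv {a<..<b} k u) = L2_norm_on {a<..<b} g"
proof -
  show w: "has_weak_deriv {a<..<b} k u (weak_deriv {a<..<b} k u)"
    unfolding weak_deriv_def using someI[of "has_weak_deriv {a<..<b} k u", OF g(1)] by simp
  show ae: "AE x in lebesgue_on {a<..<b}. g x = weak_deriv {a<..<b} k u x"
    by (rule has_weak_deriv_unique[OF g(1) w \<open>a < b\<close>])
  show l: "weak_deriv {a<..<b} k u \<in> L2_on {a<..<b}"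
    by (rule L2_on_AE[OF g(2) ae]) simp
  show "L2_norm_on {a<..<b} (weak_deriv {a<..<b} k u) = L2_norm_on {a<..<b} g"
    using L2_norm_cong_AE[OF g(2) l ae] by simp
qed

lemma has_weak_deriv_0: "locally_integrable_on \<Omega> u \<Longrightarrow> has_weak_deriv \<Omega> 0 u u"
  by (simp add: has_weak_deriv_def)

text \<open>Integration by parts against a test function has no boundary terms.\<close>

lemma L2_primitive_has_weak_deriv:
  assumes U: "L2_primitive a b U g" and "a < b"
  shows "has_weak_deriv {a<..<b} 1 U g"
  unfolding has_weak_deriv_def
proof (intro conjI ballI)
  show "locally_integrable_on {a<..<b} U" "locally_integrable_on {a<..<b} g"
    by (intro L2_locally_integrable L2_primitive_L2[OF U])+
  fix \<phi> assume \<phi>: "\<phi> \<in> test_functions {a<..<b}"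
  obtain c d where cd: "a < c" "c < d" "d < b" "\<And>x. x \<notin> {c..d} \<Longrightarrow> \<phi> x = 0"
    using test_functions_support[OF \<phi> \<open>a < b\<close>] by blast
  have "\<phi> a = 0" "\<phi> b = 0" using cd(1-3) by (auto intro: cd(4))
  then show "L2_inner_on {a<..<b} U ((deriv ^^ 1) \<phi>) = (-1) ^ 1 * L2_inner_on {a<..<b} g \<phi>"
    using L2_primitive_by_parts[OF U L2_primitive_smooth[OF test_functions_smooth[OF \<phi>]]] \<open>a < b\<close> by simp
qed

text \<open>The vanishing integral is what makes the primitive vanish to the right of the support as well.\<close>

lemma test_function_primitive:
  assumes \<rho>: "\<rho> \<in> test_functions {a<..<b}" and z: "integral {a..b} \<rho> = 0" and "a < b"
  shows "\<exists>\<Phi>\<in>test_functions {a<..<b}. deriv \<Phi> = \<rho>"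
proof -
  obtain c d where cd: "a < c" "c < d" "d < b" "\<And>x. x \<notin> {c..d} \<Longrightarrow> \<rho> x = 0"
    using test_functions_support[OF \<rho> \<open>a < b\<close>] by blast
  define \<Phi> where "\<Phi> x = integral {a..x} \<rho>" for x
  have cont: "continuous_on A \<rho>" for A
    by (intro smooth_deriv(3) test_functions_smooth[OF \<rho>])
  have left: "\<Phi> x = 0" if "x < c" for x
  proof -
    have "integral {a..x} \<rho> = integral {a..x} (\<lambda>_. 0)"
      by (rule integral_cong) (use that cd(1-3) in \<open>auto intro!: cd(4)\<close>)
    then show ?thesis by (simp add: \<Phi>_def)
  qed
  have D: "(\<Phi> has_real_derivative \<rho> x) (at x)" for x
  proof (cases "x < c")
    case True
    have "((\<lambda>_. 0) has_real_derivative \<rho> x) (at x)" using cd(4)[of x] True by simp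
    then show ?thesis
      by (rule has_field_derivative_transform_within_open[where S="{..<c}"]) (use True left in auto)
  next
    case False
    then have "(\<Phi> has_real_derivative \<rho> x) (at x within {a..x + 1})"
      unfolding \<Phi>_def has_real_derivative_iff_has_vector_derivative using cd(1)
      by (intro integral_has_vector_derivative cont) auto
    then show ?thesis
      using False cd(1) by (subst (asm) at_within_interior) auto
  qed
  have right: "\<Phi> x = 0" if "x > d" for x
  proof -
    have i: "\<rho> integrable_on {y..z}" for y z by (intro integrable_continuous_real cont)
    have zero: "integral {y..z} \<rho> = 0" if "y > d" for y z
    proof -
      have "integral {y..z} \<rho> = integral {y..z} (\<lambda>_. 0)"
        by (rule integral_cong) (use that in \<open>auto intro!: cd(4)\<close>)
      then show ?thesis by simp
    qed
    show ?thesis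
    proof (cases "x \<le> b")
      case True
      have "integral {a..x} \<rho> + integral {x..b} \<rho> = integral {a..b} \<rho>"
        by (intro Henstock_Kurzweil_Integration.integral_combine i) (use True that cd in auto)
      then show ?thesis using zero[OF that] z by (simp add: \<Phi>_def)
    next
      case False
      have "integral {a..b} \<rho> + integral {b..x} \<rho> = integral {a..x} \<rho>"
        by (intro Henstock_Kurzweil_Integration.integral_combine i) (use False \<open>a < b\<close> in auto)
      then show ?thesis using zero[of b x] cd(3) z by (simp add: \<Phi>_def)
    qed
  qed
  have "\<Phi> \<in> test_functions {a<..<b}"
  proof (rule test_functionsI)
    show "smooth \<Phi>" by (rule smooth_primitive[OF test_functions_smooth[OF \<rho>] D])
    show "{c..d} \<subseteq> {a<..<b}" using cd by auto
    show "\<Phi> x = 0" if "x \<notin> {c..d}" for x using that left right by (cases "x < c") auto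
  qed
  moreover have "deriv \<Phi> = \<rho>" using D by (auto simp: DERIV_imp_deriv)
  ultimately show ?thesis by blast
qed

text \<open>Subtracting from a test function \<open>\<phi>\<close> the multiple of a fixed bump \<open>\<beta>\<close> that has the same integral
  leaves the derivative of a test function. Hence \<open>g\<close> integrates \<open>\<phi>\<close> to a constant times the
  integral of \<open>\<phi>\<close>, and the fundamental lemma applies to \<open>g\<close> minus this constant.\<close>

lemma du_Bois_Reymond:
  assumes g: "locally_integrable_on {a<..<b} g" and "a < b"
    and z: "\<And>\<phi>. \<phi> \<in> test_functions {a<..<b} \<Longrightarrow> L2_inner_on {a<..<b} g (deriv \<phi>) = 0"
  shows "\<exists>K. AE x in lebesgue_on {a<..<b}. g x = K"
proof -
  \<comment> \<open>Any bump inside the interval would do.\<close>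
  define c d where "c = (2 * a + b) / 3" and "d = (a + 2 * b) / 3"
  have cd: "a < c" "c < d" "d < b" using \<open>a < b\<close> by (auto simp: c_def d_def)
  define \<beta> where "\<beta> = bump c d 0"
  have sm: "smooth \<beta>" unfolding \<beta>_def by (rule smooth_bump)
  have out: "\<beta> x = 0" if "x \<notin> {c..d}" for x
    unfolding \<beta>_def by (rule bump_outside) (use that in auto)
  have \<beta>: "\<beta> \<in> test_functions {a<..<b}"
    by (rule test_functionsI[OF sm out]) (use cd in auto)
  have cont: "continuous_on A \<phi>" if "\<phi> \<in> test_functions {a<..<b}" for A \<phi>
    by (intro smooth_deriv(3) test_functions_smooth[OF that])
  define J where "J = integral {a..b} \<beta>"
  have "J \<noteq> 0"
  proof
    assume "J = 0"
    then have "(\<beta> has_integral 0) (cbox a b)"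
      using integrable_integral[OF integrable_continuous_real[OF cont[OF \<beta>, of "{a..b}"]]] by (simp add: J_def)
    then have "\<beta> ((c + d) / 2) = 0"
      using has_integral_0_cbox_imp_0[of a b \<beta> "(c + d) / 2"] cont[OF \<beta>] bump_bounds(1) cd by (auto simp: \<beta>_def)
    then show False using bump_inside[of "(c + d) / 2" c d 0] cd by (auto simp: \<beta>_def)
  qed
  define K where "K = L2_inner_on {a<..<b} g \<beta> / J"
  have K: "locally_integrable_on {a<..<b} (\<lambda>_. K)"
    by (intro L2_locally_integrable L2_on_const) simp
  have "AE x in lebesgue_on {a<..<b}. g x - K = 0"
  proof (rule fundamental_lemma_variations)
    show "locally_integrable_on {a<..<b} (\<lambda>x. g x - K)"
      by (rule locally_integrable_diff[OF g K])
    fix \<phi> assume \<phi>: "\<phi> \<in> test_functions {a<..<b}"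
    define k where "k = integral {a..b} \<phi> / J"
    define \<rho> where "\<rho> x = \<phi> x - k * \<beta> x" for x
    obtain c' d' where cd': "a < c'" "c' < d'" "d' < b" "\<And>x. x \<notin> {c'..d'} \<Longrightarrow> \<phi> x = 0"
      using test_functions_support[OF \<phi> \<open>a < b\<close>] by blast
    have \<rho>: "\<rho> \<in> test_functions {a<..<b}"
    proof (rule test_functionsI)
      show "smooth \<rho>"
        unfolding \<rho>_def by (intro smooth_diff_cmult test_functions_smooth[OF \<phi>] sm)
      show "\<rho> x = 0" if "x \<notin> {min c c'..max d d'}" for x
        using that out[of x] cd'(4)[of x] by (auto simp: \<rho>_def min_le_iff_disj le_max_iff_disj)
      show "{min c c'..max d d'} \<subseteq> {a<..<b}" using cd cd'(1-3) by auto
    qed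
    have "integral {a..b} \<rho> = integral {a..b} \<phi> - k * J"
      unfolding \<rho>_def J_def
      by (subst Henstock_Kurzweil_Integration.integral_diff)
        (auto intro!: integrable_continuous_real continuous_intros cont[OF \<phi>] cont[OF \<beta>])
    then have "integral {a..b} \<rho> = 0" using \<open>J \<noteq> 0\<close> by (simp add: k_def)
    then have "L2_inner_on {a<..<b} g \<rho> = 0"
      using test_function_primitive[OF \<rho> _ \<open>a < b\<close>] z by metis
    moreover have "L2_inner_on {a<..<b} g \<rho> = L2_inner_on {a<..<b} g \<phi> - k * L2_inner_on {a<..<b} g \<beta>"
    proof -
      have "L2_inner_on {a<..<b} g \<rho> = (LINT x|lebesgue_on {a<..<b}. g x * \<phi> x - k * (g x * \<beta> x))"
        unfolding L2_inner_on_def \<rho>_def by (intro Bochner_Integration.integral_cong) (auto simp: algebra_simps)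
      also have "\<dots> = L2_inner_on {a<..<b} g \<phi> - k * L2_inner_on {a<..<b} g \<beta>"
        using test_functions_integrable[OF g \<phi> \<open>a < b\<close>] test_functions_integrable[OF g \<beta> \<open>a < b\<close>]
        by (simp add: L2_inner_on_def)
      finally show ?thesis .
    qed
    ultimately have "L2_inner_on {a<..<b} g \<phi> = k * L2_inner_on {a<..<b} g \<beta>" by simp
    also have "\<dots> = K * integral {a..b} \<phi>" by (simp add: K_def k_def)
    also have "\<dots> = L2_inner_on {a<..<b} (\<lambda>_. K) \<phi>"
      using L2_inner_Icc(2)[OF L2_on_const[of "{a<..<b}" K] test_functions_L2[OF \<phi>]] by simp
    finally show "L2_inner_on {a<..<b} (\<lambda>x. g x - K) \<phi> = 0"
      using test_inner_diff[OF g K \<phi> \<open>a < b\<close>] by simp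
  qed
  then show ?thesis by auto
qed

text \<open>A function differs from the primitive of its weak derivative by a function with weak derivative
  \<open>0\<close>, which is a constant by the lemma of du Bois-Reymond.\<close>

lemma has_weak_deriv_L2_primitive:
  assumes u: "has_weak_deriv {a<..<b} 1 u g" and g: "g \<in> L2_on {a<..<b}" and "a < b"
  shows "\<exists>U. L2_primitive a b U g \<and> (AE x in lebesgue_on {a<..<b}. u x = U x)"
proof -
  define U where "U x = integral {a..x} g" for x
  have shift: "L2_primitive a b (\<lambda>x. U x + K) g" for K
    using g by (simp add: L2_primitive_def U_def)
  have "has_weak_deriv {a<..<b} 1 (\<lambda>x. u x - (U x + 0)) (\<lambda>x. g x - g x)"
    by (intro has_weak_deriv_diff u L2_primitive_has_weak_deriv shift \<open>a < b\<close>)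
  then have w: "has_weak_deriv {a<..<b} 1 (\<lambda>x. u x - U x) (\<lambda>x. 0)" by simp
  have "\<exists>K. AE x in lebesgue_on {a<..<b}. u x - U x = K"
    by (rule du_Bois_Reymond) (use w \<open>a < b\<close> in \<open>auto simp: has_weak_deriv_def L2_inner_on_def\<close>)
  then obtain K where "AE x in lebesgue_on {a<..<b}. u x - U x = K" by blast
  then have "AE x in lebesgue_on {a<..<b}. u x = U x + K" by eventually_elim simp
  then show ?thesis using shift by blast
qed

text \<open>Point values are controlled by the norm of order 1. Thus zero boundary values survive the closure
  of the test functions in that norm.\<close>

lemma L2_primitive_trace:
  assumes W: "L2_primitive a b W g" and y: "y \<in> {a..b}"
  shows "(b - a) * (W y)\<^sup>2 \<le> 2 * (L2_norm_on {a<..<b} W)\<^sup>2 + 2 * (b - a)\<^sup>2 * (L2_norm_on {a<..<b} g)\<^sup>2"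
proof -
  let ?E = "(b - a) * (L2_norm_on {a<..<b} g)\<^sup>2"
  note n = L2_norm_Icc[OF L2_primitive_L2(1)[OF W]]
  have ab: "a \<le> b" using y by auto
  have "integral {a..b} (\<lambda>x. (W y)\<^sup>2) \<le> integral {a..b} (\<lambda>x. 2 * (W x)\<^sup>2 + 2 * ?E)"
  proof (rule integral_le)
    show "(\<lambda>x. 2 * (W x)\<^sup>2 + 2 * ?E) integrable_on {a..b}"
      by (intro integrable_add integrable_on_mult_right n(1)) auto
    show "(W y)\<^sup>2 \<le> 2 * (W x)\<^sup>2 + 2 * ?E" if "x \<in> {a..b}" for x
    proof -
      have "(W y)\<^sup>2 \<le> 2 * (W x)\<^sup>2 + 2 * (W x - W y)\<^sup>2"
        using sum_squares_bound[of "W x" "W y - W x"] zero_le_power2[of "2 * W x - W y"]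
        by (simp add: power2_eq_square algebra_simps)
      then show ?thesis using L2_primitive_Hoelder[OF W that y] by simp
    qed
  qed auto
  also have "integral {a..b} (\<lambda>x. 2 * (W x)\<^sup>2 + 2 * ?E) = 2 * integral {a..b} (\<lambda>x. (W x)\<^sup>2) + 2 * ?E * (b - a)"
    using ab n(1) by (subst Henstock_Kurzweil_Integration.integral_add) auto
  finally show ?thesis
    unfolding n(2) using ab by (simp add: power2_eq_square algebra_simps)
qed

lemma sobolev_weak_deriv:
  assumes "u \<in> sobolev {a<..<b} s" "k \<le> nat \<lfloor>s\<rfloor>" "a < b"
  shows "has_weak_deriv {a<..<b} k u (weak_deriv {a<..<b} k u)" "weak_deriv {a<..<b} k u \<in> L2_on {a<..<b}"
  using assms weak_deriv_props unfolding sobolev_def by blast+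

lemma sobolev_norm_order_1:
  assumes "has_weak_deriv {a<..<b} 1 w g" "w \<in> L2_on {a<..<b}" "g \<in> L2_on {a<..<b}" "a < b"
  shows "(sobolev_norm {a<..<b} 1 w)\<^sup>2 = (L2_norm_on {a<..<b} w)\<^sup>2 + (L2_norm_on {a<..<b} g)\<^sup>2"
proof -
  have "L2_norm_on {a<..<b} (weak_deriv {a<..<b} 0 w) = L2_norm_on {a<..<b} w"
    using assms by (intro weak_deriv_props(4) has_weak_deriv_0 L2_locally_integrable)
  moreover have "L2_norm_on {a<..<b} (weak_deriv {a<..<b} 1 w) = L2_norm_on {a<..<b} g"
    using assms by (intro weak_deriv_props(4))
  ultimately show ?thesis
    by (simp add: sobolev_norm_def L2_norm_nonneg)
qed

text \<open>The trace inequality is applied to the difference of the primitive and an approximating test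
  function, which vanishes at both end points.\<close>

lemma sobolev_1_0_L2_primitive:
  assumes u: "u \<in> sobolev_1_0 {a<..<b}" and "a < b"
  shows "\<exists>U. L2_primitive a b U (weak_grad {a<..<b} u) \<and> U a = 0 \<and> U b = 0 \<and> (AE x in lebesgue_on {a<..<b}. u x = U x)"
proof -
  let ?\<Omega> = "{a<..<b}" and ?g = "weak_grad {a<..<b} u"
  have us: "u \<in> sobolev ?\<Omega> 1" using u by (simp add: sobolev_1_0_def)
  have g: "has_weak_deriv ?\<Omega> 1 u ?g" "?g \<in> L2_on ?\<Omega>"
    using sobolev_weak_deriv[OF us _ \<open>a < b\<close>, of 1] by auto
  have uL: "u \<in> L2_on ?\<Omega>" using us by (simp add: sobolev_def)
  obtain U where U: "L2_primitive a b U ?g" "AE x in lebesgue_on ?\<Omega>. u x = U x"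
    using has_weak_deriv_L2_primitive[OF g \<open>a < b\<close>] by blast
  obtain \<phi> where \<phi>: "\<And>n. \<phi> n \<in> test_functions ?\<Omega>"
    "(\<lambda>n. sobolev_norm ?\<Omega> 1 (\<lambda>x. u x - \<phi> n x)) \<longlonglongrightarrow> 0"
    using u by (auto simp: sobolev_1_0_def)
  have "U y = 0" if y: "y \<in> {a, b}" for y
  proof -
    let ?N = "\<lambda>n. sobolev_norm ?\<Omega> 1 (\<lambda>x. u x - \<phi> n x)"
    have bound: "(b - a) * (U y)\<^sup>2 \<le> (2 + 2 * (b - a)\<^sup>2) * (?N n)\<^sup>2" for n
    proof -
      have p: "L2_primitive a b (\<phi> n) (deriv (\<phi> n))"
        using \<open>a < b\<close> by (intro L2_primitive_smooth test_functions_smooth[OF \<phi>(1)]) simp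
      have W: "L2_primitive a b (\<lambda>x. U x - \<phi> n x) (\<lambda>x. ?g x - deriv (\<phi> n) x)"
        by (rule L2_primitive_diff[OF U(1) p])
      obtain c d where cd: "a < c" "c < d" "d < b" "\<And>x. x \<notin> {c..d} \<Longrightarrow> \<phi> n x = 0"
        using test_functions_support[OF \<phi>(1) \<open>a < b\<close>] by blast
      have "y \<notin> {c..d}" using y cd(1-3) by auto
      then have "\<phi> n y = 0" by (rule cd(4))
      have "AE x in lebesgue_on ?\<Omega>. u x - \<phi> n x = U x - \<phi> n x"
        using U(2) by eventually_elim simp
      then have n: "L2_norm_on ?\<Omega> (\<lambda>x. u x - \<phi> n x) = L2_norm_on ?\<Omega> (\<lambda>x. U x - \<phi> n x)"
        by (intro L2_norm_cong_AE L2_on_diff uL L2_primitive_L2[OF U(1)] test_functions_L2[OF \<phi>(1)])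
      have "has_weak_deriv ?\<Omega> 1 (\<lambda>x. u x - \<phi> n x) (\<lambda>x. ?g x - deriv (\<phi> n) x)"
        by (intro has_weak_deriv_diff g(1) L2_primitive_has_weak_deriv p \<open>a < b\<close>)
      then have N: "(?N n)\<^sup>2 = (L2_norm_on ?\<Omega> (\<lambda>x. u x - \<phi> n x))\<^sup>2 + (L2_norm_on ?\<Omega> (\<lambda>x. ?g x - deriv (\<phi> n) x))\<^sup>2"
        by (intro sobolev_norm_order_1 L2_on_diff uL test_functions_L2[OF \<phi>(1)] L2_primitive_L2[OF W] \<open>a < b\<close>)
      have "(b - a) * (U y)\<^sup>2 \<le> 2 * (L2_norm_on ?\<Omega> (\<lambda>x. u x - \<phi> n x))\<^sup>2
          + 2 * (b - a)\<^sup>2 * (L2_norm_on ?\<Omega> (\<lambda>x. ?g x - deriv (\<phi> n) x))\<^sup>2"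
        using L2_primitive_trace[OF W, of y] y \<open>a < b\<close> \<open>\<phi> n y = 0\<close> n by auto
      also have "\<dots> \<le> (2 + 2 * (b - a)\<^sup>2) * (?N n)\<^sup>2"
        unfolding N by (simp add: algebra_simps)
      finally show ?thesis .
    qed
    have "(\<lambda>n. (2 + 2 * (b - a)\<^sup>2) * (?N n)\<^sup>2) \<longlonglongrightarrow> (2 + 2 * (b - a)\<^sup>2) * 0\<^sup>2"
      by (intro tendsto_intros \<phi>(2))
    then have "(b - a) * (U y)\<^sup>2 \<le> (2 + 2 * (b - a)\<^sup>2) * 0\<^sup>2"
      by (rule LIMSEQ_le_const) (use bound in auto)
    then have "(b - a) * (U y)\<^sup>2 \<le> 0" by simp
    then show ?thesis using \<open>a < b\<close> by (simp add: mult_le_0_iff)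
  qed
  then show ?thesis using U by blast
qed

lemma test_functions_sobolev_1_0:
  assumes \<phi>: "\<phi> \<in> test_functions {a<..<b}" and "a < b"
  shows "\<phi> \<in> sobolev_1_0 {a<..<b}"
    and "AE x in lebesgue_on {a<..<b}. deriv \<phi> x = weak_grad {a<..<b} \<phi> x"
    and "weak_grad {a<..<b} \<phi> \<in> L2_on {a<..<b}"
proof -
  let ?\<Omega> = "{a<..<b}"
  have p: "L2_primitive a b \<phi> (deriv \<phi>)"
    using \<open>a < b\<close> by (intro L2_primitive_smooth test_functions_smooth[OF \<phi>]) simp
  have w: "has_weak_deriv ?\<Omega> 1 \<phi> (deriv \<phi>)"
    by (rule L2_primitive_has_weak_deriv[OF p \<open>a < b\<close>])
  note L = L2_primitive_L2[OF p]
  show "AE x in lebesgue_on {a<..<b}. deriv \<phi> x = weak_grad {a<..<b} \<phi> x"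
    "weak_grad {a<..<b} \<phi> \<in> L2_on {a<..<b}"
    by (rule weak_deriv_props[OF w L(2) \<open>a < b\<close>])+
  have "\<exists>g\<in>L2_on ?\<Omega>. has_weak_deriv ?\<Omega> k \<phi> g" if "k \<le> 1" for k
  proof (cases "k = 0")
    case True
    then show ?thesis using has_weak_deriv_0[OF L2_locally_integrable[OF L(1)]] L(1) by blast
  next
    case False
    then show ?thesis using w L(2) that by (metis le_neq_implies_less less_one)
  qed
  then have s: "\<phi> \<in> sobolev ?\<Omega> 1" using L(1) by (simp add: sobolev_def)
  have "has_weak_deriv ?\<Omega> 1 (\<lambda>x. \<phi> x - \<phi> x) (\<lambda>x. deriv \<phi> x - deriv \<phi> x)"
    by (rule has_weak_deriv_diff[OF w w \<open>a < b\<close>])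
  then have "(sobolev_norm ?\<Omega> 1 (\<lambda>x. \<phi> x - \<phi> x))\<^sup>2 = 0"
    using L2_on_const[of ?\<Omega> 0] \<open>a < b\<close>
    by (subst sobolev_norm_order_1[where g="\<lambda>_. 0"]) (auto simp: L2_norm_on_def L2_inner_on_def)
  then have "(\<lambda>n::nat. sobolev_norm ?\<Omega> 1 (\<lambda>x. \<phi> x - \<phi> x)) \<longlonglongrightarrow> 0" by simp
  then show "\<phi> \<in> sobolev_1_0 ?\<Omega>"
    using s \<phi> unfolding sobolev_1_0_def by (intro CollectI conjI exI[of _ "\<lambda>_. \<phi>"]) auto
qed

text \<open>Testing with test functions says that \<open>F\<close> is the weak derivative of \<open>g\<close>, so \<open>g\<close> is a primitive
  of \<open>F\<close>, and integration by parts gives the equation for every primitive with zero boundary values.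
  In particular it holds for finite element functions, without approximating these by test functions.\<close>

lemma weak_equation_extends:
  assumes g: "g \<in> L2_on {a<..<b}" and F: "F \<in> L2_on {a<..<b}" and "a < b"
    and eq: "\<And>\<psi>. \<psi> \<in> sobolev_1_0 {a<..<b} \<Longrightarrow>
      L2_inner_on {a<..<b} g (weak_grad {a<..<b} \<psi>) = - L2_inner_on {a<..<b} F \<psi>"
    and \<psi>: "L2_primitive a b \<psi> \<psi>'" "\<psi> a = 0" "\<psi> b = 0"
  shows "L2_inner_on {a<..<b} g \<psi>' = - L2_inner_on {a<..<b} F \<psi>"
proof -
  let ?\<Omega> = "{a<..<b}"
  have "has_weak_deriv ?\<Omega> 1 g F"
    unfolding has_weak_deriv_def
  proof (intro conjI ballI L2_locally_integrable g F)
    fix \<phi> assume \<phi>: "\<phi> \<in> test_functions ?\<Omega>"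
    note t = test_functions_sobolev_1_0[OF \<phi> \<open>a < b\<close>]
    have refl: "AE x in lebesgue_on ?\<Omega>. g x = g x" by simp
    have "L2_inner_on ?\<Omega> g (deriv \<phi>) = L2_inner_on ?\<Omega> g (weak_grad ?\<Omega> \<phi>)"
      by (rule L2_inner_cong_AE[OF g test_functions_L2[OF test_functions_deriv[OF \<phi> \<open>a < b\<close>]] g t(3) refl t(2)])
    then show "L2_inner_on ?\<Omega> g ((deriv ^^ 1) \<phi>) = (-1) ^ 1 * L2_inner_on ?\<Omega> F \<phi>"
      using eq[OF t(1)] by simp
  qed
  then obtain G where G: "L2_primitive a b G F" "AE x in lebesgue_on ?\<Omega>. g x = G x"
    using has_weak_deriv_L2_primitive[OF _ F \<open>a < b\<close>] by blast
  have "L2_inner_on ?\<Omega> G \<psi>' + L2_inner_on ?\<Omega> F \<psi> = 0"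
    using L2_primitive_by_parts[OF G(1) \<psi>(1)] \<open>a < b\<close> \<psi>(2,3) by simp
  moreover have "L2_inner_on ?\<Omega> g \<psi>' = L2_inner_on ?\<Omega> G \<psi>'"
    using L2_primitive_L2[OF G(1)] L2_primitive_L2[OF \<psi>(1)] g G(2) by (intro L2_inner_cong_AE) auto
  ultimately show ?thesis by simp
qed

section \<open>Local polynomial approximation\<close>

text \<open>A function is at most its value at one point plus the variation controlled by its derivative.
  The version for a zero avoids the factor 2, so that iterating it produces no constants.\<close>

lemma L2_primitive_Poincare:
  assumes W: "L2_primitive a b W g" and y: "y \<in> {a..b}" 
  shows "(L2_norm_on {a<..<b} W)\<^sup>2 \<le> 2 * (b - a) * (W y)\<^sup>2 + 2 * (b - a)\<^sup>2 * (L2_norm_on {a<..<b} g)\<^sup>2"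
    and "W y = 0 \<Longrightarrow> (L2_norm_on {a<..<b} W)\<^sup>2 \<le> (b - a)\<^sup>2 * (L2_norm_on {a<..<b} g)\<^sup>2"
proof -
  let ?E = "(b - a) * (L2_norm_on {a<..<b} g)\<^sup>2"
  note n = L2_norm_Icc[OF L2_primitive_L2(1)[OF W]]
  have ab: "a \<le> b" using y by auto
  have *: "(L2_norm_on {a<..<b} W)\<^sup>2 \<le> (b - a) * K" if "\<And>x. x \<in> {a..b} \<Longrightarrow> (W x)\<^sup>2 \<le> K" for K
  proof -
    have "integral {a..b} (\<lambda>x. (W x)\<^sup>2) \<le> integral {a..b} (\<lambda>x. K)"
      by (rule integral_le[OF n(1)]) (use that in auto)
    then show ?thesis using ab by (simp add: n(2))
  qed
  show "(L2_norm_on {a<..<b} W)\<^sup>2 \<le> 2 * (b - a) * (W y)\<^sup>2 + 2 * (b - a)\<^sup>2 * (L2_norm_on {a<..<b} g)\<^sup>2"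
  proof -
    have "(W x)\<^sup>2 \<le> 2 * (W y)\<^sup>2 + 2 * ?E" if "x \<in> {a..b}" for x
    proof -
      have "(W x)\<^sup>2 \<le> 2 * (W y)\<^sup>2 + 2 * (W x - W y)\<^sup>2"
        using zero_le_power2[of "W x - 2 * W y"] by (simp add: power2_eq_square algebra_simps)
      then show ?thesis using L2_primitive_Hoelder[OF W that y] by simp
    qed
    from *[OF this] show ?thesis by (simp add: power2_eq_square algebra_simps)
  qed
  show "(L2_norm_on {a<..<b} W)\<^sup>2 \<le> (b - a)\<^sup>2 * (L2_norm_on {a<..<b} g)\<^sup>2" if "W y = 0"
    using *[of ?E] L2_primitive_Hoelder[OF W _ y] that by (simp add: power2_eq_square)
qed

text \<open>Polynomials with at most \<open>k\<close> coefficients are described by the vanishing of the coefficients from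
  \<open>k\<close> on, because \<open>k = 0\<close>, where only the zero polynomial is left, is needed below.\<close>

lemma poly_antiderivative:
  fixes P :: "real poly"
  assumes "\<forall>i\<ge>k. coeff P i = 0"
  shows "\<exists>Q. pderiv Q = P \<and> poly Q c = y \<and> (\<forall>i\<ge>Suc k. coeff Q i = 0)"
proof -
  define R where "R = (\<Sum>i\<le>degree P. monom (coeff P i / real (Suc i)) (Suc i))"
  note pderiv_sum = higher_pderiv_sum[of 1, simplified]
  have "pderiv R = (\<Sum>i\<le>degree P. monom (coeff P i) i)"
    unfolding R_def pderiv_sum by (intro sum.cong refl) (simp add: pderiv_monom del: of_nat_Suc)
  then have R: "pderiv R = P" by (simp add: poly_as_sum_of_monoms)
  have cR: "coeff R i = 0" if "i \<ge> Suc k" for i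
    unfolding R_def coeff_sum by (rule sum.neutral) (use assms that in auto)
  define Q where "Q = R + [:y - poly R c:]"
  have "pderiv Q = P" "poly Q c = y" by (simp_all add: Q_def R pderiv_add)
  moreover have "coeff Q i = 0" if "i \<ge> Suc k" for i
    using cR[OF that] that by (cases i) (simp_all add: Q_def)
  ultimately show ?thesis by blast
qed

lemma L2_primitive_poly:
  assumes "c \<le> d" shows "L2_primitive c d (poly Q) (poly (pderiv Q))"
  unfolding L2_primitive_def
proof (intro conjI ballI)
  show "poly (pderiv Q) \<in> L2_on {c<..<d}" by (intro L2_on_continuous continuous_intros)
  fix x assume "x \<in> {c..d}"
  then have "(poly (pderiv Q) has_integral poly Q x - poly Q c) {c..x}"
    by (intro fundamental_theorem_of_calculus)
      (auto simp flip: has_real_derivative_iff_has_vector_derivative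
        intro: has_field_derivative_at_within poly_DERIV)
  then show "poly Q x = poly Q c + integral {c..x} (poly (pderiv Q))" by (simp add: integral_unique)
qed

text \<open>If \<open>P\<close> approximates the derivative, then the primitive of \<open>P\<close> with the correct initial value
  approximates the function, and a power of the length of the interval is gained.\<close>

lemma poly_approx_primitive:
  assumes U: "L2_primitive c d U g" and "c \<le> d" and P: "\<forall>i\<ge>k. coeff P i = 0"
    and E: "(L2_norm_on {c<..<d} (\<lambda>x. g x - poly P x))\<^sup>2 \<le> E"
  shows "\<exists>Q. (\<forall>i\<ge>Suc k. coeff Q i = 0) \<and> (L2_norm_on {c<..<d} (\<lambda>x. U x - poly Q x))\<^sup>2 \<le> (d - c)\<^sup>2 * E"
proof -
  obtain Q where Q: "pderiv Q = P" "poly Q c = U c" "\<forall>i\<ge>Suc k. coeff Q i = 0"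
    using poly_antiderivative[OF P, of c "U c"] by blast
  have "L2_primitive c d (\<lambda>x. U x - poly Q x) (\<lambda>x. g x - poly P x)"
    using L2_primitive_diff[OF U L2_primitive_poly[OF \<open>c \<le> d\<close>, of Q]] Q(1) by simp
  from L2_primitive_Poincare(2)[OF this, of c] have "(L2_norm_on {c<..<d} (\<lambda>x. U x - poly Q x))\<^sup>2
      \<le> (d - c)\<^sup>2 * (L2_norm_on {c<..<d} (\<lambda>x. g x - poly P x))\<^sup>2"
    using \<open>c \<le> d\<close> Q(2) by simp
  also have "\<dots> \<le> (d - c)\<^sup>2 * E" by (intro mult_left_mono E) simp
  finally show ?thesis using Q(3) by blast
qed

lemma poly_approx_iterated:
  assumes U: "\<And>k. k < m \<Longrightarrow> L2_primitive c d (U k) (U (Suc k))" and "c \<le> d"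
    and P: "\<forall>i\<ge>j. coeff P i = 0"
    and E: "(L2_norm_on {c<..<d} (\<lambda>x. U m x - poly P x))\<^sup>2 \<le> E"
    and "n \<le> m"
  shows "\<exists>Q. (\<forall>i\<ge>j + n. coeff Q i = 0) \<and>
    (L2_norm_on {c<..<d} (\<lambda>x. U (m - n) x - poly Q x))\<^sup>2 \<le> (d - c) ^ (2 * n) * E"
  using \<open>n \<le> m\<close>
proof (induction n)
  case 0
  then show ?case using P E by auto
next
  case (Suc n)
  then obtain Q where Q: "\<forall>i\<ge>j + n. coeff Q i = 0"
    "(L2_norm_on {c<..<d} (\<lambda>x. U (m - n) x - poly Q x))\<^sup>2 \<le> (d - c) ^ (2 * n) * E" by auto
  have "L2_primitive c d (U (m - Suc n)) (U (m - n))"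
    using U[of "m - Suc n"] Suc.prems by (simp add: Suc_diff_Suc)
  from poly_approx_primitive[OF this \<open>c \<le> d\<close> Q] show ?case
    by (simp add: power_add power2_eq_square mult.assoc)
qed

text \<open>The formula for the variance.\<close>

lemma L2_mean_deviation:
  assumes f: "f \<in> L2_on {c<..<d}" and "c < d"
  defines "\<mu> \<equiv> integral {c..d} f / (d - c)"
  shows "(L2_norm_on {c<..<d} (\<lambda>x. f x - \<mu>))\<^sup>2 = (L2_norm_on {c<..<d} f)\<^sup>2 - (integral {c..d} f)\<^sup>2 / (d - c)"
proof -
  have one: "(\<lambda>_. \<mu>) \<in> L2_on {c<..<d}" by (intro L2_on_const) simp
  have i: "f integrable_on {c..d}" using L2_on_Icc[OF f] by (simp add: absolutely_integrable_on_def)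
  have c: "L2_inner_on {c<..<d} f (\<lambda>_. \<mu>) = integral {c..d} f * \<mu>"
    using L2_inner_Icc(2)[OF f one] i by simp
  have "(L2_norm_on {c<..<d} (\<lambda>x. f x - \<mu>))\<^sup>2 = L2_inner_on {c<..<d} f f - 2 * (integral {c..d} f * \<mu>) + (d - c) * \<mu>\<^sup>2"
    unfolding L2_norm_square L2_inner_diff[OF f one L2_on_diff[OF f one]] L2_inner_diff(2)[OF f one f]
      L2_inner_diff(2)[OF f one one] L2_inner_commute[of _ "\<lambda>_. \<mu>" f] c
    using L2_inner_Icc(2)[OF one one] \<open>c < d\<close> by (simp add: power2_eq_square)
  also have "\<dots> = L2_inner_on {c<..<d} f f - (integral {c..d} f)\<^sup>2 / (d - c)"
  proof -
    have "(d - c) * \<mu>\<^sup>2 = integral {c..d} f * \<mu>" using \<open>c < d\<close> by (simp add: \<mu>_def power2_eq_square)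
    moreover have "integral {c..d} f * \<mu> = (integral {c..d} f)\<^sup>2 / (d - c)" by (simp add: \<mu>_def power2_eq_square)
    ultimately show ?thesis by simp
  qed
  finally show ?thesis by (simp add: L2_norm_square)
qed

text \<open>Adding a constant to \<open>P\<close> so that \<open>g - P\<close> has mean \<open>0\<close> does not increase the norm of \<open>g - P\<close>,
  and the mean \<open>0\<close> is exactly what makes the primitive of \<open>P\<close> match \<open>U\<close> at the right end point
  once it does so at the left one. Interpolation at the end points makes the pieces fit together
  continuously.\<close>

lemma poly_approx_interpolating:
  assumes U: "L2_primitive c d U g" and "c < d" and P: "\<forall>i\<ge>k. coeff P i = 0" and "1 \<le> k"
  shows "\<exists>Q. (\<forall>i\<ge>Suc k. coeff Q i = 0) \<and> poly Q c = U c \<and> poly Q d = U d \<and>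
    (L2_norm_on {c<..<d} (\<lambda>x. g x - poly (pderiv Q) x))\<^sup>2 \<le> (L2_norm_on {c<..<d} (\<lambda>x. g x - poly P x))\<^sup>2"
proof -
  let ?f = "\<lambda>x. g x - poly P x"
  define \<mu> where "\<mu> = integral {c..d} ?f / (d - c)"
  have "poly P \<in> L2_on {c<..<d}" by (intro L2_on_continuous continuous_intros)
  then have f: "?f \<in> L2_on {c<..<d}" by (intro L2_on_diff L2_primitive_L2[OF U])
  have fi: "?f integrable_on {c..d}" using L2_on_Icc[OF f] by (simp add: absolutely_integrable_on_def)
  have "\<forall>i\<ge>k. coeff (P + [:\<mu>:]) i = 0"
    using P \<open>1 \<le> k\<close> by (auto simp: coeff_pCons split: nat.split)
  then obtain Q where Q: "pderiv Q = P + [:\<mu>:]" "poly Q c = U c" "\<forall>i\<ge>Suc k. coeff Q i = 0"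
    using poly_antiderivative[of k "P + [:\<mu>:]" c "U c"] by blast
  have W: "L2_primitive c d (\<lambda>x. U x - poly Q x) (\<lambda>x. ?f x - \<mu>)"
    using L2_primitive_diff[OF U L2_primitive_poly[of c d Q]] Q(1) \<open>c < d\<close> by (simp add: algebra_simps)
  have "(U d - poly Q d) - (U c - poly Q c) = integral {c..d} (\<lambda>x. ?f x - \<mu>)"
    using L2_primitive_increment[OF W, of c d] \<open>c < d\<close> by simp
  also have "\<dots> = integral {c..d} ?f - \<mu> * (d - c)"
    using fi \<open>c < d\<close> by (subst Henstock_Kurzweil_Integration.integral_diff) auto
  also have "\<dots> = 0" using \<open>c < d\<close> by (simp add: \<mu>_def)
  finally have "poly Q d = U d" using Q(2) by simp
  moreover have "(L2_norm_on {c<..<d} (\<lambda>x. g x - poly (pderiv Q) x))\<^sup>2 \<le> (L2_norm_on {c<..<d} ?f)\<^sup>2"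
  proof -
    have "0 \<le> (integral {c..d} ?f)\<^sup>2 / (d - c)" using \<open>c < d\<close> by simp
    then have "(L2_norm_on {c<..<d} (\<lambda>x. ?f x - \<mu>))\<^sup>2 \<le> (L2_norm_on {c<..<d} ?f)\<^sup>2"
      using L2_mean_deviation[OF f \<open>c < d\<close>] unfolding \<mu>_def by linarith
    then show ?thesis by (simp add: Q(1) algebra_simps)
  qed
  ultimately show ?thesis using Q(2,3) by blast
qed

text \<open>The integral of \<open>(g x - g y)\<^sup>2\<close> over the square is twice the length of the interval times the
  squared distance of \<open>g\<close> from its mean. On the square \<open>\<bar>x - y\<bar>\<close> is at most the length of the
  interval, which compares this integral with the fractional seminorm. The seminorm is written as an
  integral over the big square with an indicator function, so that the contributions of several
  intervals can be added.\<close>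

lemma fractional_Poincare:
  assumes g: "g \<in> L2_on {a<..<b}" and "a \<le> c" "c < d" "d \<le> b" and "0 < \<theta>"
    and G: "integrable (lebesgue_on {a<..<b} \<Otimes>\<^sub>M lebesgue_on {a<..<b}) (gagliardo_integrand \<theta> g)"
  shows "(L2_norm_on {c<..<d} (\<lambda>x. g x - integral {c..d} g / (d - c)))\<^sup>2 \<le> (d - c) powr (2 * \<theta>) *
    (LINT z|(lebesgue_on {a<..<b} \<Otimes>\<^sub>M lebesgue_on {a<..<b}).
      indicat_real ({c<..<d} \<times> {c<..<d}) z * gagliardo_integrand \<theta> g z)"
proof -
  let ?M = "lebesgue_on {a<..<b}" and ?T = "{c<..<d}"
  let ?\<chi> = "indicat_real ?T" and ?l = "d - c"
  let ?S = "LINT z|(?M \<Otimes>\<^sub>M ?M). indicat_real (?T \<times> ?T) z * gagliardo_integrand \<theta> g z"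
  interpret finite_measure ?M by (rule finite_measure_lebesgue_on) simp
  have T: "?T \<in> sets ?M" using assms by (auto simp: sets_restrict_space)
  have sub: "?T \<subseteq> {a<..<b}" using assms by auto
  have gT: "g \<in> L2_on ?T" by (rule L2_on_subset[OF g sub]) simp_all
  have restr: "integrable ?M (\<lambda>x. ?\<chi> x * h x)" "(LINT x|?M. ?\<chi> x * h x) = (LINT x|lebesgue_on ?T. h x)"
    if "integrable (lebesgue_on ?T) h" for h
  proof -
    have eq: "indicat_real {a<..<b} x * (?\<chi> x * h x) = ?\<chi> x * h x" for x
      using sub by (auto simp: indicator_def)
    show "integrable ?M (\<lambda>x. ?\<chi> x * h x)"
      using that by (simp add: integrable_restrict_space eq)
    show "(LINT x|?M. ?\<chi> x * h x) = (LINT x|lebesgue_on ?T. h x)"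
      by (simp add: integral_restrict_space eq)
  qed
  have i2: "integrable (lebesgue_on ?T) (\<lambda>x. (g x)\<^sup>2)" using gT by (simp add: L2_on_def)
  have i1: "integrable (lebesgue_on ?T) g" by (rule L2_on_integrable[OF _ gT]) simp
  have i0: "integrable (lebesgue_on ?T) (\<lambda>x. 1 :: real)" using L2_on_integrable[OF _ L2_on_const[of ?T 1]] by simp
  define A B where "A = (LINT x|lebesgue_on ?T. (g x)\<^sup>2)" and "B = (LINT x|lebesgue_on ?T. g x)"
  have C: "(LINT x|lebesgue_on ?T. 1) = (?l :: real)"
  proof -
    have "(LINT x|lebesgue_on ?T. 1) = integral {c<..<d} (\<lambda>_. 1 :: real)"
      by (rule lebesgue_integral_eq_integral[OF i0]) simp
    also have "\<dots> = integral {c..d} (\<lambda>_. 1)" by (simp only: integral_open_interval_real)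
    also have "\<dots> = ?l" using \<open>c < d\<close> by simp
    finally show ?thesis .
  qed
  have A: "A = (L2_norm_on ?T g)\<^sup>2"
    unfolding A_def L2_norm_square by (simp add: L2_inner_on_def power2_eq_square)
  have B: "B = integral {c..d} g"
    using lebesgue_integral_eq_integral[OF i1] by (simp add: B_def integral_open_interval_real)
  note r2 = restr[OF i2, folded A_def] and r1 = restr[OF i1, folded B_def] and r0 = restr[OF i0, unfolded C]
  note p20 = integrable_prod_mult[OF sigma_finite_measure_axioms r2(1) r0(1), unfolded r2 r0]
  note p11 = integrable_prod_mult[OF sigma_finite_measure_axioms r1(1) r1(1), unfolded r1]
  note p02 = integrable_prod_mult[OF sigma_finite_measure_axioms r0(1) r2(1), unfolded r2 r0]
  \<comment> \<open>Expanding the square gives three products of functions of one variable each.\<close>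
  let ?D = "\<lambda>(x, y). ?\<chi> x * ?\<chi> y * (g x - g y)\<^sup>2"
  let ?h20 = "\<lambda>(x, y). ?\<chi> x * (g x)\<^sup>2 * (?\<chi> y * 1)" and ?h11 = "\<lambda>(x, y). ?\<chi> x * g x * (?\<chi> y * g y)"
    and ?h02 = "\<lambda>(x, y). ?\<chi> x * 1 * (?\<chi> y * (g y)\<^sup>2)"
  let ?MM = "?M \<Otimes>\<^sub>M ?M"
  have "has_bochner_integral ?MM (\<lambda>z. ?h20 z - 2 * ?h11 z + ?h02 z) (A * ?l - 2 * (B * B) + ?l * A)"
    by (intro has_bochner_integral_add has_bochner_integral_diff has_bochner_integral_mult_right)
      (simp_all only: has_bochner_integral_iff p20 p11 p02)
  moreover have "(\<lambda>z. ?h20 z - 2 * ?h11 z + ?h02 z) = ?D"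
    by (rule ext) (simp add: split_beta power2_eq_square algebra_simps)
  ultimately have "has_bochner_integral ?MM ?D (A * ?l - 2 * (B * B) + ?l * A)" by simp
  then have Di: "integrable ?MM ?D" and DI: "(LINT z|?MM. ?D z) = A * ?l - 2 * (B * B) + ?l * A"
    by (simp_all only: has_bochner_integral_iff)
  have TT: "?T \<times> ?T \<in> sets (?M \<Otimes>\<^sub>M ?M)" using T by simp
  have Si: "integrable (?M \<Otimes>\<^sub>M ?M) (\<lambda>z. indicat_real (?T \<times> ?T) z * gagliardo_integrand \<theta> g z)"
    using integrable_mult_indicator[OF TT G] by simp
  have "(LINT z|(?M \<Otimes>\<^sub>M ?M). ?D z) \<le>
      (LINT z|(?M \<Otimes>\<^sub>M ?M). ?l powr (1 + 2 * \<theta>) * (indicat_real (?T \<times> ?T) z * gagliardo_integrand \<theta> g z))"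
  proof (rule integral_mono[OF Di])
    show "integrable (?M \<Otimes>\<^sub>M ?M) (\<lambda>z. ?l powr (1 + 2 * \<theta>) * (indicat_real (?T \<times> ?T) z * gagliardo_integrand \<theta> g z))"
      by (rule integrable_mult_right[OF Si])
    fix z :: "real \<times> real"
    obtain x y where z: "z = (x, y)" by force
    show "?D z \<le> ?l powr (1 + 2 * \<theta>) * (indicat_real (?T \<times> ?T) z * gagliardo_integrand \<theta> g z)"
    proof (cases "x \<in> ?T \<and> y \<in> ?T \<and> x \<noteq> y")
      case True
      then have "\<bar>x - y\<bar> powr (1 + 2 * \<theta>) \<le> ?l powr (1 + 2 * \<theta>)"
        using \<open>0 < \<theta>\<close> by (intro powr_mono2) auto
      then have "(g x - g y)\<^sup>2 * \<bar>x - y\<bar> powr (1 + 2 * \<theta>) \<le> (g x - g y)\<^sup>2 * ?l powr (1 + 2 * \<theta>)"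
        by (intro mult_left_mono) auto
      then show ?thesis using True
        by (simp add: z gagliardo_integrand_def field_simps)
    qed (auto simp: z gagliardo_integrand_def indicator_def)
  qed
  then have "A * ?l - 2 * (B * B) + ?l * A \<le> ?l powr (1 + 2 * \<theta>) * ?S"
    unfolding DI Bochner_Integration.integral_mult_right_zero .
  moreover have "A * ?l - 2 * (B * B) + ?l * A = ?l * ((A - B\<^sup>2 / ?l) * 2)"
    using \<open>c < d\<close> by (simp add: right_diff_distrib power2_eq_square)
  moreover have "?l powr (1 + 2 * \<theta>) * ?S = ?l * (?l powr (2 * \<theta>) * ?S)"
    using \<open>c < d\<close> by (simp add: powr_add)
  ultimately have "?l * ((A - B\<^sup>2 / ?l) * 2) \<le> ?l * (?l powr (2 * \<theta>) * ?S)" by simp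
  then have "(A - B\<^sup>2 / ?l) * 2 \<le> ?l powr (2 * \<theta>) * ?S"
    by (rule mult_left_le_imp_le) (use \<open>c < d\<close> in simp)
  moreover have dev: "(L2_norm_on ?T (\<lambda>x. g x - integral {c..d} g / ?l))\<^sup>2 = A - B\<^sup>2 / ?l"
    using L2_mean_deviation[OF gT \<open>c < d\<close>] by (simp add: A B)
  moreover have "x \<le> y" if "z * 2 \<le> y" "x = z" "0 \<le> x" for x y z :: real
    using that by linarith
  ultimately show ?thesis using zero_le_power2 by blast
qed

text \<open>The weak derivatives of order up to \<open>m\<close> can be changed on null sets so that each is the primitive
  of the next. The last one is left as it is, since the fractional seminorm refers to it.\<close>

lemma sobolev_chain:
  assumes u: "u \<in> sobolev {a<..<b} s" and "1 \<le> s" "a < b"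
  defines "m \<equiv> nat \<lfloor>s\<rfloor>"
  shows "\<exists>U. (\<forall>k<m. L2_primitive a b (U k) (U (Suc k))) \<and> U m = weak_deriv {a<..<b} m u \<and>
    (AE x in lebesgue_on {a<..<b}. weak_grad {a<..<b} u x = U 1 x)"
proof -
  let ?\<Omega> = "{a<..<b}" and ?D = "\<lambda>k. weak_deriv {a<..<b} k u"
  note D = sobolev_weak_deriv[OF u _ \<open>a < b\<close>, folded m_def]
  have "\<exists>W. L2_primitive a b W (?D (Suc k)) \<and> (AE x in lebesgue_on ?\<Omega>. ?D k x = W x)" if k: "k < m" for k
  proof (rule has_weak_deriv_L2_primitive)
    show "?D (Suc k) \<in> L2_on ?\<Omega>" using D(2)[of "Suc k"] k by simp
    show "has_weak_deriv ?\<Omega> 1 (?D k) (?D (Suc k))"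
      unfolding has_weak_deriv_def
    proof (intro conjI ballI L2_locally_integrable D(2))
      fix \<phi> assume \<phi>: "\<phi> \<in> test_functions ?\<Omega>"
      have "L2_inner_on ?\<Omega> u ((deriv ^^ k) (deriv \<phi>)) = (-1) ^ k * L2_inner_on ?\<Omega> (?D k) (deriv \<phi>)"
        using D(1)[of k] k test_functions_deriv[OF \<phi> \<open>a < b\<close>] by (simp add: has_weak_deriv_def)
      moreover have "L2_inner_on ?\<Omega> u ((deriv ^^ Suc k) \<phi>) = (-1) ^ Suc k * L2_inner_on ?\<Omega> (?D (Suc k)) \<phi>"
        using D(1)[of "Suc k"] k \<phi> unfolding has_weak_deriv_def by (simp del: funpow.simps)
      ultimately have "(-1) ^ k * L2_inner_on ?\<Omega> (?D k) (deriv \<phi>) = (-1) ^ Suc k * L2_inner_on ?\<Omega> (?D (Suc k)) \<phi>"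
        by (simp add: funpow_Suc_right del: funpow.simps)
      then show "L2_inner_on ?\<Omega> (?D k) ((deriv ^^ 1) \<phi>) = (-1) ^ 1 * L2_inner_on ?\<Omega> (?D (Suc k)) \<phi>"
        by (cases "even k") simp_all
    qed (use k in auto)
  qed (rule \<open>a < b\<close>)
  then obtain W where W: "\<And>k. k < m \<Longrightarrow> L2_primitive a b (W k) (?D (Suc k))"
    "\<And>k. k < m \<Longrightarrow> AE x in lebesgue_on ?\<Omega>. ?D k x = W k x" by metis
  \<comment> \<open>Order \<open>m\<close> keeps the selected weak derivative; the lower orders get continuous representatives.\<close>
  define U where "U k = (if k < m then W k else ?D m)" for k
  have ae: "AE x in lebesgue_on ?\<Omega>. ?D k x = U k x" if "k \<le> m" for k
    using W(2)[of k] that by (cases "k = m") (auto simp: U_def)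
  have prim: "L2_primitive a b (U k) (U (Suc k))" if "k < m" for k
  proof -
    have "L2_primitive a b (U k) (?D (Suc k))" using W(1)[OF that] that by (simp add: U_def)
    moreover have "U (Suc k) \<in> L2_on ?\<Omega>"
      by (rule L2_on_AE[OF D(2) ae]) (use that in auto)
    moreover have "AE x in lebesgue_on ?\<Omega>. ?D (Suc k) x = U (Suc k) x" using ae[of "Suc k"] that by simp
    ultimately show ?thesis by (rule L2_primitive_cong_AE)
  qed
  have "1 \<le> m" using \<open>1 \<le> s\<close> by (simp add: m_def le_nat_iff le_floor_iff)
  then have "AE x in lebesgue_on ?\<Omega>. ?D 1 x = U 1 x" by (rule ae)
  moreover have "U m = ?D m" by (simp add: U_def)
  ultimately show ?thesis using prim by (intro exI[of _ U]) auto
qed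

text \<open>The share of one element in the seminorm of highest order. In the fractional case only the
  interaction of the element with itself is counted.\<close>

definition local_energy :: "real \<Rightarrow> real \<Rightarrow> real \<Rightarrow> (real \<Rightarrow> real) \<Rightarrow> real set \<Rightarrow> real" where
  "local_energy a b s g T = (if s \<in> \<int> then (L2_norm_on T g)\<^sup>2
     else LINT z|(lebesgue_on {a<..<b} \<Otimes>\<^sub>M lebesgue_on {a<..<b}).
       indicat_real (T \<times> T) z * gagliardo_integrand (frac s) g z)"

lemma local_energy_nonneg: "0 \<le> local_energy a b s g T"
  by (auto simp: local_energy_def gagliardo_integrand_def split_beta intro!: Bochner_Integration.integral_nonneg)

text \<open>The derivative of order \<open>m\<close> is approximated first, by \<open>0\<close> if \<open>s\<close> is an integer and by its mean
  otherwise. Then \<open>m - 1\<close> integrations lead down to the derivative of order 1, each of them gaining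
  one power of the length, and a last integration gives the interpolating polynomial. The degree
  stays below \<open>r\<close>: the chain has length at most \<open>r\<close>, and in the fractional case, where it starts with
  a constant, \<open>m < s \<le> r\<close> makes up for the additional coefficient.\<close>

lemma local_interpolation:
  assumes U: "\<And>k. k < m \<Longrightarrow> L2_primitive a b (U k) (U (Suc k))" and m: "m = nat \<lfloor>s\<rfloor>"
    and "1 \<le> s" "s \<le> real r" "2 \<le> r" and cd: "a \<le> c" "c < d" "d \<le> b"
    and G: "s \<notin> \<int> \<Longrightarrow> integrable (lebesgue_on {a<..<b} \<Otimes>\<^sub>M lebesgue_on {a<..<b}) (gagliardo_integrand (frac s) (U m))"
  shows "\<exists>Q. degree Q \<le> r - 1 \<and> poly Q c = U 0 c \<and> poly Q d = U 0 d \<and>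
    (L2_norm_on {c<..<d} (\<lambda>x. U 1 x - poly (pderiv Q) x))\<^sup>2 \<le> (d - c) powr (2 * (s - 1)) * local_energy a b s (U m) {c<..<d}"
proof -
  let ?T = "{c<..<d}" and ?E = "local_energy a b s (U m) {c<..<d}"
  have m1: "1 \<le> m" using \<open>1 \<le> s\<close> m by linarith
  have ms: "s = real m + frac s" using \<open>1 \<le> s\<close> m by (simp add: frac_def)
  have V: "L2_primitive c d (U k) (U (Suc k))" if "k < m" for k
    using L2_primitive_sub[OF U[OF that] cd(1) cd(3)] .
  have pw: "(d - c) ^ (2 * (m - 1)) = (d - c) powr (2 * (real m - 1))"
    using cd m1 by (simp flip: powr_realpow add: of_nat_diff)
  have "\<exists>P. (\<forall>i\<ge>r - 1. coeff P i = 0) \<and>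
      (L2_norm_on ?T (\<lambda>x. U 1 x - poly P x))\<^sup>2 \<le> (d - c) powr (2 * (s - 1)) * ?E"
  proof (cases "s \<in> \<int>")
    case True
    then have "frac s = 0" by (simp only: frac_eq_0_iff)
    then have s: "s = real m" using ms by linarith
    have "(L2_norm_on ?T (\<lambda>x. U m x - poly 0 x))\<^sup>2 \<le> ?E" using True by (simp add: local_energy_def)
    from poly_approx_iterated[OF V _ _ this, of 0 "m - 1"] cd m1
    obtain Q where Q: "\<forall>i\<ge>m - 1. coeff Q i = 0"
      "(L2_norm_on ?T (\<lambda>x. U 1 x - poly Q x))\<^sup>2 \<le> (d - c) ^ (2 * (m - 1)) * ?E" by auto
    have "m \<le> r" using s \<open>s \<le> real r\<close> by simp
    then show ?thesis using Q unfolding pw by (intro exI[of _ Q]) (auto simp: s)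
  next
    case False
    let ?g = "U m" and ?P = "[:integral {c..d} (U m) / (d - c):]"
    have fr: "0 < frac s" using False by (simp only: frac_gt_0_iff simp_thms)
    have g: "?g \<in> L2_on {a<..<b}" using L2_primitive_L2(2)[OF U[of "m - 1"]] m1 by simp
    have "(L2_norm_on ?T (\<lambda>x. U m x - poly ?P x))\<^sup>2 \<le> (d - c) powr (2 * frac s) * ?E"
      using fractional_Poincare[OF g cd fr G[OF False]] False by (simp add: local_energy_def)
    moreover have "\<forall>i\<ge>1. coeff ?P i = 0" by (auto simp: coeff_pCons split: nat.split)
    ultimately have "\<exists>Q. (\<forall>i\<ge>1 + (m - 1). coeff Q i = 0) \<and>
        (L2_norm_on ?T (\<lambda>x. U (m - (m - 1)) x - poly Q x))\<^sup>2
          \<le> (d - c) ^ (2 * (m - 1)) * ((d - c) powr (2 * frac s) * ?E)"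
      using cd by (intro poly_approx_iterated[where m=m and U=U and c=c and d=d]) (auto intro: V)
    then obtain Q where Q: "\<forall>i\<ge>m. coeff Q i = 0"
      "(L2_norm_on ?T (\<lambda>x. U 1 x - poly Q x))\<^sup>2 \<le> (d - c) ^ (2 * (m - 1)) * ((d - c) powr (2 * frac s) * ?E)"
      using m1 by auto
    have "real m < real r" using ms fr \<open>s \<le> real r\<close> by linarith
    then have "m \<le> r - 1" by simp
    have eq: "(d - c) powr (2 * (real m - 1)) * ((d - c) powr (2 * frac s) * ?E) = (d - c) powr (2 * (s - 1)) * ?E"
    proof -
      have "2 * (s - 1) = 2 * (real m - 1) + 2 * frac s" using ms by simp
      then show ?thesis by (simp only: powr_add mult.assoc)
    qed
    have "\<forall>i\<ge>r - 1. coeff Q i = 0" using Q(1) \<open>m \<le> r - 1\<close> by auto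
    then show ?thesis using Q(2) unfolding pw eq by blast
  qed
  then obtain P where P: "\<forall>i\<ge>r - 1. coeff P i = 0"
    "(L2_norm_on ?T (\<lambda>x. U 1 x - poly P x))\<^sup>2 \<le> (d - c) powr (2 * (s - 1)) * ?E" by blast
  have "L2_primitive c d (U 0) (U 1)" using V[of 0] m1 by simp
  moreover have "1 \<le> r - 1" using \<open>2 \<le> r\<close> by simp
  ultimately obtain Q where Q: "\<forall>i\<ge>Suc (r - 1). coeff Q i = 0" "poly Q c = U 0 c" "poly Q d = U 0 d"
    "(L2_norm_on ?T (\<lambda>x. U 1 x - poly (pderiv Q) x))\<^sup>2 \<le> (L2_norm_on ?T (\<lambda>x. U 1 x - poly P x))\<^sup>2"
    using poly_approx_interpolating[OF _ cd(2) P(1)] by blast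
  have "degree Q \<le> r - 1" by (rule degree_le) (use Q(1) in auto)
  then show ?thesis using Q P(2) by (intro exI[of _ Q]) auto
qed

section \<open>The finite element space\<close>

lemma interval_partition_division:
  assumes "interval_partition {a<..<b} \<T>" "a < b"
  shows "\<T> division_of {a..b}" "finite \<T>" "\<T> \<noteq> {}"
proof -
  show d: "\<T> division_of {a..b}" using assms by (simp add: interval_partition_def)
  then show "finite \<T>" by blast
  show "\<T> \<noteq> {}" using d \<open>a < b\<close> by (auto simp: division_of_def)
qed

lemma interval_partition_elem:
  assumes T: "interval_partition {a<..<b} \<T>" "a < b" and "K \<in> \<T>"
  obtains c d where "K = {c..d}" "interior K = {c<..<d}" "a \<le> c" "c < d" "d \<le> b" "d - c \<le> mesh_size \<T>"
proof -
  note div = interval_partition_division[OF T]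
  obtain c d where K: "K = {c..d}"
    using division_ofD(4)[OF div(1) \<open>K \<in> \<T>\<close>] by auto
  have "interior K \<noteq> {}" using T(1) \<open>K \<in> \<T>\<close> by (simp add: interval_partition_def)
  then have "c < d" by (auto simp: K)
  moreover have "K \<subseteq> {a..b}" using division_ofD(2)[OF div(1) \<open>K \<in> \<T>\<close>] .
  moreover have "measure lborel K \<le> mesh_size \<T>"
    unfolding mesh_size_def using div(2) \<open>K \<in> \<T>\<close> by (intro Max_ge) auto
  ultimately show thesis by (intro that[OF K]) (auto simp: K)
qed

lemma mesh_size_bounds:
  assumes T: "interval_partition {a<..<b} \<T>" "a < b"
  shows "0 < mesh_size \<T>" "mesh_size \<T> \<le> b - a"
proof -
  note div = interval_partition_division[OF T]
  obtain K where "K \<in> \<T>" using div(3) by blast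
  then show "0 < mesh_size \<T>" using interval_partition_elem[OF T] by (metis diff_gt_0_iff_gt less_le_trans)
  have "measure lborel K \<le> b - a" if "K \<in> \<T>" for K
    by (rule interval_partition_elem[OF T that]) auto
  then show "mesh_size \<T> \<le> b - a"
    unfolding mesh_size_def using div(2,3) by (intro Max.boundedI) auto
qed

lemma interval_partition_separated:
  assumes T: "interval_partition {a<..<b} \<T>" "a < b" and "{c..d} \<in> \<T>" "{c'..d'} \<in> \<T>"
    and "{c..d} \<noteq> {c'..d'}"
  shows "d \<le> c' \<or> d' \<le> c"
proof (rule ccontr)
  assume "\<not> (d \<le> c' \<or> d' \<le> c)"
  moreover have "{c..d} \<noteq> {}" "{c'..d'} \<noteq> {}" "interior {c..d} \<noteq> {}" "interior {c'..d'} \<noteq> {}"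
    using T assms(3,4) interior_empty unfolding interval_partition_def by metis+
  ultimately have "(max c c' + min d d') / 2 \<in> interior {c..d} \<inter> interior {c'..d'}"
    by (auto simp: max_def min_def field_simps split: if_splits)
  moreover have "interior {c..d} \<inter> interior {c'..d'} = {}"
    by (rule division_ofD(5)[OF interval_partition_division(1)[OF T] assms(3,4,5)])
  ultimately show False by blast
qed

text \<open>The interiors of the elements miss only finitely many points.\<close>

lemma L2_norm_partition:
  assumes T: "interval_partition {a<..<b} \<T>" "a < b" and g: "g \<in> L2_on {a<..<b}"
  shows "(L2_norm_on {a<..<b} g)\<^sup>2 = (\<Sum>K\<in>\<T>. (L2_norm_on (interior K) g)\<^sup>2)"
proof -
  note n = L2_norm_Icc[OF g]
  have "integral {a..b} (\<lambda>x. (g x)\<^sup>2) = (\<Sum>K\<in>\<T>. integral K (\<lambda>x. (g x)\<^sup>2))"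
    by (rule integral_combine_division_topdown[OF n(1) interval_partition_division(1)[OF T]])
  also have "\<dots> = (\<Sum>K\<in>\<T>. (L2_norm_on (interior K) g)\<^sup>2)"
  proof (rule sum.cong[OF refl])
    fix K assume "K \<in> \<T>"
    then obtain c d where K: "K = {c..d}" "interior K = {c<..<d}" "a \<le> c" "c < d" "d \<le> b"
      using interval_partition_elem[OF T] by metis
    have "g \<in> L2_on {c<..<d}" by (rule L2_on_subset[OF g]) (use K in auto)
    then show "integral K (\<lambda>x. (g x)\<^sup>2) = (L2_norm_on (interior K) g)\<^sup>2"
      using L2_norm_Icc(2)[of g c d] unfolding K(2) by (simp add: K(1))
  qed
  finally show ?thesis by (simp add: n(2))
qed

lemma fe_space_alt:
  assumes "a < b"
  shows "w \<in> fe_space {a<..<b} r \<T> \<longleftrightarrow> continuous_on {a..b} w \<and> w a = 0 \<and> w b = 0 \<and>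
    (\<forall>K\<in>\<T>. \<exists>P. degree P \<le> r - 1 \<and> (\<forall>x\<in>K. w x = poly P x))"
  using assms by (simp add: fe_space_def frontier_def conj_assoc)

lemma fe_space_diff:
  assumes "a < b" "v \<in> fe_space {a<..<b} r \<T>" "w \<in> fe_space {a<..<b} r \<T>"
  shows "(\<lambda>x. v x - w x) \<in> fe_space {a<..<b} r \<T>"
  unfolding fe_space_alt[OF \<open>a < b\<close>]
proof (intro conjI ballI)
  note v = assms(2)[unfolded fe_space_alt[OF \<open>a < b\<close>]] and w = assms(3)[unfolded fe_space_alt[OF \<open>a < b\<close>]]
  show "continuous_on {a..b} (\<lambda>x. v x - w x)" using v w by (auto intro: continuous_intros)
  show "v a - w a = 0" "v b - w b = 0" using v w by auto
  fix K assume "K \<in> \<T>"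
  then obtain P Q where P: "degree P \<le> r - 1" "\<forall>x\<in>K. v x = poly P x"
    and Q: "degree Q \<le> r - 1" "\<forall>x\<in>K. w x = poly Q x" using v w by metis
  have "degree (P - Q) \<le> r - 1" using P Q by (intro degree_diff_le)
  then show "\<exists>R. degree R \<le> r - 1 \<and> (\<forall>x\<in>K. v x - w x = poly R x)"
    using P Q by (intro exI[of _ "P - Q"]) auto
qed

lemma deriv_poly_on_open:
  fixes w :: "real \<Rightarrow> real"
  assumes "\<And>x. x \<in> {c<..<d} \<Longrightarrow> w x = poly P x" "x \<in> {c<..<d}"
  shows "(w has_real_derivative poly (pderiv P) x) (at x)" "deriv w x = poly (pderiv P) x"
proof -
  show *: "(w has_real_derivative poly (pderiv P) x) (at x)"
    by (rule has_field_derivative_transform_within_open[OF poly_DERIV _ assms(2)]) (use assms in auto)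
  then show "deriv w x = poly (pderiv P) x" by (rule DERIV_imp_deriv)
qed

text \<open>The fundamental theorem of calculus tolerates the finitely many nodes, where the derivative may
  not exist.\<close>

lemma fe_space_L2_primitive:
  assumes T: "interval_partition {a<..<b} \<T>" "a < b" and w: "w \<in> fe_space {a<..<b} r \<T>"
  shows "L2_primitive a b w (deriv w)"
proof -
  note div = interval_partition_division[OF T]
  have wP: "\<And>K. K \<in> \<T> \<Longrightarrow> \<exists>P. \<forall>x\<in>K. w x = poly P x" and cont: "continuous_on {a..b} w"
    using w unfolding fe_space_alt[OF T(2)] by blast+
  define N where "N = (\<Union>K\<in>\<T>. {Inf K, Sup K})"
  have "finite N" using div(2) by (simp add: N_def)
  have D: "(w has_vector_derivative deriv w x) (at x)" if x: "x \<in> {a..b} - N" for x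
  proof -
    have "x \<in> \<Union>\<T>" using x division_ofD(6)[OF div(1)] by simp
    then obtain K where K: "K \<in> \<T>" "x \<in> K" by blast
    obtain c d where cd: "K = {c..d}" "c < d" using interval_partition_elem[OF T K(1)] by metis
    have "c \<in> N" "d \<in> N" using K(1) cd by (auto simp: N_def intro!: bexI[of _ K])
    then have xcd: "x \<in> {c<..<d}" using x K(2) cd by (auto simp: less_le)
    obtain P where "\<forall>x\<in>K. w x = poly P x" using wP[OF K(1)] by blast
    then have P: "\<And>x. x \<in> {c<..<d} \<Longrightarrow> w x = poly P x" using cd by simp
    show ?thesis
      using deriv_poly_on_open[OF P xcd] by (simp add: has_real_derivative_iff_has_vector_derivative)
  qed
  have FTC: "(deriv w has_integral (w x - w a)) {a..x}" if x: "x \<in> {a..b}" for x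
    by (rule fundamental_theorem_of_calculus_interior_strong[OF \<open>finite N\<close>])
      (use x D in \<open>auto intro: continuous_on_subset[OF cont]\<close>)
  have sq: "(\<lambda>x. (deriv w x)\<^sup>2) integrable_on {a..b}"
  proof (rule integrable_combine_division[OF div(1)])
    fix K assume K: "K \<in> \<T>"
    obtain c d where cd: "K = {c..d}" "c < d" using interval_partition_elem[OF T K] by metis
    obtain P where "\<forall>x\<in>K. w x = poly P x" using wP[OF K] by blast
    then have P: "\<And>x. x \<in> {c<..<d} \<Longrightarrow> w x = poly P x" using cd by simp
    have "(\<lambda>x. (poly (pderiv P) x)\<^sup>2) integrable_on {c..d}"
      by (intro integrable_continuous_real continuous_intros)
    then show "(\<lambda>x. (deriv w x)\<^sup>2) integrable_on K"
      unfolding cd(1)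
      by (rule integrable_spike_finite[of "{c, d}", rotated -1]) (use deriv_poly_on_open(2)[OF P] in auto)
  qed
  have i: "deriv w integrable_on {a..b}" using FTC[of b] T(2) by auto
  have "deriv w absolutely_integrable_on {a..b}"
  proof (rule absolutely_integrable_integrable_bound[OF _ i])
    show "(\<lambda>x. 1 + (deriv w x)\<^sup>2) integrable_on {a..b}" by (intro integrable_add sq) auto
    show "norm (deriv w x) \<le> 1 + (deriv w x)\<^sup>2" for x
    proof -
      have "2 * \<bar>deriv w x\<bar> \<le> 1 + (deriv w x)\<^sup>2" using sum_squares_bound[of "\<bar>deriv w x\<bar>" 1] by simp
      then show ?thesis using abs_ge_zero[of "deriv w x"] by simp
    qed
  qed
  then have "deriv w \<in> L2_on {a<..<b}" using sq by (rule L2_on_IccI)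
  then show ?thesis unfolding L2_primitive_def
  proof (intro conjI ballI)
    show "w x = w a + integral {a..x} (deriv w)" if "x \<in> {a..b}" for x
      using integral_unique[OF FTC[OF that]] by simp
  qed
qed

text \<open>Elementwise polynomials that share their values at the nodes with one function \<open>U\<close> are pieces of
  a continuous function, since two elements can meet only at an end point of both.\<close>

lemma fe_space_from_elements:
  assumes T: "interval_partition {a<..<b} \<T>" "a < b" and U: "U a = 0" "U b = 0"
    and Q: "\<And>K. K \<in> \<T> \<Longrightarrow> degree (Q K) \<le> r - 1"
    and E: "\<And>c d. {c..d} \<in> \<T> \<Longrightarrow> c < d \<Longrightarrow> poly (Q {c..d}) c = U c \<and> poly (Q {c..d}) d = U d"
  shows "\<exists>w\<in>fe_space {a<..<b} r \<T>. \<forall>K\<in>\<T>. \<forall>x\<in>K. w x = poly (Q K) x"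
proof -
  note div = interval_partition_division[OF T]
  define w where "w x = poly (Q (SOME K. K \<in> \<T> \<and> x \<in> K)) x" for x
  have same: "poly (Q K) x = poly (Q K') x" if KK: "K \<in> \<T>" "K' \<in> \<T>" "x \<in> K" "x \<in> K'" for K K' x
  proof (cases "K = K'")
    case False
    obtain c d where K: "K = {c..d}" "c < d" using interval_partition_elem[OF T KK(1)] by metis
    obtain c' d' where K': "K' = {c'..d'}" "c' < d'" using interval_partition_elem[OF T KK(2)] by metis
    have "d \<le> c' \<or> d' \<le> c"
      using interval_partition_separated[OF T, of c d c' d'] that False K K' by simp
    then have "(x = d \<and> x = c') \<or> (x = c \<and> x = d')" using that(3,4) K K' by auto
    then show ?thesis using E[of c d] E[of c' d'] that(1,2) K K' by auto
  qed simp
  have w: "w x = poly (Q K) x" if "K \<in> \<T>" "x \<in> K" for K x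
  proof -
    have "(SOME K. K \<in> \<T> \<and> x \<in> K) \<in> \<T> \<and> x \<in> (SOME K. K \<in> \<T> \<and> x \<in> K)"
      by (rule someI[of "\<lambda>K. K \<in> \<T> \<and> x \<in> K" K]) (use that in simp)
    then show ?thesis unfolding w_def using same that by blast
  qed
  have wU: "w c = U c \<and> w d = U d" if "{c..d} \<in> \<T>" "c < d" for c d
    using w[OF that(1), of c] w[OF that(1), of d] E[OF that] that(2) by auto
  have "continuous_on (\<Union>\<T>) w"
  proof (rule continuous_on_closed_Union[of \<T> "\<lambda>K. K", simplified])
    show "finite \<T>" by (rule div(2))
    show "closed K" if "K \<in> \<T>" for K using interval_partition_elem[OF T that] by (metis closed_atLeastAtMost)
    show "continuous_on K w" if "K \<in> \<T>" for K
      by (rule continuous_on_eq[of K "poly (Q K)"]) (use w[OF that] in \<open>auto intro: continuous_intros\<close>)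
  qed
  then have cont: "continuous_on {a..b} w" using division_ofD(6)[OF div(1)] by simp
  have "w a = 0"
  proof -
    have "a \<in> \<Union>\<T>" using division_ofD(6)[OF div(1)] T(2) by simp
    then obtain K where K: "K \<in> \<T>" "a \<in> K" by blast
    obtain c d where cd: "K = {c..d}" "a \<le> c" "c < d" using interval_partition_elem[OF T K(1)] by metis
    then have "c = a" using K(2) by auto
    then show ?thesis using wU[of c d] cd K(1) U(1) by simp
  qed
  moreover have "w b = 0"
  proof -
    have "b \<in> \<Union>\<T>" using division_ofD(6)[OF div(1)] T(2) by simp
    then obtain K where K: "K \<in> \<T>" "b \<in> K" by blast
    obtain c d where cd: "K = {c..d}" "c < d" "d \<le> b" using interval_partition_elem[OF T K(1)] by metis
    then have "d = b" using K(2) by auto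
    then show ?thesis using wU[of c d] cd K(1) U(2) by simp
  qed
  ultimately have "w \<in> fe_space {a<..<b} r \<T>"
    unfolding fe_space_alt[OF T(2)] using cont w Q by blast
  then show ?thesis using w by blast
qed

lemma sobolev_norm_nonneg: "0 \<le> sobolev_norm \<Omega> s u"
  unfolding sobolev_norm_def
  by (auto intro!: add_nonneg_nonneg sum_nonneg Bochner_Integration.integral_nonneg
      simp: gagliardo_integrand_def split_beta)

text \<open>In the fractional case the squares of the interiors are disjoint subsets of the big square, so that
  interactions between different elements are simply dropped.\<close>

lemma sum_local_energy:
  assumes T: "interval_partition {a<..<b} \<T>" "a < b" and u: "u \<in> sobolev {a<..<b} s"
  defines "g \<equiv> weak_deriv {a<..<b} (nat \<lfloor>s\<rfloor>) u"
  shows "(\<Sum>K\<in>\<T>. local_energy a b s g (interior K)) \<le> (sobolev_norm {a<..<b} s u)\<^sup>2"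
proof -
  let ?MM = "lebesgue_on {a<..<b} \<Otimes>\<^sub>M lebesgue_on {a<..<b}"
  let ?G = "gagliardo_integrand (frac s) g"
  let ?L = "\<Sum>k\<le>nat \<lfloor>s\<rfloor>. (L2_norm_on {a<..<b} (weak_deriv {a<..<b} k u))\<^sup>2"
  note div = interval_partition_division[OF T]
  have G0: "0 \<le> ?G z" for z by (simp add: gagliardo_integrand_def split_beta)
  have norm: "(sobolev_norm {a<..<b} s u)\<^sup>2 = ?L + (if s \<in> \<int> then 0 else LINT z|?MM. ?G z)"
    unfolding sobolev_norm_def g_def
    by (subst real_sqrt_pow2)
      (auto intro!: add_nonneg_nonneg sum_nonneg Bochner_Integration.integral_nonneg
        simp: gagliardo_integrand_def split_beta)
  have gL: "g \<in> L2_on {a<..<b}" unfolding g_def by (rule sobolev_weak_deriv(2)[OF u _ T(2)]) simp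
  show ?thesis
  proof (cases "s \<in> \<int>")
    case True
    then have "(\<Sum>K\<in>\<T>. local_energy a b s g (interior K)) = (L2_norm_on {a<..<b} g)\<^sup>2"
      using L2_norm_partition[OF T gL] by (simp add: local_energy_def)
    also have "\<dots> \<le> ?L" unfolding g_def by (rule member_le_sum) auto
    finally show ?thesis using True norm by simp
  next
    case False
    then have Gi: "integrable ?MM ?G" using u unfolding sobolev_def g_def by blast
    let ?I = "\<lambda>K. indicat_real (interior K \<times> interior K)"
    have i: "integrable ?MM (\<lambda>z. ?I K z * ?G z)" if KT: "K \<in> \<T>" for K
    proof -
      obtain c d where K: "interior K = {c<..<d}" "a \<le> c" "d \<le> b"
        using interval_partition_elem[OF T KT] by metis
      then have "interior K \<in> sets (lebesgue_on {a<..<b})" by (auto simp: sets_restrict_space)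
      then have "interior K \<times> interior K \<in> sets ?MM" by simp
      from integrable_mult_indicator[OF this Gi] show ?thesis by simp
    qed
    have le1: "(\<Sum>K\<in>\<T>. ?I K z) \<le> 1" for z
    proof (cases "\<exists>K\<in>\<T>. z \<in> interior K \<times> interior K")
      case True
      then obtain K where K: "K \<in> \<T>" "z \<in> interior K \<times> interior K" by blast
      have "?I K' z = 0" if "K' \<in> \<T> - {K}" for K'
      proof -
        have "interior K \<inter> interior K' = {}" using division_ofD(5)[OF div(1) K(1), of K'] that by auto
        then show ?thesis using K(2) by (auto simp: indicator_def)
      qed
      then have "(\<Sum>K\<in>\<T>. ?I K z) = ?I K z"
        using K(1) div(2) by (subst sum.remove[of _ K]) auto
      then show ?thesis by (simp add: indicator_def)
    next
      case False
      then have "(\<Sum>K\<in>\<T>. ?I K z) = 0" by (intro sum.neutral) (auto simp: indicator_def)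
      then show ?thesis by simp
    qed
    have "(\<Sum>K\<in>\<T>. local_energy a b s g (interior K)) = (LINT z|?MM. (\<Sum>K\<in>\<T>. ?I K z * ?G z))"
      using False i by (simp add: local_energy_def Bochner_Integration.integral_sum)
    also have "\<dots> \<le> (LINT z|?MM. ?G z)"
    proof (rule integral_mono[OF _ Gi])
      show "integrable ?MM (\<lambda>z. \<Sum>K\<in>\<T>. ?I K z * ?G z)" using i by (intro Bochner_Integration.integrable_sum)
      show "(\<Sum>K\<in>\<T>. ?I K z * ?G z) \<le> ?G z" for z
        using mult_right_mono[OF le1 G0, of z z] by (simp add: sum_distrib_right)
    qed
    also have "\<dots> \<le> ?L + (LINT z|?MM. ?G z)" by (simp add: sum_nonneg)
    finally show ?thesis using norm False by simp
  qed
qed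

text \<open>The local interpolants of the representative with zero boundary values are glued together, and
  the squares of the local errors are added.\<close>

lemma fe_interpolation:
  assumes T: "interval_partition {a<..<b} \<T>" "a < b" and u: "u \<in> sobolev {a<..<b} s"
    and U: "L2_primitive a b U (weak_grad {a<..<b} u)" "U a = 0" "U b = 0"
    and s: "1 \<le> s" "s \<le> real r" "2 \<le> r"
  shows "\<exists>w\<in>fe_space {a<..<b} r \<T>. L2_norm_on {a<..<b} (\<lambda>x. weak_grad {a<..<b} u x - deriv w x)
    \<le> mesh_size \<T> powr (s - 1) * sobolev_norm {a<..<b} s u"
proof -
  let ?\<Omega> = "{a<..<b}" and ?h = "mesh_size \<T>"
  define m where "m = nat \<lfloor>s\<rfloor>"
  have m1: "1 \<le> m" using s(1) by (simp add: m_def le_nat_iff le_floor_iff)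
  obtain V where V: "\<forall>k<m. L2_primitive a b (V k) (V (Suc k))" "V m = weak_deriv ?\<Omega> m u"
    and ae: "AE x in lebesgue_on ?\<Omega>. weak_grad ?\<Omega> u x = V 1 x"
    using sobolev_chain[OF u s(1) T(2)] unfolding m_def by blast
  have V1: "V 1 \<in> L2_on ?\<Omega>" using L2_primitive_L2(2)[of a b "V 0" "V 1"] V(1) m1 by simp
  \<comment> \<open>The bottom of the chain is replaced by the representative that vanishes at both end points.\<close>
  define W where "W = V(0 := U)"
  have W: "L2_primitive a b (W k) (W (Suc k))" if "k < m" for k
  proof (cases "k = 0")
    case True
    then show ?thesis using L2_primitive_cong_AE[OF U(1) V1 ae] by (simp add: W_def)
  next
    case False
    then show ?thesis using V(1) that by (simp add: W_def)
  qed
  have Wm: "W m = weak_deriv ?\<Omega> m u" using V(2) m1 by (simp add: W_def)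
  have G: "integrable (lebesgue_on ?\<Omega> \<Otimes>\<^sub>M lebesgue_on ?\<Omega>) (gagliardo_integrand (frac s) (W m))" if "s \<notin> \<int>"
    using u that unfolding Wm by (simp add: sobolev_def m_def)
  let ?E = "\<lambda>K. local_energy a b s (W m) (interior K)"
  let ?P = "\<lambda>K Q. degree Q \<le> r - 1 \<and> (\<forall>c d. K = {c..d} \<and> c < d \<longrightarrow> poly Q c = U c \<and> poly Q d = U d) \<and>
    (L2_norm_on (interior K) (\<lambda>x. V 1 x - poly (pderiv Q) x))\<^sup>2 \<le> ?h powr (2 * (s - 1)) * ?E K"
  have "\<exists>Q. ?P K Q" if KT: "K \<in> \<T>" for K
  proof -
    obtain c d where K: "K = {c..d}" "interior K = {c<..<d}" "a \<le> c" "c < d" "d \<le> b" "d - c \<le> ?h"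
      using interval_partition_elem[OF T KT] by metis
    obtain Q where Q: "degree Q \<le> r - 1" "poly Q c = U c" "poly Q d = U d"
      "(L2_norm_on {c<..<d} (\<lambda>x. W 1 x - poly (pderiv Q) x))\<^sup>2
        \<le> (d - c) powr (2 * (s - 1)) * local_energy a b s (W m) {c<..<d}"
      using local_interpolation[OF W m_def s K(3,4,5) G] by (auto simp: W_def)
    note Q(4)
    also have "(d - c) powr (2 * (s - 1)) * local_energy a b s (W m) {c<..<d}
        \<le> ?h powr (2 * (s - 1)) * local_energy a b s (W m) {c<..<d}"
      using K s by (intro mult_right_mono powr_mono2 local_energy_nonneg) auto
    finally have "(L2_norm_on (interior K) (\<lambda>x. V 1 x - poly (pderiv Q) x))\<^sup>2 \<le> ?h powr (2 * (s - 1)) * ?E K"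
      unfolding K(2) by (simp add: W_def)
    moreover have "c' = c \<and> d' = d" if "K = {c'..d'}" "c' < d'" for c' d'
      using that K by (auto simp: Icc_eq_Icc)
    ultimately show ?thesis using Q(1-3) by blast
  qed
  then have "\<forall>K\<in>\<T>. \<exists>Q. ?P K Q" by (intro ballI)
  then have "\<exists>Q. \<forall>K\<in>\<T>. ?P K (Q K)" by (rule bchoice)
  then obtain Q where "\<forall>K\<in>\<T>. ?P K (Q K)" by (rule exE)
  then have Q: "?P K (Q K)" if "K \<in> \<T>" for K using that by (rule bspec)
  obtain w where w: "w \<in> fe_space ?\<Omega> r \<T>" "\<And>K x. K \<in> \<T> \<Longrightarrow> x \<in> K \<Longrightarrow> w x = poly (Q K) x"
    using fe_space_from_elements[of a b \<T> U Q r, OF T U(2,3)] Q by auto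
  have w': "deriv w \<in> L2_on ?\<Omega>" using fe_space_L2_primitive[OF T w(1)] by (rule L2_primitive_L2)
  have loc: "L2_norm_on (interior K) (\<lambda>x. V 1 x - deriv w x) = L2_norm_on (interior K) (\<lambda>x. V 1 x - poly (pderiv (Q K)) x)"
    if KT: "K \<in> \<T>" for K
  proof -
    obtain c d where K: "K = {c..d}" "interior K = {c<..<d}" using interval_partition_elem[OF T KT] by metis
    have "deriv w x = poly (pderiv (Q K)) x" if "x \<in> {c<..<d}" for x
      by (rule deriv_poly_on_open(2)[OF _ that]) (use w(2)[OF \<open>K \<in> \<T>\<close>] K in auto)
    then show ?thesis unfolding L2_norm_on_def L2_inner_on_def K(2)
      by (intro arg_cong[where f=sqrt] Bochner_Integration.integral_cong) auto
  qed
  have L: "(\<lambda>x. V 1 x - deriv w x) \<in> L2_on ?\<Omega>" by (intro L2_on_diff V1 w')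
  have "(L2_norm_on ?\<Omega> (\<lambda>x. V 1 x - deriv w x))\<^sup>2 = (\<Sum>K\<in>\<T>. (L2_norm_on (interior K) (\<lambda>x. V 1 x - deriv w x))\<^sup>2)"
    by (rule L2_norm_partition[OF T L])
  also have "\<dots> \<le> (\<Sum>K\<in>\<T>. ?h powr (2 * (s - 1)) * ?E K)"
    by (rule sum_mono) (use Q loc in simp)
  also have "\<dots> = ?h powr (2 * (s - 1)) * (\<Sum>K\<in>\<T>. ?E K)" by (simp add: sum_distrib_left)
  also have "\<dots> \<le> ?h powr (2 * (s - 1)) * (sobolev_norm ?\<Omega> s u)\<^sup>2"
    using sum_local_energy[OF T u, folded m_def, folded Wm] by (intro mult_left_mono) simp_all
  also have "\<dots> = (?h powr (s - 1) * sobolev_norm ?\<Omega> s u)\<^sup>2"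
  proof -
    have "?h powr (2 * (s - 1)) = (?h powr (s - 1))\<^sup>2" by (simp add: power2_eq_square flip: powr_add)
    then show ?thesis by (simp add: power_mult_distrib)
  qed
  finally have "L2_norm_on ?\<Omega> (\<lambda>x. V 1 x - deriv w x) \<le> ?h powr (s - 1) * sobolev_norm ?\<Omega> s u"
    by (rule power2_le_imp_le) (simp add: sobolev_norm_nonneg)
  moreover have "AE x in lebesgue_on ?\<Omega>. weak_grad ?\<Omega> u x - deriv w x = V 1 x - deriv w x"
    using ae by eventually_elim simp
  then have "L2_norm_on ?\<Omega> (\<lambda>x. weak_grad ?\<Omega> u x - deriv w x) = L2_norm_on ?\<Omega> (\<lambda>x. V 1 x - deriv w x)"
    using L L2_on_diff[OF L2_primitive_L2(2)[OF U(1)] w'] by (intro L2_norm_cong_AE)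
  ultimately show ?thesis by (intro bexI[OF _ w(1)]) simp
qed

section \<open>The error of the Galerkin approximation\<close>

text \<open>A multiple of the Green function of the second derivative on the interval, with pole \<open>\<xi>\<close>. It is
  continuous and piecewise linear, hence an admissible discrete test function if \<open>\<xi>\<close> is a node.\<close>

definition hat :: "real \<Rightarrow> real \<Rightarrow> real \<Rightarrow> real \<Rightarrow> real" where
  "hat a b \<xi> x = (if x \<le> \<xi> then (x - a) * (b - \<xi>) else (\<xi> - a) * (b - x))"

lemma hat_in_fe_space:
  assumes T: "interval_partition {a<..<b} \<T>" "a < b" and "{\<xi>..d} \<in> \<T>" "a < \<xi>" "\<xi> < d" "2 \<le> r"
  shows "hat a b \<xi> \<in> fe_space {a<..<b} r \<T>"
  unfolding fe_space_alt[OF T(2)]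
proof (intro conjI ballI)
  have "d \<le> b" using interval_partition_elem[OF T assms(3)] \<open>\<xi> < d\<close> by (metis Icc_eq_Icc less_imp_le)
  have "\<xi> < b" using \<open>\<xi> < d\<close> \<open>d \<le> b\<close> by simp
  have "continuous_on ({a..\<xi>} \<union> {\<xi>..b}) (\<lambda>x. if x \<le> \<xi> then (x - a) * (b - \<xi>) else (\<xi> - a) * (b - x))"
    by (intro continuous_on_cases continuous_intros) auto
  then show "continuous_on {a..b} (hat a b \<xi>)"
    using \<open>a < \<xi>\<close> \<open>\<xi> < b\<close> by (simp add: hat_def[abs_def] ivl_disj_un_two_touch)
  show "hat a b \<xi> a = 0" "hat a b \<xi> b = 0" using \<open>a < \<xi>\<close> \<open>\<xi> < b\<close> by (auto simp: hat_def)
  fix K assume "K \<in> \<T>"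
  then obtain c' d' where K: "K = {c'..d'}" "c' < d'" using interval_partition_elem[OF T] by metis
  let ?L = "[:- a * (b - \<xi>), b - \<xi>:]" and ?R = "[:(\<xi> - a) * b, - (\<xi> - a):]"
  have "d' \<le> \<xi> \<or> \<xi> \<le> c'"
  proof (cases "K = {\<xi>..d}")
    case True
    then show ?thesis using K \<open>\<xi> < d\<close> by (auto simp: Icc_eq_Icc)
  next
    case False
    then show ?thesis
      using interval_partition_separated[OF T assms(3), of c' d'] \<open>K \<in> \<T>\<close> K \<open>\<xi> < d\<close> by auto
  qed
  then show "\<exists>P. degree P \<le> r - 1 \<and> (\<forall>x\<in>K. hat a b \<xi> x = poly P x)"
  proof
    assume "d' \<le> \<xi>"
    then show ?thesis
      using K \<open>2 \<le> r\<close> by (intro exI[of _ ?L]) (auto simp: hat_def algebra_simps)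
  next
    assume "\<xi> \<le> c'"
    moreover have "hat a b \<xi> x = (\<xi> - a) * (b - x)" if "\<xi> \<le> x" for x
      using that by (cases "x = \<xi>") (auto simp: hat_def)
    ultimately show ?thesis
      using K \<open>2 \<le> r\<close> by (intro exI[of _ ?R]) (auto simp: algebra_simps)
  qed
qed

text \<open>For a function with zero boundary values, testing with the hat function reads off the value at
  the node.\<close>

lemma L2_inner_hat:
  assumes e: "L2_primitive a b e g" and \<xi>: "a < \<xi>" "\<xi> < b" and \<psi>: "L2_primitive a b (hat a b \<xi>) \<psi>'"
  shows "L2_inner_on {a<..<b} g \<psi>' = (b - a) * e \<xi> - (b - \<xi>) * e a - (\<xi> - a) * e b"
proof -
  \<comment> \<open>On both sides of the node the hat function is linear with a known slope.\<close>
  have L: "L2_primitive a \<xi> (hat a b \<xi>) (\<lambda>_. b - \<xi>)"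
    using L2_on_const[of "{a<..<\<xi>}" "b - \<xi>"] by (auto simp: L2_primitive_def hat_def)
  have R: "L2_primitive \<xi> b (hat a b \<xi>) (\<lambda>_. - (\<xi> - a))"
    using L2_on_const[of "{\<xi><..<b}" "- (\<xi> - a)"] by (auto simp: L2_primitive_def hat_def algebra_simps)
  have part: "L2_inner_on {c<..<d} g \<psi>' = k * (e d - e c)"
    if cd: "a \<le> c" "c < d" "d \<le> b" and H: "L2_primitive c d (hat a b \<xi>) (\<lambda>_. k)" for c d k
  proof -
    have \<psi>cd: "L2_primitive c d (hat a b \<xi>) \<psi>'" and ecd: "L2_primitive c d e g"
      using L2_primitive_sub cd(1,3) \<psi> e by blast+
    note w = L2_primitive_has_weak_deriv[OF _ cd(2)]
    have ae: "AE x in lebesgue_on {c<..<d}. \<psi>' x = k"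
      by (rule has_weak_deriv_unique[OF w[OF \<psi>cd] w[OF H] cd(2)])
    note L2 = L2_primitive_L2(2)[OF ecd] L2_primitive_L2(2)[OF \<psi>cd] L2_primitive_L2(2)[OF H]
    have "L2_inner_on {c<..<d} g \<psi>' = L2_inner_on {c<..<d} g (\<lambda>_. k)"
      by (rule L2_inner_cong_AE[OF L2(1,2,1,3) _ ae]) simp
    also have "\<dots> = integral {c..d} (\<lambda>x. g x * k)" by (rule L2_inner_Icc(2)[OF L2(1,3)])
    also have "\<dots> = (e d - e c) * k"
      using L2_primitive_increment[OF ecd, of c d] cd(2) by simp
    finally show ?thesis by simp
  qed
  note gi = L2_inner_Icc[OF L2_primitive_L2(2)[OF e] L2_primitive_L2(2)[OF \<psi>]]
  have sub: "g \<in> L2_on {c<..<d}" "\<psi>' \<in> L2_on {c<..<d}" if "a \<le> c" "d \<le> b" for c d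
    using L2_primitive_L2(2)[OF L2_primitive_sub[OF e that]] L2_primitive_L2(2)[OF L2_primitive_sub[OF \<psi> that]] by auto
  have "L2_inner_on {a<..<b} g \<psi>' = integral {a..b} (\<lambda>x. g x * \<psi>' x)" by (rule gi(2))
  also have "\<dots> = integral {a..\<xi>} (\<lambda>x. g x * \<psi>' x) + integral {\<xi>..b} (\<lambda>x. g x * \<psi>' x)"
    by (rule Henstock_Kurzweil_Integration.integral_combine[symmetric])
      (use \<xi> gi(1) in \<open>auto simp: absolutely_integrable_on_def\<close>)
  also have "\<dots> = L2_inner_on {a<..<\<xi>} g \<psi>' + L2_inner_on {\<xi><..<b} g \<psi>'"
    using L2_inner_Icc(2)[OF sub] \<xi> by simp
  also have "\<dots> = (b - \<xi>) * (e \<xi> - e a) + - (\<xi> - a) * (e b - e \<xi>)"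
    using part[OF _ _ _ L] part[OF _ _ _ R] \<xi> by simp
  also have "\<dots> = (b - a) * e \<xi> - (b - \<xi>) * e a - (\<xi> - a) * e b" by (simp add: algebra_simps)
  finally show ?thesis .
qed

lemma hat_L2_norm:
  assumes \<xi>: "a < \<xi>" "\<xi> < b" and \<psi>: "hat a b \<xi> \<in> L2_on {a<..<b}"
  shows "(L2_norm_on {a<..<b} (hat a b \<xi>))\<^sup>2 \<le> (b - a) ^ 5"
proof -
  note n = L2_norm_Icc[OF \<psi>]
  have "\<bar>hat a b \<xi> x\<bar> \<le> (b - a) * (b - a)" if "x \<in> {a..b}" for x
    using that \<xi> by (auto simp: hat_def abs_mult intro!: mult_mono)
  then have "\<bar>hat a b \<xi> x\<bar>\<^sup>2 \<le> ((b - a) * (b - a))\<^sup>2" if "x \<in> {a..b}" for x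
    using that by (intro power_mono) auto
  then have "integral {a..b} (\<lambda>x. (hat a b \<xi> x)\<^sup>2) \<le> integral {a..b} (\<lambda>x. ((b - a) * (b - a))\<^sup>2)"
    by (intro integral_le n(1)) auto
  also have "\<dots> = (b - a) ^ 5" using \<xi> by (simp add: eval_nat_numeral)
  finally show ?thesis by (simp only: n(2))
qed

text \<open>The abstract estimate for two equations with different data \<open>F\<close> and \<open>G\<close>. For the derivative, the
  difference of the discrete solution \<open>v\<close> and any \<open>w\<close> in the discrete space is used as a test function.
  For the function itself no duality argument is needed: the hat functions bound the error at the
  nodes by the difference of the data alone, and within an element the error changes by at most the
  mesh size times its derivative. So the part that comes from \<open>w\<close> gains a power of the mesh size.\<close>

lemma galerkin_error:
  assumes T: "interval_partition {a<..<b} \<T>" "a < b" and r: "2 \<le> r"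
    and U: "L2_primitive a b U g" "U a = 0" "U b = 0"
    and w: "w \<in> fe_space {a<..<b} r \<T>" and v: "v \<in> fe_space {a<..<b} r \<T>"
    and F: "F \<in> L2_on {a<..<b}" and G: "G \<in> L2_on {a<..<b}"
    and eqU: "\<And>\<psi> \<psi>'. \<psi> \<in> fe_space {a<..<b} r \<T> \<Longrightarrow> L2_primitive a b \<psi> \<psi>' \<Longrightarrow>
      L2_inner_on {a<..<b} g \<psi>' = - L2_inner_on {a<..<b} F \<psi>"
    and eqv: "\<And>\<psi> \<psi>'. \<psi> \<in> fe_space {a<..<b} r \<T> \<Longrightarrow> L2_primitive a b \<psi> \<psi>' \<Longrightarrow>
      L2_inner_on {a<..<b} (deriv v) \<psi>' = - L2_inner_on {a<..<b} G \<psi>"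
  defines "A \<equiv> L2_norm_on {a<..<b} (\<lambda>x. g x - deriv w x)"
    and "D \<equiv> L2_norm_on {a<..<b} (\<lambda>x. F x - G x)"
  shows "L2_norm_on {a<..<b} (\<lambda>x. g x - deriv v x) \<le> 2 * A + (b - a) * D"
    and "L2_norm_on {a<..<b} (\<lambda>x. U x - v x) \<le> 4 * mesh_size \<T> * A + 4 * (b - a)\<^sup>2 * D"
proof -
  let ?\<Omega> = "{a<..<b}" and ?h = "mesh_size \<T>" and ?L = "b - a"
  have L0: "0 < ?L" using T(2) by simp
  note wp = fe_space_L2_primitive[OF T w] and vp = fe_space_L2_primitive[OF T v]
  have w0: "w a = 0" and v0: "v a = 0" "v b = 0" using w v unfolding fe_space_alt[OF T(2)] by blast+
  have gL: "g \<in> L2_on ?\<Omega>" by (rule L2_primitive_L2[OF U(1)])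
  have wL: "deriv w \<in> L2_on ?\<Omega>" and vL: "deriv v \<in> L2_on ?\<Omega>" by (intro L2_primitive_L2[OF wp] L2_primitive_L2[OF vp])+
  have A0: "0 \<le> A" and D0: "0 \<le> D" by (simp_all add: A_def D_def L2_norm_nonneg)
  let ?e = "\<lambda>x. U x - v x" and ?e' = "\<lambda>x. g x - deriv v x"
  have ep: "L2_primitive a b ?e ?e'" by (rule L2_primitive_diff[OF U(1) vp])
  have orth: "L2_inner_on ?\<Omega> ?e' \<psi>' = - L2_inner_on ?\<Omega> (\<lambda>x. F x - G x) \<psi>"
    if "\<psi> \<in> fe_space ?\<Omega> r \<T>" "L2_primitive a b \<psi> \<psi>'" for \<psi> \<psi>'
    using eqU[OF that] eqv[OF that] L2_inner_diff(1)[OF gL vL L2_primitive_L2(2)[OF that(2)]]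
      L2_inner_diff(1)[OF F G L2_primitive_L2(1)[OF that(2)]] by simp
  have FG: "(\<lambda>x. F x - G x) \<in> L2_on ?\<Omega>" by (rule L2_on_diff[OF F G])
  have wg: "(\<lambda>x. deriv w x - g x) \<in> L2_on ?\<Omega>" by (rule L2_on_diff[OF wL gL])
  let ?z = "\<lambda>x. w x - v x" and ?z' = "\<lambda>x. deriv w x - deriv v x"
  have z: "?z \<in> fe_space ?\<Omega> r \<T>" by (rule fe_space_diff[OF T(2) w v])
  have zp: "L2_primitive a b ?z ?z'" by (rule L2_primitive_diff[OF wp vp])
  have "(L2_norm_on ?\<Omega> ?z)\<^sup>2 \<le> (?L * L2_norm_on ?\<Omega> ?z')\<^sup>2"
    using L2_primitive_Poincare(2)[OF zp, of a] T(2) w0 v0 by (simp add: power_mult_distrib)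
  then have zn: "L2_norm_on ?\<Omega> ?z \<le> ?L * L2_norm_on ?\<Omega> ?z'"
    by (rule power2_le_imp_le) (use L0 in \<open>simp add: L2_norm_nonneg\<close>)
  \<comment> \<open>Testing with \<open>w - v\<close>: the Galerkin orthogonality holds up to the difference of the data.\<close>
  have "(L2_norm_on ?\<Omega> ?z')\<^sup>2 = L2_inner_on ?\<Omega> (\<lambda>x. (deriv w x - g x) + ?e' x) ?z'"
    by (simp add: L2_norm_square)
  also have "\<dots> = L2_inner_on ?\<Omega> (\<lambda>x. deriv w x - g x) ?z' + L2_inner_on ?\<Omega> ?e' ?z'"
    using L2_inner_lincomb(1)[OF wg L2_primitive_L2(2)[OF ep] L2_primitive_L2(2)[OF zp], of 1 1] by simp
  also have "\<dots> = L2_inner_on ?\<Omega> (\<lambda>x. deriv w x - g x) ?z' - L2_inner_on ?\<Omega> (\<lambda>x. F x - G x) ?z"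
    using orth[OF z zp] by simp
  also have "\<dots> \<le> A * L2_norm_on ?\<Omega> ?z' + D * L2_norm_on ?\<Omega> ?z"
    using L2_Cauchy_Schwarz[OF wg L2_primitive_L2(2)[OF zp]] L2_Cauchy_Schwarz[OF FG L2_primitive_L2(1)[OF zp]]
    by (simp add: A_def D_def L2_norm_diff_commute[of _ g])
  also have "\<dots> \<le> A * L2_norm_on ?\<Omega> ?z' + D * (?L * L2_norm_on ?\<Omega> ?z')"
    by (intro add_left_mono mult_left_mono zn D0)
  finally have "L2_norm_on ?\<Omega> ?z' * L2_norm_on ?\<Omega> ?z' \<le> (A + ?L * D) * L2_norm_on ?\<Omega> ?z'"
    by (simp add: power2_eq_square algebra_simps)
  moreover have "0 \<le> A + ?L * D" using A0 D0 L0 by simp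
  ultimately have zb: "L2_norm_on ?\<Omega> ?z' \<le> A + ?L * D"
    using L2_norm_nonneg[of ?\<Omega> ?z'] by (cases "L2_norm_on ?\<Omega> ?z' = 0") auto
  have "L2_norm_on ?\<Omega> ?e' = L2_norm_on ?\<Omega> (\<lambda>x. (g x - deriv w x) + ?z' x)" by simp
  also have "\<dots> \<le> A + L2_norm_on ?\<Omega> ?z'"
    unfolding A_def by (rule L2_norm_triangle[OF L2_on_diff[OF gL wL] L2_primitive_L2(2)[OF zp]])
  finally show e'b: "L2_norm_on ?\<Omega> ?e' \<le> 2 * A + ?L * D" using zb by simp
  \<comment> \<open>The left end point of each element is either the boundary point \<open>a\<close> or a node with a hat function.\<close>
  have node: "(?e c)\<^sup>2 \<le> ?L ^ 3 * D\<^sup>2" if cd: "{c..d} \<in> \<T>" "c < d" "a \<le> c" "d \<le> b" for c d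
  proof (cases "c = a")
    case True
    then show ?thesis using U(2) v0 L0 by simp
  next
    case False
    then have c: "a < c" "c < b" using cd by auto
    have \<psi>: "hat a b c \<in> fe_space ?\<Omega> r \<T>" by (rule hat_in_fe_space[OF T cd(1) c(1) cd(2) r])
    note \<psi>p = fe_space_L2_primitive[OF T \<psi>]
    have "?L * ?e c = - L2_inner_on ?\<Omega> (\<lambda>x. F x - G x) (hat a b c)"
      using L2_inner_hat[OF ep c \<psi>p] orth[OF \<psi> \<psi>p] U(2,3) v0 by simp
    then have "\<bar>?L * ?e c\<bar> \<le> D * L2_norm_on ?\<Omega> (hat a b c)"
      using L2_Cauchy_Schwarz[OF FG L2_primitive_L2(1)[OF \<psi>p]] by (simp add: D_def)
    then have "\<bar>?L * ?e c\<bar>\<^sup>2 \<le> (D * L2_norm_on ?\<Omega> (hat a b c))\<^sup>2" by (intro power_mono) auto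
    also have "\<dots> \<le> D\<^sup>2 * ?L ^ 5"
      unfolding power_mult_distrib by (intro mult_left_mono hat_L2_norm c L2_primitive_L2(1)[OF \<psi>p]) simp
    finally have "?L\<^sup>2 * (?e c)\<^sup>2 \<le> ?L\<^sup>2 * (?L ^ 3 * D\<^sup>2)"
      by (simp add: power_mult_distrib eval_nat_numeral mult_ac)
    then show ?thesis by (rule mult_left_le_imp_le) (use L0 in simp)
  qed
  have loc: "(L2_norm_on (interior K) ?e)\<^sup>2 \<le>
      2 * ?L ^ 3 * D\<^sup>2 * (L2_norm_on (interior K) (\<lambda>_. 1))\<^sup>2 + 2 * ?h\<^sup>2 * (L2_norm_on (interior K) ?e')\<^sup>2"
    if KT: "K \<in> \<T>" for K
  proof -
    obtain c d where K: "K = {c..d}" "interior K = {c<..<d}" "a \<le> c" "c < d" "d \<le> b" "d - c \<le> ?h"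
      using interval_partition_elem[OF T KT] by metis
    have one: "(L2_norm_on {c<..<d} (\<lambda>_. 1))\<^sup>2 = d - c"
      using L2_norm_Icc(2)[OF L2_on_const[of "{c<..<d}" 1]] K(4) by simp
    have "(L2_norm_on {c<..<d} ?e)\<^sup>2 \<le> 2 * (d - c) * (?e c)\<^sup>2 + 2 * (d - c)\<^sup>2 * (L2_norm_on {c<..<d} ?e')\<^sup>2"
      by (rule L2_primitive_Poincare(1)[OF L2_primitive_sub[OF ep K(3,5)]]) (use K in auto)
    also have "\<dots> \<le> 2 * (d - c) * (?L ^ 3 * D\<^sup>2) + 2 * ?h\<^sup>2 * (L2_norm_on {c<..<d} ?e')\<^sup>2"
      using K KT by (intro add_mono mult_left_mono mult_right_mono power_mono node) auto
    finally show ?thesis unfolding K(2) one by (simp add: algebra_simps)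
  qed
  have one: "(\<lambda>_. 1) \<in> L2_on ?\<Omega>" by (intro L2_on_const) simp
  have "(L2_norm_on ?\<Omega> ?e)\<^sup>2 = (\<Sum>K\<in>\<T>. (L2_norm_on (interior K) ?e)\<^sup>2)"
    by (rule L2_norm_partition[OF T L2_primitive_L2(1)[OF ep]])
  also have "\<dots> \<le> (\<Sum>K\<in>\<T>. 2 * ?L ^ 3 * D\<^sup>2 * (L2_norm_on (interior K) (\<lambda>_. 1))\<^sup>2 + 2 * ?h\<^sup>2 * (L2_norm_on (interior K) ?e')\<^sup>2)"
    by (rule sum_mono[OF loc])
  also have "\<dots> = 2 * ?L ^ 3 * D\<^sup>2 * (L2_norm_on ?\<Omega> (\<lambda>_. 1))\<^sup>2 + 2 * ?h\<^sup>2 * (L2_norm_on ?\<Omega> ?e')\<^sup>2"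
    unfolding L2_norm_partition[OF T one] L2_norm_partition[OF T L2_primitive_L2(2)[OF ep]]
    by (simp add: sum.distrib sum_distrib_left)
  also have "\<dots> = 2 * (?L\<^sup>2 * D)\<^sup>2 + 2 * (?h * L2_norm_on ?\<Omega> ?e')\<^sup>2"
    using L2_norm_Icc(2)[OF one] T(2) by (simp add: power_mult_distrib eval_nat_numeral mult_ac)
  also have "\<dots> \<le> (2 * (?L\<^sup>2 * D + ?h * L2_norm_on ?\<Omega> ?e'))\<^sup>2"
  proof -
    have "2 * x\<^sup>2 + 2 * y\<^sup>2 \<le> (2 * (x + y))\<^sup>2" if "0 \<le> x" "0 \<le> y" for x y :: real
      using mult_nonneg_nonneg[OF that] by (simp add: power2_eq_square algebra_simps)
    then show ?thesis using D0 L0 mesh_size_bounds[OF T] by (simp add: L2_norm_nonneg)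
  qed
  finally have "L2_norm_on ?\<Omega> ?e \<le> 2 * (?L\<^sup>2 * D + ?h * L2_norm_on ?\<Omega> ?e')"
    by (rule power2_le_imp_le) (use D0 L0 mesh_size_bounds[OF T] in \<open>simp add: L2_norm_nonneg\<close>)
  also have "\<dots> \<le> 2 * (?L\<^sup>2 * D + (?h * (2 * A) + ?L * (?L * D)))"
  proof -
    have "?h * L2_norm_on ?\<Omega> ?e' \<le> ?h * (2 * A + ?L * D)"
      using mesh_size_bounds[OF T] by (intro mult_left_mono e'b) simp
    also have "\<dots> \<le> ?h * (2 * A) + ?L * (?L * D)"
      using mesh_size_bounds[OF T] D0 L0 by (simp add: distrib_left mult_right_mono)
    finally show ?thesis by simp
  qed
  finally show "L2_norm_on ?\<Omega> ?e \<le> 4 * ?h * A + 4 * ?L\<^sup>2 * D"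
    by (simp add: power2_eq_square algebra_simps)
qed

text \<open>The previous estimate with the interpolant for \<open>w\<close>, expressed in weak derivatives. It serves both
  components of the system, which differ only in the data.\<close>

lemma sobolev_galerkin_error:
  assumes T: "interval_partition {a<..<b} \<T>" "a < b" and s: "1 \<le> s" "s \<le> real r" "2 \<le> r"
    and u: "u \<in> sobolev_1_0 {a<..<b}" "u \<in> sobolev {a<..<b} s" and w: "w \<in> fe_space {a<..<b} r \<T>"
    and F: "F \<in> L2_on {a<..<b}" and G: "G \<in> L2_on {a<..<b}"
    and equ: "\<And>\<psi>. \<psi> \<in> sobolev_1_0 {a<..<b} \<Longrightarrow>
      L2_inner_on {a<..<b} (weak_grad {a<..<b} u) (weak_grad {a<..<b} \<psi>) = - L2_inner_on {a<..<b} F \<psi>"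
    and eqw: "\<And>\<psi>. \<psi> \<in> fe_space {a<..<b} r \<T> \<Longrightarrow>
      L2_inner_on {a<..<b} (weak_grad {a<..<b} w) (weak_grad {a<..<b} \<psi>) = - L2_inner_on {a<..<b} G \<psi>"
  defines "h \<equiv> mesh_size \<T>" and "D \<equiv> L2_norm_on {a<..<b} (\<lambda>x. F x - G x)"
  shows "L2_norm_on {a<..<b} (weak_grad {a<..<b} (\<lambda>x. u x - w x))
      \<le> 2 * (h powr (s - 1) * sobolev_norm {a<..<b} s u) + (b - a) * D"
    and "L2_norm_on {a<..<b} (\<lambda>x. u x - w x)
      \<le> 4 * (h powr s * sobolev_norm {a<..<b} s u) + 4 * (b - a)\<^sup>2 * D"
proof -
  let ?\<Omega> = "{a<..<b}"
  let ?g = "weak_grad ?\<Omega> u"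
  have h: "0 < h" unfolding h_def by (rule mesh_size_bounds(1)[OF T])
  obtain U where U: "L2_primitive a b U ?g" "U a = 0" "U b = 0" "AE x in lebesgue_on ?\<Omega>. u x = U x"
    using sobolev_1_0_L2_primitive[OF u(1) T(2)] by blast
  note gL = L2_primitive_L2(2)[OF U(1)]
  obtain v where v: "v \<in> fe_space ?\<Omega> r \<T>"
    "L2_norm_on ?\<Omega> (\<lambda>x. ?g x - deriv v x) \<le> h powr (s - 1) * sobolev_norm ?\<Omega> s u"
    using fe_interpolation[OF T u(2) U(1-3) s] unfolding h_def by blast
  have eqU: "L2_inner_on ?\<Omega> ?g \<psi>' = - L2_inner_on ?\<Omega> F \<psi>"
    if \<psi>: "\<psi> \<in> fe_space ?\<Omega> r \<T>" "L2_primitive a b \<psi> \<psi>'" for \<psi> \<psi>'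
  proof (rule weak_equation_extends[OF gL F T(2) equ \<psi>(2)])
    show "\<psi> a = 0" "\<psi> b = 0" using \<psi>(1) unfolding fe_space_alt[OF T(2)] by blast+
  qed
  have grad: "AE x in lebesgue_on ?\<Omega>. \<psi>' x = weak_grad ?\<Omega> \<psi> x" "weak_grad ?\<Omega> \<psi> \<in> L2_on ?\<Omega>"
    if "L2_primitive a b \<psi> \<psi>'" for \<psi> \<psi>'
    by (rule weak_deriv_props[OF L2_primitive_has_weak_deriv[OF that T(2)] L2_primitive_L2(2)[OF that] T(2)])+
  note wp = fe_space_L2_primitive[OF T w]
  have eqW: "L2_inner_on ?\<Omega> (deriv w) \<psi>' = - L2_inner_on ?\<Omega> G \<psi>"
    if \<psi>: "\<psi> \<in> fe_space ?\<Omega> r \<T>" "L2_primitive a b \<psi> \<psi>'" for \<psi> \<psi>'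
  proof -
    have "L2_inner_on ?\<Omega> (deriv w) \<psi>' = L2_inner_on ?\<Omega> (weak_grad ?\<Omega> w) (weak_grad ?\<Omega> \<psi>)"
      by (rule L2_inner_cong_AE[OF L2_primitive_L2(2)[OF wp] L2_primitive_L2(2)[OF \<psi>(2)] grad(2)[OF wp] grad(2)[OF \<psi>(2)]
            grad(1)[OF wp] grad(1)[OF \<psi>(2)]])
    then show ?thesis using eqw[OF \<psi>(1)] by simp
  qed
  note err = galerkin_error[OF T s(3) U(1-3) v(1) w F G eqU eqW, folded D_def h_def]
  have "u \<in> sobolev ?\<Omega> 1" using u(1) by (simp add: sobolev_1_0_def)
  then have wu: "has_weak_deriv ?\<Omega> 1 u ?g" using sobolev_weak_deriv(1)[OF _ _ T(2), of u 1 1] by simp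
  note weak = has_weak_deriv_diff[OF wu L2_primitive_has_weak_deriv[OF wp T(2)] T(2)]
  have "L2_norm_on ?\<Omega> (weak_grad ?\<Omega> (\<lambda>x. u x - w x)) = L2_norm_on ?\<Omega> (\<lambda>x. ?g x - deriv w x)"
    by (rule weak_deriv_props(4)[OF weak L2_on_diff[OF gL L2_primitive_L2(2)[OF wp]] T(2)])
  then show "L2_norm_on ?\<Omega> (weak_grad ?\<Omega> (\<lambda>x. u x - w x))
      \<le> 2 * (h powr (s - 1) * sobolev_norm ?\<Omega> s u) + (b - a) * D"
    using err(1) v(2) by linarith
  have uL: "u \<in> L2_on ?\<Omega>" using u(2) by (simp add: sobolev_def)
  have "AE x in lebesgue_on ?\<Omega>. u x - w x = U x - w x" using U(4) by eventually_elim simp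
  then have "L2_norm_on ?\<Omega> (\<lambda>x. u x - w x) = L2_norm_on ?\<Omega> (\<lambda>x. U x - w x)"
    by (intro L2_norm_cong_AE L2_on_diff uL L2_primitive_L2(1)[OF U(1)] L2_primitive_L2(1)[OF wp])
  also have "\<dots> \<le> 4 * h * L2_norm_on ?\<Omega> (\<lambda>x. ?g x - deriv v x) + 4 * (b - a)\<^sup>2 * D" by (rule err(2))
  also have "\<dots> \<le> 4 * h * (h powr (s - 1) * sobolev_norm ?\<Omega> s u) + 4 * (b - a)\<^sup>2 * D"
    using v(2) h by (intro add_right_mono mult_left_mono) auto
  also have "\<dots> = 4 * (h powr s * sobolev_norm ?\<Omega> s u) + 4 * (b - a)\<^sup>2 * D"
    using h by (simp add: powr_diff)
  finally show "L2_norm_on ?\<Omega> (\<lambda>x. u x - w x)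
      \<le> 4 * (h powr s * sobolev_norm ?\<Omega> s u) + 4 * (b - a)\<^sup>2 * D" .
qed

section \<open>The power nonlinearity\<close>

lemma powr_subadditive:
  fixes x y \<alpha> :: real
  assumes "0 \<le> x" "0 \<le> y" "0 \<le> \<alpha>" "\<alpha> \<le> 1"
  shows "(x + y) powr \<alpha> \<le> x powr \<alpha> + y powr \<alpha>"
proof (cases "x = 0 \<or> y = 0")
  case False
  then have xy: "0 < x" "0 < y" using assms by auto
  have split: "z powr \<alpha> = z * z powr (\<alpha> - 1)" if "0 < z" for z :: real
    using that by (simp add: powr_diff)
  have "(x + y) powr \<alpha> = x * (x + y) powr (\<alpha> - 1) + y * (x + y) powr (\<alpha> - 1)"
    using split[of "x + y"] xy by (simp add: distrib_right)
  also have "\<dots> \<le> x * x powr (\<alpha> - 1) + y * y powr (\<alpha> - 1)"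
    using xy assms by (intro add_mono mult_left_mono powr_mono2') auto
  also have "\<dots> = x powr \<alpha> + y powr \<alpha>" using split xy by simp
  finally show ?thesis .
qed auto

text \<open>A concave power lies below this affine function. With a suitable \<open>\<mu>\<close> it replaces Jensen's
  inequality.\<close>

lemma powr_le_affine:
  fixes x \<mu> \<alpha> :: real
  assumes "0 \<le> x" "0 < \<mu>" "0 \<le> \<alpha>" "\<alpha> \<le> 1"
  shows "x powr \<alpha> \<le> \<mu> powr \<alpha> + \<mu> powr (\<alpha> - 1) * x"
proof (cases "x \<le> \<mu>")
  case True
  then have "x powr \<alpha> \<le> \<mu> powr \<alpha>" using assms by (intro powr_mono2) auto
  then show ?thesis using assms by (simp add: add_increasing2)
next
  case False
  then have "x powr \<alpha> = x powr (\<alpha> - 1) * x" using assms by (simp add: powr_diff)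
  also have "\<dots> \<le> \<mu> powr (\<alpha> - 1) * x"
    using False assms by (intro mult_right_mono powr_mono2') auto
  finally show ?thesis by (simp add: add_increasing)
qed

lemma power_nl_nonneg: "0 \<le> t \<Longrightarrow> power_nl q t = t powr (q - 1)"
  by (cases "t = 0") (simp_all add: power_nl_def powr_diff power2_eq_square)

lemma power_nl_minus: "power_nl q (- t) = - power_nl q t"
  by (simp add: power_nl_def)

text \<open>For arguments of the same sign this is the subadditivity of the power with exponent
  \<open>q - 1 \<le> 1\<close>. For opposite signs both terms are bounded by the power of the distance, which gives
  the factor 2.\<close>

lemma power_nl_Hoelder:
  assumes "1 \<le> q" "q \<le> 2"
  shows "\<bar>power_nl q s - power_nl q t\<bar> \<le> 2 * \<bar>s - t\<bar> powr (q - 1)"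
proof -
  have same: "\<bar>power_nl q s - power_nl q t\<bar> \<le> 2 * \<bar>s - t\<bar> powr (q - 1)" if st: "0 \<le> t" "t \<le> s" for s t
  proof -
    have "s powr (q - 1) \<le> (s - t) powr (q - 1) + t powr (q - 1)"
      using powr_subadditive[of "s - t" t "q - 1"] st assms by simp
    moreover have "t powr (q - 1) \<le> s powr (q - 1)" using st assms by (intro powr_mono2) auto
    moreover have "0 \<le> (s - t) powr (q - 1)" by simp
    ultimately show ?thesis using st by (simp add: power_nl_nonneg)
  qed
  have opp: "\<bar>power_nl q s - power_nl q t\<bar> \<le> 2 * \<bar>s - t\<bar> powr (q - 1)" if st: "t \<le> 0" "0 \<le> s" for s t
  proof -
    have "s powr (q - 1) \<le> (s - t) powr (q - 1)" "(- t) powr (q - 1) \<le> (s - t) powr (q - 1)"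
      using st assms by (auto intro!: powr_mono2)
    moreover have "power_nl q t = - ((- t) powr (q - 1))"
      using power_nl_minus[of q "- t"] power_nl_nonneg[of "- t" q] st by simp
    moreover have "\<bar>s - t\<bar> = s - t" using st by simp
    ultimately show ?thesis using st by (simp add: power_nl_nonneg)
  qed
  have ord: "\<bar>power_nl q s - power_nl q t\<bar> \<le> 2 * \<bar>s - t\<bar> powr (q - 1)" if "t \<le> s" for s t
  proof -
    consider "0 \<le> t" | "s \<le> 0" | "t \<le> 0" "0 \<le> s" by linarith
    then show ?thesis
    proof cases
      case 2
      then show ?thesis using same[of "- s" "- t"] that by (simp add: power_nl_minus abs_minus_commute)
    qed (use same opp that in auto)
  qed
  show ?thesis
    using ord[of s t] ord[of t s] by (cases "t \<le> s") (auto simp: abs_minus_commute)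
qed

lemma square_powr_abs: "(\<bar>t\<bar> powr \<alpha>)\<^sup>2 = (t\<^sup>2) powr \<alpha>" for t \<alpha> :: real
proof -
  have "(\<bar>t\<bar> powr \<alpha>)\<^sup>2 = (\<bar>t\<bar> * \<bar>t\<bar>) powr \<alpha>" by (simp only: power2_eq_square powr_mult abs_ge_zero)
  then show ?thesis by (simp add: power2_eq_square)
qed

lemma power_nl_L2:
  assumes v: "v \<in> L2_on S" and "S \<in> lmeasurable" and q: "1 \<le> q" "q \<le> 2"
  shows "(\<lambda>x. power_nl q (v x)) \<in> L2_on S"
proof -
  have [measurable]: "v \<in> borel_measurable (lebesgue_on S)" using v by (simp add: L2_on_def)
  have m: "(\<lambda>x. power_nl q (v x)) \<in> borel_measurable (lebesgue_on S)"
    unfolding power_nl_def by measurable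
  have "integrable (lebesgue_on S) (\<lambda>x. (power_nl q (v x))\<^sup>2)"
  proof (rule Bochner_Integration.integrable_bound)
    show "integrable (lebesgue_on S) (\<lambda>x. 4 * (1 + (v x)\<^sup>2))"
      using v finite_measure.integrable_const[OF finite_measure_lebesgue_on[OF \<open>S \<in> lmeasurable\<close>]]
      by (intro integrable_mult_right Bochner_Integration.integrable_add) (auto simp: L2_on_def)
    show "(\<lambda>x. (power_nl q (v x))\<^sup>2) \<in> borel_measurable (lebesgue_on S)" using m by measurable
    have "(power_nl q t)\<^sup>2 \<le> 4 * (1 + t\<^sup>2)" for t
    proof -
      have "\<bar>power_nl q t\<bar> \<le> 2 * \<bar>t\<bar> powr (q - 1)"
        using power_nl_Hoelder[OF q, of t 0] by (simp add: power_nl_def)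
      then have "\<bar>power_nl q t\<bar>\<^sup>2 \<le> (2 * \<bar>t\<bar> powr (q - 1))\<^sup>2" by (intro power_mono) auto
      also have "\<dots> = 4 * (t\<^sup>2) powr (q - 1)" by (simp add: power_mult_distrib square_powr_abs)
      also have "(t\<^sup>2) powr (q - 1) \<le> 1 + t\<^sup>2"
        using powr_le_affine[of "t\<^sup>2" 1 "q - 1"] q by simp
      finally show ?thesis by simp
    qed
    then show "AE x in lebesgue_on S. norm ((power_nl q (v x))\<^sup>2) \<le> norm (4 * (1 + (v x)\<^sup>2))"
      by (intro AE_I2) (simp add: add_nonneg_nonneg)
  qed
  with m show ?thesis by (simp add: L2_on_def)
qed

text \<open>Only the bound \<open>B\<close> for the norm enters, not the norm itself, since the right-hand side is to be
  compared with powers of the mesh size.\<close>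

lemma power_nl_L2_Hoelder:
  assumes v: "v \<in> L2_on {a<..<b}" and w: "w \<in> L2_on {a<..<b}" and q: "1 < q" "q \<le> 2" and "a \<le> b"
    and B: "L2_norm_on {a<..<b} (\<lambda>x. v x - w x) \<le> B"
  shows "L2_norm_on {a<..<b} (\<lambda>x. power_nl q (v x) - power_nl q (w x)) \<le> 2 * sqrt (b - a + 1) * B powr (q - 1)"
proof -
  let ?\<Omega> = "{a<..<b}" and ?e = "\<lambda>x. v x - w x" and ?N = "\<lambda>x. power_nl q (v x) - power_nl q (w x)"
  have N: "?N \<in> L2_on ?\<Omega>" using q by (intro L2_on_diff power_nl_L2 v w) auto
  have e: "?e \<in> L2_on ?\<Omega>" by (intro L2_on_diff v w)
  show ?thesis
  proof (cases "B = 0")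
    case True
    then have "L2_norm_on ?\<Omega> ?e = 0" using B L2_norm_nonneg[of ?\<Omega> ?e] by simp
    then have "(LINT x|lebesgue_on ?\<Omega>. (?e x)\<^sup>2) = 0"
      using L2_norm_square[of ?\<Omega> ?e] by (simp add: L2_inner_on_def power2_eq_square)
    then have "AE x in lebesgue_on ?\<Omega>. (?e x)\<^sup>2 = 0"
      using e by (subst (asm) integral_nonneg_eq_0_iff_AE) (auto simp: L2_on_def)
    then have "AE x in lebesgue_on ?\<Omega>. ?N x = 0" by eventually_elim simp
    then have "L2_norm_on ?\<Omega> ?N = L2_norm_on ?\<Omega> (\<lambda>_. 0)"
      by (intro L2_norm_cong_AE N L2_on_const) simp_all
    then show ?thesis using \<open>a \<le> b\<close> by (simp add: L2_norm_on_def L2_inner_on_def)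
  next
    case False
    then have "0 < B" using B L2_norm_nonneg[of ?\<Omega> ?e] by linarith
    \<comment> \<open>The affine bound is used at the square of \<open>B\<close>, which balances its two terms after integration.\<close>
    let ?\<mu> = "B\<^sup>2" and ?\<alpha> = "q - 1"
    note nN = L2_norm_Icc[OF N] and ne = L2_norm_Icc[OF e]
    have pt: "(?N x)\<^sup>2 \<le> 4 * (?\<mu> powr ?\<alpha> + ?\<mu> powr (?\<alpha> - 1) * (?e x)\<^sup>2)" for x
    proof -
      have "\<bar>?N x\<bar>\<^sup>2 \<le> (2 * \<bar>?e x\<bar> powr ?\<alpha>)\<^sup>2"
        using q by (intro power_mono power_nl_Hoelder) auto
      also have "\<dots> = 4 * ((?e x)\<^sup>2) powr ?\<alpha>"
        by (simp add: power_mult_distrib square_powr_abs)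
      also have "\<dots> \<le> 4 * (?\<mu> powr ?\<alpha> + ?\<mu> powr (?\<alpha> - 1) * (?e x)\<^sup>2)"
        using powr_le_affine[of "(?e x)\<^sup>2" ?\<mu> ?\<alpha>] q \<open>0 < B\<close> by simp
      finally show ?thesis by simp
    qed
    have "integral {a..b} (\<lambda>x. (?N x)\<^sup>2) \<le> integral {a..b} (\<lambda>x. 4 * (?\<mu> powr ?\<alpha> + ?\<mu> powr (?\<alpha> - 1) * (?e x)\<^sup>2))"
      by (intro integral_le nN(1) integrable_on_mult_right integrable_add ne(1) pt) auto
    also have "\<dots> = 4 * ((b - a) * ?\<mu> powr ?\<alpha> + ?\<mu> powr (?\<alpha> - 1) * integral {a..b} (\<lambda>x. (?e x)\<^sup>2))"
    proof (rule integral_unique, intro has_integral_mult_right has_integral_add integrable_integral ne(1))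
      show "((\<lambda>x. ?\<mu> powr ?\<alpha>) has_integral (b - a) * ?\<mu> powr ?\<alpha>) {a..b}"
        using has_integral_const_real[of "?\<mu> powr ?\<alpha>" a b] \<open>a \<le> b\<close> by simp
    qed
    also have "\<dots> \<le> 4 * ((b - a) * ?\<mu> powr ?\<alpha> + ?\<mu> powr (?\<alpha> - 1) * ?\<mu>)"
      using power_mono[OF B L2_norm_nonneg, of 2] by (intro mult_left_mono add_left_mono) (auto simp: ne(2))
    also have "\<dots> = 4 * (b - a + 1) * ?\<mu> powr ?\<alpha>"
    proof -
      have "?\<mu> powr (?\<alpha> - 1) * ?\<mu> = ?\<mu> powr ?\<alpha>"
        using powr_add[of ?\<mu> "?\<alpha> - 1" 1] \<open>0 < B\<close> by simp
      then show ?thesis by (simp only: distrib_right mult_1_left mult.assoc)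
    qed
    also have "\<dots> = (2 * sqrt (b - a + 1) * B powr ?\<alpha>)\<^sup>2"
      using \<open>a \<le> b\<close> \<open>0 < B\<close> by (simp add: power_mult_distrib power2_eq_square powr_mult)
    finally have "(L2_norm_on ?\<Omega> ?N)\<^sup>2 \<le> (2 * sqrt (b - a + 1) * B powr ?\<alpha>)\<^sup>2" by (simp add: nN(2))
    then show ?thesis by (rule power2_le_imp_le) (use \<open>a \<le> b\<close> in simp)
  qed
qed

section \<open>The error estimates\<close>

theorem theorem4p5:
  fixes a b p q s :: real and r :: nat and \<Omega> :: "real set"
  assumes "a < b" and "\<Omega> = {a<..<b}"
    and "2 < p" and "q = p / (p - 1)"
    and "2 \<le> r" and "1 \<le> s" and "s \<le> real r"
  shows "\<exists>C::real. \<forall>f u v \<T> u\<^sub>h v\<^sub>h h.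
    f \<in> L2_on \<Omega> \<and> weak_solution \<Omega> q f u v \<and> u \<in> sobolev \<Omega> s \<and> v \<in> sobolev \<Omega> s \<and>
    interval_partition \<Omega> \<T> \<and> h = mesh_size \<T> \<and> discrete_solution \<Omega> q r \<T> f u\<^sub>h v\<^sub>h \<longrightarrow>
      L2_norm_on \<Omega> (weak_grad \<Omega> (\<lambda>x. v x - v\<^sub>h x)) \<le> C * h powr (s - 1) * sobolev_norm \<Omega> s v \<and>
      L2_norm_on \<Omega> (\<lambda>x. v x - v\<^sub>h x) \<le> C * h powr s * sobolev_norm \<Omega> s v \<and>
      L2_norm_on \<Omega> (weak_grad \<Omega> (\<lambda>x. u x - u\<^sub>h x)) \<le>
        C * h powr (s - 1) * sobolev_norm \<Omega> s u +
        C * h powr (s / (p - 1)) * sobolev_norm \<Omega> s v powr (1 / (p - 1)) \<and>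
      L2_norm_on \<Omega> (\<lambda>x. u x - u\<^sub>h x) \<le>
        C * h powr s * sobolev_norm \<Omega> s u +
        C * (h powr ((s + p - 1) / (p - 1)) + h powr (s / (p - 1))) *
          sobolev_norm \<Omega> s v powr (1 / (p - 1))"
proof -
  let ?L = "b - a" and ?K = "2 * sqrt (b - a + 1)"
  \<comment> \<open>The three summands absorb the interpolation errors and, by way of the nonlinearity, the error of \<open>v\<close> in the two estimates for \<open>u\<close>.\<close>
  define C where "C = 4 + 4 * ?L * ?K + 16 * ?L\<^sup>2 * ?K"
  have L: "0 < ?L" using \<open>a < b\<close> by simp
  have K: "0 \<le> ?K" using L by simp
  have C: "4 \<le> C" "4 * ?L * ?K \<le> C" "16 * ?L\<^sup>2 * ?K \<le> C" using L K by (simp_all add: C_def)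
  have q1: "q - 1 = 1 / (p - 1)" using assms(3,4) by (simp add: field_simps)
  have q: "1 < q" "q \<le> 2" unfolding assms(4) using assms(3) by (simp_all add: field_simps)
  have goal: "L2_norm_on \<Omega> (weak_grad \<Omega> (\<lambda>x. v x - v\<^sub>h x)) \<le> C * h powr (s - 1) * sobolev_norm \<Omega> s v \<and>
      L2_norm_on \<Omega> (\<lambda>x. v x - v\<^sub>h x) \<le> C * h powr s * sobolev_norm \<Omega> s v \<and>
      L2_norm_on \<Omega> (weak_grad \<Omega> (\<lambda>x. u x - u\<^sub>h x)) \<le>
        C * h powr (s - 1) * sobolev_norm \<Omega> s u +
        C * h powr (s / (p - 1)) * sobolev_norm \<Omega> s v powr (1 / (p - 1)) \<and>
      L2_norm_on \<Omega> (\<lambda>x. u x - u\<^sub>h x) \<le>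
        C * h powr s * sobolev_norm \<Omega> s u +
        C * (h powr ((s + p - 1) / (p - 1)) + h powr (s / (p - 1))) *
          sobolev_norm \<Omega> s v powr (1 / (p - 1))"
    if f: "f \<in> L2_on \<Omega>" and sol: "weak_solution \<Omega> q f u v" and us: "u \<in> sobolev \<Omega> s" and vs: "v \<in> sobolev \<Omega> s"
      and T: "interval_partition \<Omega> \<T>" and hT: "h = mesh_size \<T>" and dis: "discrete_solution \<Omega> q r \<T> f u\<^sub>h v\<^sub>h"
    for f u v \<T> u\<^sub>h v\<^sub>h h
  proof -
    note \<Omega> = \<open>\<Omega> = {a<..<b}\<close>
    note T' = T[unfolded \<Omega>]
    let ?Nu = "sobolev_norm \<Omega> s u" and ?Nv = "sobolev_norm \<Omega> s v"
    have h: "0 < h" unfolding hT by (rule mesh_size_bounds(1)[OF T' \<open>a < b\<close>])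
    have Nu: "0 \<le> ?Nu" and Nv: "0 \<le> ?Nv" by (rule sobolev_norm_nonneg)+
    have fe: "u\<^sub>h \<in> fe_space {a<..<b} r \<T>" "v\<^sub>h \<in> fe_space {a<..<b} r \<T>"
      using dis by (simp_all add: discrete_solution_def \<Omega>)
    have vL: "v \<in> L2_on {a<..<b}" using vs by (simp add: sobolev_def \<Omega>)
    have vhL: "v\<^sub>h \<in> L2_on {a<..<b}"
      by (rule L2_primitive_L2(1)[OF fe_space_L2_primitive[OF T' \<open>a < b\<close> fe(2)]])
    note sobolev_galerkin_error[OF T' \<open>a < b\<close> assms(6,7,5)]
    note err = this[of v v\<^sub>h f f, folded \<Omega> hT]
    have ev: "L2_norm_on \<Omega> (weak_grad \<Omega> (\<lambda>x. v x - v\<^sub>h x)) \<le> 2 * (h powr (s - 1) * ?Nv)"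
      "L2_norm_on \<Omega> (\<lambda>x. v x - v\<^sub>h x) \<le> 4 * (h powr s * ?Nv)"
    proof -
      have "L2_norm_on \<Omega> (\<lambda>x. f x - f x) = 0" by (simp add: L2_norm_on_def L2_inner_on_def)
      moreover have "v \<in> sobolev_1_0 \<Omega>" "v\<^sub>h \<in> fe_space \<Omega> r \<T>"
        using sol dis by (simp_all add: weak_solution_def discrete_solution_def)
      moreover have "\<And>\<psi>. \<psi> \<in> sobolev_1_0 \<Omega> \<Longrightarrow> L2_inner_on \<Omega> (weak_grad \<Omega> v) (weak_grad \<Omega> \<psi>) = - L2_inner_on \<Omega> f \<psi>"
        using sol unfolding weak_solution_def by blast
      moreover have "\<And>\<psi>. \<psi> \<in> fe_space \<Omega> r \<T> \<Longrightarrow> L2_inner_on \<Omega> (weak_grad \<Omega> v\<^sub>h) (weak_grad \<Omega> \<psi>) = - L2_inner_on \<Omega> f \<psi>"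
        using dis unfolding discrete_solution_def by blast
      ultimately show "L2_norm_on \<Omega> (weak_grad \<Omega> (\<lambda>x. v x - v\<^sub>h x)) \<le> 2 * (h powr (s - 1) * ?Nv)"
        "L2_norm_on \<Omega> (\<lambda>x. v x - v\<^sub>h x) \<le> 4 * (h powr s * ?Nv)"
        using err vs f by simp_all
    qed
    let ?F = "\<lambda>x. power_nl q (v x)" and ?G = "\<lambda>x. power_nl q (v\<^sub>h x)"
    let ?D = "L2_norm_on \<Omega> (\<lambda>x. ?F x - ?G x)" and ?R = "h powr (s / (p - 1)) * ?Nv powr (1 / (p - 1))"
    have eu: "L2_norm_on \<Omega> (weak_grad \<Omega> (\<lambda>x. u x - u\<^sub>h x)) \<le> 2 * (h powr (s - 1) * ?Nu) + ?L * ?D"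
      "L2_norm_on \<Omega> (\<lambda>x. u x - u\<^sub>h x) \<le> 4 * (h powr s * ?Nu) + 4 * ?L\<^sup>2 * ?D"
    proof -
      have "?F \<in> L2_on \<Omega>" "?G \<in> L2_on \<Omega>"
        unfolding \<Omega> using q by (intro power_nl_L2 vL vhL; simp)+
      moreover have "u \<in> sobolev_1_0 \<Omega>" "u\<^sub>h \<in> fe_space \<Omega> r \<T>"
        using sol dis by (simp_all add: weak_solution_def discrete_solution_def)
      moreover have "\<And>\<psi>. \<psi> \<in> sobolev_1_0 \<Omega> \<Longrightarrow> L2_inner_on \<Omega> (weak_grad \<Omega> u) (weak_grad \<Omega> \<psi>) = - L2_inner_on \<Omega> ?F \<psi>"
        using sol unfolding weak_solution_def by blast
      moreover have "\<And>\<psi>. \<psi> \<in> fe_space \<Omega> r \<T> \<Longrightarrow> L2_inner_on \<Omega> (weak_grad \<Omega> u\<^sub>h) (weak_grad \<Omega> \<psi>) = - L2_inner_on \<Omega> ?G \<psi>"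
        using dis unfolding discrete_solution_def by blast
      ultimately show "L2_norm_on \<Omega> (weak_grad \<Omega> (\<lambda>x. u x - u\<^sub>h x)) \<le> 2 * (h powr (s - 1) * ?Nu) + ?L * ?D"
        "L2_norm_on \<Omega> (\<lambda>x. u x - u\<^sub>h x) \<le> 4 * (h powr s * ?Nu) + 4 * ?L\<^sup>2 * ?D"
        using sobolev_galerkin_error[OF T' \<open>a < b\<close> assms(6,7,5), of u u\<^sub>h ?F ?G, folded \<Omega> hT] us by simp_all
    qed
    have D: "?D \<le> ?K * (4 * ?R)"
    proof -
      have "?D \<le> ?K * (4 * (h powr s * ?Nv)) powr (q - 1)"
        unfolding \<Omega> using ev(2) \<open>a < b\<close> unfolding \<Omega> by (intro power_nl_L2_Hoelder vL vhL q) auto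
      also have "(4 * (h powr s * ?Nv)) powr (q - 1) = 4 powr (q - 1) * ?R"
        using h Nv by (simp add: powr_mult powr_powr q1)
      also have "?K * (4 powr (q - 1) * ?R) \<le> ?K * (4 * ?R)"
        using powr_mono[of "q - 1" 1 "4 :: real"] q by (intro mult_left_mono[OF _ K] mult_right_mono) auto
      finally show ?thesis .
    qed
    have R: "0 \<le> ?R" by simp
    have 1: "2 * (h powr (s - 1) * ?Nv) \<le> C * h powr (s - 1) * ?Nv" "2 * (h powr (s - 1) * ?Nu) \<le> C * h powr (s - 1) * ?Nu"
      "4 * (h powr s * ?Nv) \<le> C * h powr s * ?Nv" "4 * (h powr s * ?Nu) \<le> C * h powr s * ?Nu"
      unfolding mult.assoc using C(1) Nu Nv by (intro mult_right_mono; simp)+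
    have "?L * ?D \<le> ?L * (?K * (4 * ?R))" using L by (intro mult_left_mono[OF D]) simp
    also have "\<dots> = 4 * ?L * ?K * ?R" by (simp only: mult_ac)
    also have "\<dots> \<le> C * ?R" by (rule mult_right_mono[OF C(2) R])
    finally have 2: "?L * ?D \<le> C * ?R" .
    have "4 * ?L\<^sup>2 * ?D \<le> 4 * ?L\<^sup>2 * (?K * (4 * ?R))" by (intro mult_left_mono[OF D]) simp
    also have "\<dots> = 16 * ?L\<^sup>2 * ?K * ?R" by simp
    also have "\<dots> \<le> C * ?R" by (rule mult_right_mono[OF C(3) R])
    also have "\<dots> \<le> C * (h powr ((s + p - 1) / (p - 1)) + h powr (s / (p - 1))) * ?Nv powr (1 / (p - 1))"
      unfolding mult.assoc using C(1) by (intro mult_left_mono mult_right_mono) auto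
    finally have 3: "4 * ?L\<^sup>2 * ?D \<le> C * (h powr ((s + p - 1) / (p - 1)) + h powr (s / (p - 1))) * ?Nv powr (1 / (p - 1))" .
    show ?thesis
      using ev eu 1 2 3 by (auto simp: mult.assoc intro: order_trans add_mono)
  qed
  show ?thesis by (intro exI[of _ C] allI impI) (elim conjE, rule goal)
qed

end
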